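(* Let $g \geq 1$ and let $f = x^{2g+1} + c_2 x^{2g-1} + \dots + c_{2g+1} \in \mathbb{Z}[x]$ be a polynomial of nonzero discriminant. Let $(U, V, R)$ be a Mumford triple for $f$ over $\mathbb{Q}$ with associated divisor $D$, and let $M \in \mathbb{N}$ be the least (positive) natural number such that $M U \in \mathbb{Z}[x]$. Then $M = N^2$ is a square. Suppose moreover that $(U, f) = 1$ (i.e. $U$ and $f$ are coprime). Then there exists a $\mathbb{Z}$-lattice $M_D \leq W_D$ such that $T_D M_D \leq M_D$ and there is a primitive vector $v_D \in M_D$ satisfying $$\frac{1}{2} \log \langle v_D, v_D \rangle_{H_{T_D}} = \frac{1}{2} \log M + \frac{1}{2} \log \sum_{i=1}^{2g+1} \frac{ | U(\omega_i) |}{ | f'(\omega_i) |},$$ where $\omega_1, \dots, \omega_{2g+1} \in \mathbb{C}$ are the roots of $f(x)$.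
   Context: Mumford triples: for a field $k$ of characteristic $0$ and separable $f(x) = x^{2g+1} + c_2 x^{2g-1} + \dots + c_{2g+1} \in k[x]$, a Mumford triple for $f$ over $k$ is a tuple $(U,V,R)$ of polynomials in $k[x]$ such that, for some $0 \le m \le g$, $U$ is monic of degree $m$, $V$ is monic of degree $2g+1-m$, $\deg R \leq m-1$, and $UV = f - R^2$. Let $C_f^0 : y^2 = f(x)$, with smooth projective completion $C_f$ and point at infinity $P_\infty$. The associated divisor is $D = \sum_{i=1}^m P_i - mP_\infty$ where $P_i = (\alpha_i, R(\alpha_i))$ and $\alpha_1, \dots, \alpha_m$ are the roots of $U$ with multiplicity. The space $W_D$: let $A_f = k[x]/(f(x))$ and let $\tau : A_f \to k$ be the linear form sending a polynomial of degree $\le 2g$ to its coefficient of $x^{2g}$. Let $I_D = H^0(C_f^0, \mathcal{O}_{C_f}(-D))$, which is the ideal of $k[x,y]/(y^2 - f)$ with $k[x]$-basis $U, y-R$. Set $W_D = I_D / yI_D$, a free $A_f$-module of rank 1. For $v,w \in I_D$ set $\varphi_D(v \otimes w) = v\cdot\iota^*(w)/U \bmod y \in A_f$, where $\iota^*(y) = -y$, $\iota^*(x) = x$; thus $\varphi_D(U\otimes U) = U$, $\varphi_D(U \otimes (y-R)) = -R$, $\varphi_D((y-R)\otimes(y-R)) = -V$. Then $W_D$ is a quadratic space over $k$ of dimension $2g+1$ (finite-dimensional vector space with nondegenerate symmetric bilinear form) with form $(v,w)_{W_D} = (-1)^{\deg U}\tau(\varphi_D(v\otimes w))$, and $T_D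 : W_D \to W_D$, $T_D(v) = xv$, is a self-adjoint operator with characteristic polynomial $f$. Lattices: for a quadratic space $W_0$ over $\mathbb{Q}$, a $\mathbb{Z}$-lattice $M_0 \leq W_0$ is a $\mathbb{Z}$-submodule generated by a $\mathbb{Q}$-basis of $W_0$ such that $(\cdot,\cdot)_{W_0}$ takes values in $\mathbb{Z}$ on $M_0\times M_0$ and induces an isomorphism $M_0 \cong \mathrm{Hom}(M_0, \mathbb{Z})$. A vector of $M_0$ is primitive if it does not lie in $pM_0$ for any prime $p$. Inner product: let $W_0$ be a real quadratic space of dimension $2g+1$ and $T_0$ a self-adjoint operator on it with separable characteristic polynomial. An inner product $\langle\cdot,\cdot\rangle_H$ on $W_0$ is compatible with $(\cdot,\cdot)_{W_0}$ if $\varphi_H^{-1}\varphi_{W_0}$ is a $\langle\cdot,\cdot\rangle_H$-isometry, where $\varphi_{W_0}(v) = (v,\cdot)_{W_0}$ and $\varphi_H(v) = \langle v,\cdot\rangle_H$. There is a unique inner product $\langle\cdot,\cdot\rangle_{H_{T_0}}$ compatible with $(\cdot,\cdot)_{W_0}$ such that $T_0$ commutes with its $\langle\cdot,\cdot\rangle_{H_{T_0}}$-adjoint. (Explicitly, its Hermitian extension to $W_0\otimes_{\mathbb{R}}\mathbb{C}$ makes the $T_0$-eigenvectors $b_i$ orthogonal with $\langle b_i,b_i\rangle = |(b_i,b_i)_{W_0}|$.) In the claim, $\langle\cdot,\cdot\rangle_{H_{T_D}}$ is this inner product for $W_D\otimes_{\mathbb{Q}}\mathbb{R}$ and $T_D$.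 *)

theory Defs
  imports "HOL-Algebra.QuotRing" "Subresultants.Subresultant_Gcd" "Jordan_Normal_Form.VS_Connect"
begin

hide_const (open) Multiset.mult Polynomial.smult

definition poly_disc :: "'a :: idom_divide poly \<Rightarrow> 'a" where
  "poly_disc p =
     (- 1) ^ (degree p * (degree p - 1) div 2) * resultant p (pderiv p) div lead_coeff p"

text \<open>
  The bound \<open>deg R \<le> m - 1\<close> is to be read with \<open>deg 0 = - \<infinity>\<close>; in particular \<open>R = 0\<close> if \<open>m = 0\<close>.
\<close>

definition mumford_triple :: "nat \<Rightarrow> 'a :: field poly \<Rightarrow> 'a poly \<Rightarrow> 'a poly \<Rightarrow> 'a poly \<Rightarrow> bool" where
  "mumford_triple g f U V R \<longleftrightarrow>
     (\<exists>m \<le> g. lead_coeff U = 1 \<and> degree U = m \<and>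
              lead_coeff V = 1 \<and> degree V = 2 * g + 1 - m \<and>
              (R = 0 \<or> degree R < m)) \<and>
     U * V = f - R ^ 2"


section \<open>The space \<open>W\<^sub>D\<close>\<close>

text \<open>
  The ring \<open>k[x,y]/(y\<^sup>2 - f)\<close> is free over \<open>k[x]\<close> with basis \<open>1, y\<close>; the pair \<open>(a, b)\<close> stands for
  \<open>a + b y\<close>.
\<close>

definition coord_ring :: "'a :: field poly \<Rightarrow> ('a poly \<times> 'a poly) ring" where
  "coord_ring f =
     \<lparr> carrier = UNIV,
       mult = (\<lambda>(a, b) (c, d). (a * c + b * d * f, a * d + b * c)),
       one = (1, 0),
       zero = (0, 0),
       add = (\<lambda>(a, b) (c, d). (a + c, b + d)) \<rparr>"

definition hyp_invol :: "'a :: field poly \<times> 'a poly \<Rightarrow> 'a poly \<times> 'a poly" where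
  "hyp_invol = (\<lambda>(a, b). (a, - b))"

text \<open>The elements \<open>a U + b (y - R)\<close> with \<open>a\<close> and \<open>b\<close> in \<open>k[x]\<close>.\<close>

definition ideal_D :: "'a :: field poly \<Rightarrow> 'a poly \<Rightarrow> ('a poly \<times> 'a poly) set" where
  "ideal_D U R = {(a * U - b * R, b) | a b. True}"

definition y_ideal_D :: "'a :: field poly \<Rightarrow> 'a poly \<Rightarrow> 'a poly \<Rightarrow> ('a poly \<times> 'a poly) set" where
  "y_ideal_D f U R = (\<lambda>v. (0, 1) \<otimes>\<^bsub>coord_ring f\<^esub> v) ` ideal_D U R"

definition W_class ::
    "'a :: field poly \<Rightarrow> 'a poly \<Rightarrow> 'a poly \<Rightarrow> 'a poly \<times> 'a poly \<Rightarrow> ('a poly \<times> 'a poly) set" where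
  "W_class f U R v = y_ideal_D f U R +>\<^bsub>coord_ring f\<^esub> v"

text \<open>
  The quotient \<open>W\<^sub>D = I\<^sub>D / y I\<^sub>D\<close> as a \<open>k\<close>-vector space of cosets. The ring fields \<open>mult\<close> and \<open>one\<close>
  of the record have no meaning here.
\<close>

definition W_space ::
    "'a :: field poly \<Rightarrow> 'a poly \<Rightarrow> 'a poly \<Rightarrow> ('a, ('a poly \<times> 'a poly) set) module" where
  "W_space f U R =
     \<lparr> carrier = W_class f U R ` ideal_D U R,
       mult = undefined,
       one = undefined,
       zero = y_ideal_D f U R,
       add = set_add (coord_ring f),
       smult = (\<lambda>c X. \<Union>v\<in>X. W_class f U R (([:c:], 0) \<otimes>\<^bsub>coord_ring f\<^esub> v)) \<rparr>"

definition W_op ::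
    "'a :: field poly \<Rightarrow> 'a poly \<Rightarrow> 'a poly \<Rightarrow> ('a poly \<times> 'a poly) set \<Rightarrow> ('a poly \<times> 'a poly) set" where
  "W_op f U R X = (\<Union>v\<in>X. W_class f U R (([:0, 1:], 0) \<otimes>\<^bsub>coord_ring f\<^esub> v))"

text \<open>
  Elements of \<open>A\<^sub>f = k[x]/(f) = k[x,y]/(y\<^sup>2 - f, y)\<close> are represented by their remainders modulo \<open>f\<close>.
  For \<open>v\<close> and \<open>w\<close> in \<open>I\<^sub>D\<close>, both components of \<open>v \<cdot> \<iota>\<^sup>*(w)\<close> are multiples of \<open>U\<close>; reducing
  \<open>a + b y\<close> modulo \<open>y\<close> leaves \<open>a\<close>.
\<close>

definition phi_D ::
    "'a :: field poly \<Rightarrow> 'a poly \<Rightarrow> 'a poly \<times> 'a poly \<Rightarrow> 'a poly \<times> 'a poly \<Rightarrow> 'a poly" where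
  "phi_D f U v w = (fst (v \<otimes>\<^bsub>coord_ring f\<^esub> hyp_invol w) div U) mod f"

definition tau :: "'a :: field poly \<Rightarrow> 'a poly \<Rightarrow> 'a" where
  "tau f p = coeff (p mod f) (degree f - 1)"

text \<open>The value does not depend on the representatives \<open>v\<close> and \<open>w\<close> of the cosets.\<close>

definition W_form ::
    "'a :: field poly \<Rightarrow> 'a poly \<Rightarrow> ('a poly \<times> 'a poly) set \<Rightarrow> ('a poly \<times> 'a poly) set \<Rightarrow> 'a" where
  "W_form f U X Y = (THE c. \<exists>v\<in>X. \<exists>w\<in>Y. c = (- 1) ^ degree U * tau f (phi_D f U v w))"


section \<open>Lattices\<close>

definition Z_span :: "('a :: field, 'v) module \<Rightarrow> 'v set \<Rightarrow> 'v set" where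
  "Z_span W B = {\<Oplus>\<^bsub>W\<^esub>b\<in>B. of_int (n b) \<odot>\<^bsub>W\<^esub> b | n. True}"

definition Z_dual :: "(rat, 'v) module \<Rightarrow> 'v set \<Rightarrow> ('v \<Rightarrow> rat) set" where
  "Z_dual W M = {l \<in> M \<rightarrow>\<^sub>E \<int>. \<forall>v\<in>M. \<forall>w\<in>M. l (v \<oplus>\<^bsub>W\<^esub> w) = l v + l w}"

definition Z_lattice :: "(rat, 'v) module \<Rightarrow> ('v \<Rightarrow> 'v \<Rightarrow> rat) \<Rightarrow> 'v set \<Rightarrow> bool" where
  "Z_lattice W B M \<longleftrightarrow>
     (\<exists>E. finite E \<and> vectorspace.basis class_ring W E \<and> M = Z_span W E) \<and>
     (\<forall>v\<in>M. \<forall>w\<in>M. B v w \<in> \<int>) \<and>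
     bij_betw (\<lambda>v. \<lambda>w\<in>M. B v w) M (Z_dual W M)"

definition primitive_vector :: "(rat, 'v) module \<Rightarrow> 'v set \<Rightarrow> 'v \<Rightarrow> bool" where
  "primitive_vector W M v \<longleftrightarrow>
     v \<in> M \<and> \<not> (\<exists>p :: nat. prime p \<and> v \<in> (\<lambda>w. of_nat p \<odot>\<^bsub>W\<^esub> w) ` M)"


section \<open>The compatible inner product attached to a self-adjoint operator\<close>

definition inner_product :: "(real, 'v) module \<Rightarrow> ('v \<Rightarrow> 'v \<Rightarrow> real) \<Rightarrow> bool" where
  "inner_product W H \<longleftrightarrow>
     (\<forall>u\<in>carrier W. \<forall>v\<in>carrier W. \<forall>w\<in>carrier W. H (u \<oplus>\<^bsub>W\<^esub> v) w = H u w + H v w) \<and>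
     (\<forall>c. \<forall>v\<in>carrier W. \<forall>w\<in>carrier W. H (c \<odot>\<^bsub>W\<^esub> v) w = c * H v w) \<and>
     (\<forall>v\<in>carrier W. \<forall>w\<in>carrier W. H v w = H w v) \<and>
     (\<forall>v\<in>carrier W. v \<noteq> \<zero>\<^bsub>W\<^esub> \<longrightarrow> 0 < H v v)"

text \<open>The map \<open>v \<mapsto> B(v, -)\<close> to the dual space.\<close>

definition to_dual :: "(real, 'v) module \<Rightarrow> ('v \<Rightarrow> 'v \<Rightarrow> real) \<Rightarrow> 'v \<Rightarrow> 'v \<Rightarrow> real" where
  "to_dual W B v = (\<lambda>w\<in>carrier W. B v w)"

definition isometry :: "(real, 'v) module \<Rightarrow> ('v \<Rightarrow> 'v \<Rightarrow> real) \<Rightarrow> ('v \<Rightarrow> 'v) \<Rightarrow> bool" where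
  "isometry W H S \<longleftrightarrow>
     S \<in> module_hom class_ring W W \<and> bij_betw S (carrier W) (carrier W) \<and>
     (\<forall>v\<in>carrier W. \<forall>w\<in>carrier W. H (S v) (S w) = H v w)"

definition compatible :: "(real, 'v) module \<Rightarrow> ('v \<Rightarrow> 'v \<Rightarrow> real) \<Rightarrow> ('v \<Rightarrow> 'v \<Rightarrow> real) \<Rightarrow> bool" where
  "compatible W B H \<longleftrightarrow> isometry W H (\<lambda>v. inv_into (carrier W) (to_dual W H) (to_dual W B v))"

definition commutes_with_adjoint ::
    "(real, 'v) module \<Rightarrow> ('v \<Rightarrow> 'v \<Rightarrow> real) \<Rightarrow> ('v \<Rightarrow> 'v) \<Rightarrow> bool" where
  "commutes_with_adjoint W H T \<longleftrightarrow>
     (\<exists>S \<in> module_hom class_ring W W.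
        (\<forall>v\<in>carrier W. \<forall>w\<in>carrier W. H (T v) w = H v (S w)) \<and>
        (\<forall>v\<in>carrier W. T (S v) = S (T v)))"

text \<open>
  Functions in HOL are total, so uniqueness requires the values outside the carrier to be fixed.
\<close>

definition H_inner ::
    "(real, 'v) module \<Rightarrow> ('v \<Rightarrow> 'v \<Rightarrow> real) \<Rightarrow> ('v \<Rightarrow> 'v) \<Rightarrow> 'v \<Rightarrow> 'v \<Rightarrow> real" where
  "H_inner W B T = (THE H.
     inner_product W H \<and> compatible W B H \<and> commutes_with_adjoint W H T \<and>
     (\<forall>v w. v \<notin> carrier W \<or> w \<notin> carrier W \<longrightarrow> H v w = 0))"


section \<open>Extension of scalars from \<open>\<rat>\<close> to \<open>\<real>\<close>\<close>

text \<open>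
  The construction of \<open>W\<^sub>D\<close> commutes with extension of the base field: \<open>W\<^sub>D \<otimes> \<real>\<close>, with its form and
  operator, is the space attached to the same polynomials over \<open>\<real>\<close>, and \<open>v \<mapsto> v \<otimes> 1\<close> is given
  by reading the polynomials in a representative of \<open>v\<close> over \<open>\<real>\<close>.
\<close>

abbreviation real_poly :: "rat poly \<Rightarrow> real poly" where
  "real_poly \<equiv> map_poly of_rat"

definition W_base_change ::
    "rat poly \<Rightarrow> rat poly \<Rightarrow> rat poly \<Rightarrow> (rat poly \<times> rat poly) set \<Rightarrow> (real poly \<times> real poly) set" where
  "W_base_change f U R X =
     (\<Union>v\<in>X. W_class (real_poly f) (real_poly U) (real_poly R) (map_prod real_poly real_poly v))"

definition H_TD :: "rat poly \<Rightarrow> rat poly \<Rightarrow> rat poly \<Rightarrow>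
    (real poly \<times> real poly) set \<Rightarrow> (real poly \<times> real poly) set \<Rightarrow> real" where
  "H_TD f U R =
     H_inner (W_space (real_poly f) (real_poly U) (real_poly R))
             (W_form (real_poly f) (real_poly U))
             (W_op (real_poly f) (real_poly U) (real_poly R))"


section \<open>Basic facts\<close>

text \<open>
  \<open>W\<^sub>D\<close> is a vector space over \<open>k\<close>, and its operations, operator and form, as well as the base change
  map, are given on cosets by the expected formulas in representatives.
\<close>

lemma coord_ring_simps:
  "carrier (coord_ring f) = UNIV" "\<zero>\<^bsub>coord_ring f\<^esub> = (0,0)" "\<one>\<^bsub>coord_ring f\<^esub> = (1,0)"
  "u \<oplus>\<^bsub>coord_ring f\<^esub> v = (fst u + fst v, snd u + snd v)"
  "u \<otimes>\<^bsub>coord_ring f\<^esub> v = (fst u * fst v + snd u * snd v * f, fst u * snd v + snd u * fst v)"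
  by (simp_all add: coord_ring_def case_prod_beta)

context
  notes coord_ring_simps [simp]
begin

lemma cring_coord_ring: "cring (coord_ring f)"
proof (rule cringI)
  show "abelian_group (coord_ring f)"
  proof (rule abelian_groupI)
    fix x assume "x \<in> carrier (coord_ring f)"
    show "\<exists>y\<in>carrier (coord_ring f). y \<oplus>\<^bsub>coord_ring f\<^esub> x = \<zero>\<^bsub>coord_ring f\<^esub>"
      by (rule bexI[of _ "(- fst x, - snd x)"]) auto
  qed (auto simp: algebra_simps)
  show "comm_monoid (coord_ring f)"
    by (rule comm_monoidI) (auto simp: algebra_simps)
qed (auto simp: algebra_simps)

lemma y_ideal_D_iff: "v \<in> y_ideal_D f U R \<longleftrightarrow> (\<exists>a b. v = (b * f, a * U - b * R))"
proof -
  have "v \<in> y_ideal_D f U R \<longleftrightarrow> (\<exists>x\<in>ideal_D U R. v = (snd x * f, fst x))" by (auto simp: y_ideal_D_def)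
  also have "\<dots> \<longleftrightarrow> (\<exists>a b. v = (b * f, a * U - b * R))" unfolding ideal_D_def by fastforce
  finally show ?thesis .
qed

lemma W_class_iff: "w \<in> W_class f U R v \<longleftrightarrow> (\<exists>a b. w = (fst v + b * f, snd v + (a * U - b * R)))"
  by (force simp: W_class_def a_r_coset_def' y_ideal_D_iff algebra_simps)

lemma ideal_ideal_D:
  assumes "U * V = f - R^2" shows "ideal (ideal_D U R) (coord_ring f)"
proof -
  have f: "f = U * V + R^2" using assms by simp
  interpret cring "coord_ring f" by (rule cring_coord_ring)
  show ?thesis
  proof (rule idealI)
    show "subgroup (ideal_D U R) (add_monoid (coord_ring f))"
    proof (rule subgroup.intro, goal_cases)
      case (2 x y)
      then obtain a b c d where "x = (a*U-b*R,b)" "y = (c*U-d*R,d)" by (auto simp: ideal_D_def)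
      then have "x \<oplus>\<^bsub>coord_ring f\<^esub> y = ((a+c)*U-(b+d)*R,b+d)" by (simp add: algebra_simps)
      then show ?case by (auto simp: ideal_D_def)
    next
      case 3 have "(0,0) = (0*U-0*R,0::'a poly)" by simp
      then show ?case unfolding ideal_D_def by (simp; blast)
    next
      case (4 x)
      then obtain a b where x: "x = (a*U-b*R,b)" by (auto simp: ideal_D_def)
      have "inv\<^bsub>add_monoid (coord_ring f)\<^esub> x = ((-a)*U-(-b)*R,-b)"
        unfolding a_inv_def[symmetric]
        by (rule minus_equality) (auto simp: x algebra_simps)
      then show ?case unfolding ideal_D_def by blast
    qed auto
  next
    fix x y :: "'a poly \<times> 'a poly" assume "x \<in> ideal_D U R"
    then obtain a b where x: "x = (a*U-b*R,b)" by (auto simp: ideal_D_def)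
    obtain c d where y: "y = (c,d)" by (cases y)
    have "y \<otimes>\<^bsub>coord_ring f\<^esub> x = ((c*a + d*b*V + d*a*R)*U - (c*b + d*(a*U-b*R)) * R + (d*b*R^2 + d*(a*U-b*R)*R - d*a*R*U), c*b + d*(a*U-b*R))" 
      by (simp add: x y f algebra_simps power2_eq_square)
    then have "y \<otimes>\<^bsub>coord_ring f\<^esub> x = ((c*a + d*b*V + d*a*R)*U - (c*b + d*(a*U-b*R)) * R , c*b + d*(a*U-b*R))" 
      by (simp add: algebra_simps power2_eq_square)
    then show "y \<otimes>\<^bsub>coord_ring f\<^esub> x \<in> ideal_D U R" unfolding ideal_D_def by blast
    then show "x \<otimes>\<^bsub>coord_ring f\<^esub> y \<in> ideal_D U R" by (simp add: algebra_simps)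
  qed (rule ring_axioms)
qed

lemma phi_D_eq:
  assumes "U * V = f - R^2" "U \<noteq> 0"
  shows "phi_D f U (a*U-b*R,b) (c*U-d*R,d) = (a*c*U - (a*d+b*c)*R - b*d*V) mod f"
proof -
  have f: "f = U * V + R^2" using assms by simp
  have "fst ((a*U-b*R,b) \<otimes>\<^bsub>coord_ring f\<^esub> hyp_invol (c*U-d*R,d)) = U * (a*c*U - (a*d+b*c)*R - b*d*V)"
    by (simp add: hyp_invol_def f algebra_simps power2_eq_square)
  then show ?thesis using assms(2) by (simp only: phi_D_def nonzero_mult_div_cancel_left not_False_eq_True)
qed

lemma W_form_class:
  assumes "U * V = f - R^2" "U \<noteq> 0"
  shows "W_form f U (W_class f U R (a*U-b*R,b)) (W_class f U R (c*U-d*R,d)) =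
    (-1) ^ degree U * tau f (a*c*U - (a*d+b*c)*R - b*d*V)"
proof -
  have f: "f = U * V + R^2" using assms by simp
  have gen: "\<exists>a' b'. v = (a'*U-b'*R,b') \<and> (\<exists>s t. b' = b + (s*U - t*R) \<and> a' = a + t*V + s*R)"
    if vin: "v \<in> W_class f U R (a*U-b*R,b)" for v a b
  proof -
    obtain s t where v: "v = (a*U-b*R + t*f, b + (s*U-t*R))" using vin by (auto simp: W_class_iff)
    have "v = ((a + t*V + s*R)*U-(b + (s*U-t*R))*R,b + (s*U-t*R))"
      by (simp add: v f algebra_simps power2_eq_square)
    then show ?thesis by blast
  qed
  have cong: "(a'*c'*U - (a'*d'+b'*c')*R - b'*d'*V) mod f = (a*c*U - (a*d+b*c)*R - b*d*V) mod f"
    if "b' = b + (s*U - t*R)" "a' = a + t*V + s*R" "d' = d + (s'*U - t'*R)" "c' = c + t'*V + s'*R"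
    for a' b' c' d' s t s' t'
  proof -
    have 1: "a'*x*U - (a'*z+b'*x)*R - b'*z*V = (a*x*U - (a*z+b*x)*R - b*z*V) + f * (t*x - s*z)" for x z
      unfolding that f by (simp add: algebra_simps power2_eq_square)
    have 2: "x*c'*U - (x*d'+z*c')*R - z*d'*V = (x*c*U - (x*d+z*c)*R - z*d*V) + f * (t'*x - s'*z)" for x z
      unfolding that f by (simp add: algebra_simps power2_eq_square)
    show ?thesis by (simp only: 1 2 mod_mult_self2)
  qed
  let ?val = "(-1) ^ degree U * tau f (a*c*U - (a*d+b*c)*R - b*d*V)"
  have val: "(-1) ^ degree U * tau f (phi_D f U v w) = ?val"
    if vw: "v \<in> W_class f U R (a*U-b*R,b)" "w \<in> W_class f U R (c*U-d*R,d)" for v w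
  proof -
    obtain a' b' s t where v: "v = (a'*U-b'*R,b')" "b' = b + (s*U - t*R)" "a' = a + t*V + s*R"
      using gen[OF vw(1)] by blast
    obtain c' d' s' t' where w: "w = (c'*U-d'*R,d')" "d' = d + (s'*U - t'*R)" "c' = c + t'*V + s'*R"
      using gen[OF vw(2)] by blast
    show ?thesis
      unfolding v(1) w(1) phi_D_eq[OF assms] tau_def mod_mod_trivial cong[OF v(2,3) w(2,3)] ..
  qed
  have "(a*U-b*R,b) \<in> W_class f U R (a*U-b*R,b)" "(c*U-d*R,d) \<in> W_class f U R (c*U-d*R,d)"
    by (auto simp: W_class_iff intro!: exI[of _ 0])
  then show ?thesis unfolding W_form_def
    by (intro the_equality) (use val in metis)+
qed

lemma W_class_eq_iff: "W_class f U R v = W_class f U R w \<longleftrightarrow> (\<exists>a b. fst v = fst w + b * f \<and> snd v = snd w + (a*U-b*R))"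
proof
  assume "W_class f U R v = W_class f U R w"
  moreover have "v \<in> W_class f U R v" by (auto simp: W_class_iff intro!: exI[of _ 0] simp: prod_eq_iff)
  ultimately have "v \<in> W_class f U R w" by simp
  then obtain a b where "v = (fst w + b * f, snd w + (a*U-b*R))" unfolding W_class_iff by blast
  then have "fst v = fst w + b * f \<and> snd v = snd w + (a*U-b*R)" by simp
  then show "\<exists>a b. fst v = fst w + b * f \<and> snd v = snd w + (a*U-b*R)" by blast
next
  assume "\<exists>a b. fst v = fst w + b * f \<and> snd v = snd w + (a*U-b*R)"
  then obtain a b where e: "fst v = fst w + b * f" "snd v = snd w + (a*U-b*R)" by blast
  have "x \<in> W_class f U R w" if "x \<in> W_class f U R v" for x
  proof -
    obtain c d where "x = (fst v + d * f, snd v + (c*U-d*R))" using \<open>x \<in> W_class f U R v\<close> unfolding W_class_iff by blast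
    then have "x = (fst w + (d+b) * f, snd w + ((c+a)*U-(d+b)*R))" by (simp add: e algebra_simps)
    then show ?thesis unfolding W_class_iff by blast
  qed
  moreover have "x \<in> W_class f U R v" if "x \<in> W_class f U R w" for x
  proof -
    obtain c d where "x = (fst w + d * f, snd w + (c*U-d*R))" using \<open>x \<in> W_class f U R w\<close> unfolding W_class_iff by blast
    then have "x = (fst v + (d-b) * f, snd v + ((c-a)*U-(d-b)*R))" by (simp add: e algebra_simps)
    then show ?thesis unfolding W_class_iff by blast
  qed
  ultimately show "W_class f U R v = W_class f U R w" by blast
qed

lemma W_class_self: "v \<in> W_class f U R v"
  by (auto simp: W_class_iff intro!: exI[of _ 0] simp: prod_eq_iff)

lemma W_add: "W_class f U R v \<oplus>\<^bsub>W_space f U R\<^esub> W_class f U R w = W_class f U R (fst v + fst w, snd v + snd w)"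
proof -
  have "W_class f U R v \<oplus>\<^bsub>W_space f U R\<^esub> W_class f U R w = {(fst x + fst y, snd x + snd y) |x y. x \<in> W_class f U R v \<and> y \<in> W_class f U R w}"
    unfolding W_space_def by (simp add: set_add_def') (auto; metis fst_conv snd_conv)
  also have "\<dots> = W_class f U R (fst v + fst w, snd v + snd w)" (is "?A = ?B")
  proof
    show "?A \<subseteq> ?B"
    proof safe
      fix a b c d assume "(a,b) \<in> W_class f U R v" "(c,d) \<in> W_class f U R w"
      then obtain s t s' t' where e: "a = fst v + t * f" "b = snd v + (s*U-t*R)" "c = fst w + t' * f" "d = snd w + (s'*U-t'*R)"
        by (auto simp: W_class_iff)
      have "(fst (a,b) + fst (c,d), snd (a,b) + snd (c,d)) =
        (fst (fst v + fst w, snd v + snd w) + (t+t') * f, snd (fst v + fst w, snd v + snd w) + ((s+s')*U-(t+t')*R))"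
        unfolding e by (simp add: algebra_simps)
      then show "(fst (a,b) + fst (c,d), snd (a,b) + snd (c,d)) \<in> W_class f U R (fst v + fst w, snd v + snd w)"
        unfolding W_class_iff by blast
    qed
    show "?B \<subseteq> ?A"
    proof safe
      fix a b assume "(a,b) \<in> W_class f U R (fst v + fst w, snd v + snd w)"
      then obtain s t where "a = fst v + fst w + t * f" "b = snd v + snd w + (s*U-t*R)"
        by (auto simp: W_class_iff)
      then show "\<exists>x y. (a,b) = (fst x + fst y, snd x + snd y) \<and> x \<in> W_class f U R v \<and> y \<in> W_class f U R w"
        by (intro exI[of _ "(fst v + t * f, snd v + (s*U-t*R))"] exI[of _ w]) (auto simp: W_class_self W_class_iff)
    qed
  qed
  finally show ?thesis .
qed

lemma W_smult: "c \<odot>\<^bsub>W_space f U R\<^esub> W_class f U R v = W_class f U R ([:c:] * fst v, [:c:] * snd v)"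
proof -
  have "W_class f U R ([:c:] * fst x, [:c:] * snd x) = W_class f U R ([:c:] * fst v, [:c:] * snd v)" if "x \<in> W_class f U R v" for x
  proof -
    from that obtain s t where e: "x = (fst v + t*f, snd v + (s*U-t*R))" by (auto simp: W_class_iff)
    show ?thesis unfolding W_class_eq_iff by (intro exI[of _ "[:c:]*s"] exI[of _ "[:c:]*t"]) (simp add: e smult_add_right smult_diff_right)
  qed
  then have "(\<Union>x\<in>W_class f U R v. W_class f U R ([:c:] * fst x, [:c:] * snd x)) =
      W_class f U R ([:c:] * fst v, [:c:] * snd v)"
    using W_class_self[of v f U R] by (intro SUP_eq_const) blast+
  then show ?thesis by (simp add: W_space_def)
qed

lemma W_zero: "\<zero>\<^bsub>W_space f U R\<^esub> = W_class f U R (0,0)"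
  by (auto simp: W_space_def y_ideal_D_iff W_class_iff)

lemma W_op_class: "W_op f U R (W_class f U R v) = W_class f U R ([:0,1:] * fst v, [:0,1:] * snd v)"
proof -
  have "W_class f U R ([:0,1:] * fst x, [:0,1:] * snd x) = W_class f U R ([:0,1:] * fst v, [:0,1:] * snd v)" if "x \<in> W_class f U R v" for x
  proof -
    from that obtain s t where e: "x = (fst v + t*f, snd v + (s*U-t*R))" by (auto simp: W_class_iff)
    show ?thesis unfolding W_class_eq_iff by (intro exI[of _ "[:0,1:]*s"] exI[of _ "[:0,1:]*t"]) (simp add: e algebra_simps del: mult_pCons_left)
  qed
  then have "(\<Union>x\<in>W_class f U R v. W_class f U R ([:0,1:] * fst x, [:0,1:] * snd x)) =
      W_class f U R ([:0,1:] * fst v, [:0,1:] * snd v)"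
    using W_class_self[of v f U R] by (intro SUP_eq_const) blast+
  then show ?thesis by (simp add: W_op_def)
qed

lemma real_poly_arith: "real_poly (a*b) = real_poly a * real_poly b" "real_poly (a+b) = real_poly a + real_poly b" "real_poly (a-b) = real_poly a - real_poly b"
  by (rule poly_eqI; simp add: coeff_map_poly coeff_mult of_rat_sum of_rat_mult of_rat_add of_rat_diff)+

lemma W_base_change_class: "W_base_change f U R (W_class f U R v) =
  W_class (real_poly f) (real_poly U) (real_poly R) (real_poly (fst v), real_poly (snd v))"
proof -
  have "W_class (real_poly f) (real_poly U) (real_poly R) (real_poly (fst x), real_poly (snd x)) =
   W_class (real_poly f) (real_poly U) (real_poly R) (real_poly (fst v), real_poly (snd v))" if "x \<in> W_class f U R v" for x
  proof -
    from that obtain s t where e: "x = (fst v + t*f, snd v + (s*U-t*R))" by (auto simp: W_class_iff)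
    show ?thesis unfolding W_class_eq_iff by (intro exI[of _ "real_poly s"] exI[of _ "real_poly t"]) (simp add: e real_poly_arith)
  qed
  then have "(\<Union>x\<in>W_class f U R v. W_class (real_poly f) (real_poly U) (real_poly R) (real_poly (fst x), real_poly (snd x))) =
      W_class (real_poly f) (real_poly U) (real_poly R) (real_poly (fst v), real_poly (snd v))"
    using W_class_self[of v f U R] by (intro SUP_eq_const) blast+
  then show ?thesis by (simp add: W_base_change_def map_prod_def case_prod_beta)
qed

lemma vectorspace_W: "vectorspace class_ring (W_space f U R)"
proof -
  have car: "carrier (W_space f U R) = {W_class f U R (a*U-b*R,b) |a b. True}" 
    by (auto simp: W_space_def ideal_D_def)
  have I: "W_class f U R (c,b) \<in> carrier (W_space f U R)" if "c = a*U-b*R" for a b c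
    using that unfolding car by blast
  have "field (class_ring :: 'a ring)" by (rule class_field.field_axioms)
  moreover have "Module.module class_ring (W_space f U R)"
  proof (rule Module.moduleI)
    show "cring (class_ring :: 'a ring)" by (rule class_cring.cring_axioms)
    show "abelian_group (W_space f U R)"
    proof (rule abelian_groupI)
      fix x y assume "x \<in> carrier (W_space f U R)" "y \<in> carrier (W_space f U R)"
      then obtain a b c d where [simp]: "x = W_class f U R (a*U-b*R,b)" "y = W_class f U R (c*U-d*R,d)" unfolding car by blast
      show "x \<oplus>\<^bsub>W_space f U R\<^esub> y \<in> carrier (W_space f U R)"
        unfolding W_add by (auto simp: W_add algebra_simps intro!: I[of _ "a+c"])
      show "x \<oplus>\<^bsub>W_space f U R\<^esub> y = y \<oplus>\<^bsub>W_space f U R\<^esub> x" by (simp add: W_add algebra_simps)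
      show "\<exists>y\<in>carrier (W_space f U R). y \<oplus>\<^bsub>W_space f U R\<^esub> x = \<zero>\<^bsub>W_space f U R\<^esub>"
        by (rule bexI[of _ "W_class f U R (-a*U-(-b)*R,-b)"]) (auto simp: W_add W_zero algebra_simps intro!: I[of _ "-a"])
    qed (auto simp: car W_add W_zero algebra_simps intro!: exI[of _ 0])
    fix c x assume "x \<in> carrier (W_space f U R)"
    then obtain a b where [simp]: "x = W_class f U R (a*U-b*R,b)" unfolding car by blast
    show "c \<odot>\<^bsub>W_space f U R\<^esub> x \<in> carrier (W_space f U R)"
      by (auto simp: W_smult smult_diff_right intro!: I[of _ "[:c:]*a"])
  qed (auto simp: car W_add W_smult algebra_simps smult_add_left smult_add_right smult_diff_right)
  ultimately show ?thesis by (simp add: vectorspace_def)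
qed

end

end

theory Submission
  imports Defs "HOL-Computational_Algebra.Fundamental_Theorem_Algebra" "HOL-Computational_Algebra.Field_as_Ring"
begin

text \<open>
  Let \<open>P = M U\<close>, a primitive integer polynomial, and let \<open>I\<^sub>\<int>\<close> be the set of elements of \<open>I\<^sub>D\<close> with integer
  coefficients. By Gauss' lemma the form \<open>v \<iota>(w) / P\<close> and the determinant form \<open>v \<and> w / P\<close>
  take values in \<open>\<int>[x, y]\<close> and \<open>\<int>[x]\<close> on \<open>I\<^sub>\<int>\<close>. Modulo every prime, \<open>I\<^sub>\<int>\<close> becomes
  free of rank 2 over \<open>F\<^sub>p[x]\<close> and the determinant form becomes perfect; hence \<open>I\<^sub>\<int> / y I\<^sub>\<int>\<close> is unimodular
  for the form of \<open>W\<^sub>D\<close> divided by \<open>M\<close>. The filtration of \<open>W\<^sub>D\<close> by pole order shows that its form is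
  split with discriminant \<open>\<plusminus>1\<close>, and comparing it with the unimodular lattice shows that \<open>M = N\<^sup>2\<close>. The
  lattice \<open>M\<^sub>D\<close> is then \<open>(1 / N) I\<^sub>\<int>\<close> modulo \<open>y\<close>, and \<open>v\<^sub>D\<close> is the class of \<open>N U = P / N\<close>.

  If \<open>U\<close> is coprime to \<open>f\<close>, then \<open>y = 0\<close> identifies \<open>W\<^sub>D\<close> with \<open>A\<^sub>f\<close>, and evaluation at the roots
  \<open>\<omega>\<close> of \<open>f\<close> turns its form into \<open>\<plusminus>\<Sum> c(\<omega>) d(\<omega>) / (U(\<omega>) f'(\<omega>))\<close>, and the compatible
  inner product into \<open>\<Sum> conj(c(\<omega>)) d(\<omega>) / |U(\<omega>) f'(\<omega>)|\<close>, from which the norm of \<open>N U\<close> is read off.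
\<close>

text \<open>Dividing by \<open>U = P / M\<close> is \<open>M\<close> times dividing by
  \<open>P\<close>, so the form takes values in \<open>M\<close> times the integers on integral
  elements. Scaling vectors by \<open>r\<close> multiplies the form by the square of
  \<open>r\<close>; hence the demand that \<open>M\<close> be a square. The obstacle is that no
  explicit basis of the integral elements is at hand: \<open>U\<close> and \<open>y - R\<close> may
  have denominators, and clearing them gives a sublattice that is too small at the primes involved.
  Therefore generators are found only modulo one prime at a time, and duality over the rationals
  follows by removing the denominator of a vector prime by prime. The determinant enters because
  pairing with \<open>y w\<close> gives \<open>f\<close> times the determinant with
  \<open>w\<close>. This puts \<open>y I\<^sub>D\<close> into the kernel of the form and makes
  Cramer's rule available for the converse. A basis over the integers comes from the pole order
  filtration. With respect to it the form is triangular: orders with too small a sum are orthogonal,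
  complementary orders pair by their leading coefficients. So vectors with prescribed pairings can
  be solved for one order at a time.\<close>

abbreviation psmult :: "'a :: comm_semiring_0 \<Rightarrow> 'a poly \<Rightarrow> 'a poly" where
  "psmult \<equiv> Polynomial.smult"

abbreviation rat_poly :: "int poly \<Rightarrow> rat poly" where
  "rat_poly \<equiv> map_poly of_int"

lemmas rat_poly_hom = of_int_poly_hom.hom_add of_int_poly_hom.hom_mult of_int_poly_hom.hom_minus
  of_int_poly_hom.hom_uminus of_int_poly_hom.hom_zero of_int_poly_hom.hom_one

lemma rat_poly_smult: "rat_poly (psmult c p) = psmult (of_int c) (rat_poly p)"
  by (rule poly_eqI) (simp add: coeff_map_poly)

lemma rat_poly_inject: "rat_poly p = rat_poly q \<longleftrightarrow> p = q"
  by (auto simp: poly_eq_iff coeff_map_poly)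

lemma degree_rat_poly: "degree (rat_poly p) = degree p"
  by (simp add: degree_map_poly)

section \<open>Integer polynomials modulo a prime\<close>

lemma prime_elem_const: "prime (p::int) \<Longrightarrow> prime_elem [:p:]"
  by (simp only: prime_elem_const_poly_iff prime_imp_prime_elem)

lemma const_dvd_iff_smult: "[:p:] dvd (a :: int poly) \<longleftrightarrow> (\<exists>t. a = psmult p t)"
  by (auto simp: dvd_def)

lemma prime_elem_power_dvd_cancel:
  fixes q h a :: "'a :: idom"
  assumes "prime_elem q" "\<not> q dvd h" "q ^ j dvd h * a"
  shows "q ^ j dvd a"
  using assms(3)
proof (induction j arbitrary: a)
  case (Suc j)
  have "q dvd h * a" using dvd_mult_left[of q "q ^ j" "h * a"] Suc.prems by simp
  then have "q dvd a" using assms(1,2) by (simp add: prime_elem_dvd_mult_iff)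
  then obtain b where b: "a = q * b" by blast
  have "q \<noteq> 0" using assms(1) by auto
  have "q * q ^ j dvd q * (h * b)" using Suc.prems unfolding b by (simp add: ac_simps)
  then have "q ^ j dvd h * b" using \<open>q \<noteq> 0\<close> by simp
  then have "q ^ j dvd b" by (rule Suc.IH)
  then show ?case unfolding b by (simp add: mult_dvd_mono)
qed simp

text \<open>Gauss' lemma, one prime of \<open>d\<close> at a time: a prime factor of
  \<open>d\<close> divides \<open>P * q\<close> but not \<open>P\<close>, so it divides
  \<open>q\<close> and cancels on both sides.\<close>

lemma primitive_dvd_cancel:
  fixes P a :: "int poly"
  assumes "\<And>p::int. prime p \<Longrightarrow> \<not> [:p:] dvd P" "d \<noteq> 0" "psmult d a = P * q"
  shows "P dvd a"
  using assms(2,3)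
proof (induction "nat \<bar>d\<bar>" arbitrary: d q rule: less_induct)
  case less
  show ?case
  proof (cases "\<bar>d\<bar> = 1")
    case True
    then have "d * d = 1" by (auto simp: abs_if split: if_splits)
    then have "a = psmult d (P * q)" unfolding less.prems(2)[symmetric] by simp
    then show ?thesis by (simp add: dvd_smult)
  next
    case False
    then obtain p where p: "prime p" "p dvd d" using less.prems(1)
      by (metis prime_divisor_exists zdvd1_eq)
    then obtain d' where d': "d = p * d'" by blast
    have "[:p:] dvd P * q" unfolding less.prems(2)[symmetric] d'
      by (simp add: const_poly_dvd_iff)
    then have "[:p:] dvd q"
      using prime_elem_dvd_mult_iff[OF prime_elem_const[OF p(1)]] assms(1)[OF p(1)] by blast
    then obtain q' where q': "q = psmult p q'" unfolding const_dvd_iff_smult by blast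
    have "p > 1" using p(1) by (simp add: prime_gt_1_int)
    have "psmult p (psmult d' a) = psmult p (P * q')"
      using less.prems(2) by (simp add: d' q')
    then have "psmult p (psmult d' a - P * q') = 0" by (simp only: smult_diff_right)
    then have eq: "psmult d' a = P * q'" using \<open>p > 1\<close> by (simp only: smult_eq_0_iff) auto
    have "d' \<noteq> 0" using less.prems(1) d' by auto
    moreover have "nat \<bar>d'\<bar> < nat \<bar>d\<bar>"
      using \<open>p > 1\<close> \<open>d' \<noteq> 0\<close> by (simp add: d' abs_mult)
    ultimately show ?thesis using less.hyps eq by blast
  qed
qed

text \<open>The image of \<open>J\<close> in F_p[x] is principal, by division with remainder.
  Working with representatives in Z[x] makes the generator come with a lift in \<open>J\<close>
  itself.\<close>

lemma ideal_principal_mod_prime: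
  fixes J :: "int poly set" and p :: int
  assumes p: "prime p"
    and add: "\<And>a b. a \<in> J \<Longrightarrow> b \<in> J \<Longrightarrow> a + b \<in> J"
    and mul: "\<And>a c. a \<in> J \<Longrightarrow> c * a \<in> J"
    and ex: "j0 \<in> J" "\<not> [:p:] dvd j0"
  obtains d where "d \<in> J" "\<And>b. b \<in> J \<Longrightarrow> \<exists>\<beta> t. b = \<beta> * d + psmult p t"
proof -
  \<comment> \<open>The preimage of the image of \<open>J\<close> in F_p[x]; in it, terms divisible
    by \<open>p\<close> may be dropped freely.\<close>
  define J' where "J' = {b. \<exists>j\<in>J. \<exists>t. b = j + psmult p t}"
  have J'I: "j \<in> J \<Longrightarrow> j + psmult p t \<in> J'" for j t unfolding J'_def by blast
  have J'p: "b + psmult p t \<in> J'" if "b \<in> J'" for b t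
  proof -
    obtain j s where "b = j + psmult p s" "j \<in> J" using \<open>b \<in> J'\<close> unfolding J'_def by blast
    then have "b + psmult p t = j + psmult p (s + t)" by (simp add: smult_add_right)
    then show ?thesis using J'I[OF \<open>j \<in> J\<close>, of "s+t"] by simp
  qed
  have J'm: "a + c * b \<in> J'" if "a \<in> J'" "b \<in> J'" for a b c
  proof -
    obtain j s where 1: "a = j + psmult p s" "j \<in> J" using \<open>a \<in> J'\<close> unfolding J'_def by blast
    obtain i t where 2: "b = i + psmult p t" "i \<in> J" using \<open>b \<in> J'\<close> unfolding J'_def by blast
    have "a + c * b = (j + c * i) + psmult p (s + c * t)"
      by (simp add: 1 2 smult_add_right algebra_simps)
    then show ?thesis using J'I[OF add[OF 1(2) mul[OF 2(2)]]] by metis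
  qed
  have monom_p: "p dvd a \<Longrightarrow> \<exists>t. monom a n = psmult p t" for a n
    by (auto elim!: dvdE simp: smult_monom[symmetric])
  define D where "D = (LEAST n. \<exists>d\<in>J'. \<not> [:p:] dvd d \<and> degree d = n)"
  have "j0 \<in> J'" using J'I[OF ex(1), of 0] by simp
  then have "\<exists>n. \<exists>d\<in>J'. \<not> [:p:] dvd d \<and> degree d = n" using ex(2) by blast
  then have "\<exists>d\<in>J'. \<not> [:p:] dvd d \<and> degree d = D" unfolding D_def by (rule LeastI_ex)
  then obtain d where d: "d \<in> J'" "\<not> [:p:] dvd d" "degree d = D" by blast
  have Dmin: "D \<le> degree b" if "b \<in> J'" "\<not> [:p:] dvd b" for b
    unfolding D_def by (rule Least_le) (use that in blast)
  \<comment> \<open>Otherwise the leading term could be dropped, contradicting the minimality of the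
    degree.\<close>
  have lead: "\<not> p dvd lead_coeff d"
  proof
    assume "p dvd lead_coeff d"
    then obtain t where t: "monom (lead_coeff d) (degree d) = psmult p t" using monom_p by blast
    let ?d = "d - monom (lead_coeff d) (degree d)"
    have 1: "?d \<in> J'" using J'p[OF d(1), of "- t"] t by simp
    have 2: "\<not> [:p:] dvd ?d" using d(2) dvd_diff_left_iff[of "[:p:]" "psmult p t" d] const_dvd_iff_smult[of p "psmult p t"]
      unfolding t by blast
    have "?d \<noteq> 0" using 2 by auto
    have "degree ?d \<le> degree d" by (intro degree_diff_le) (simp_all add: degree_monom_le)
    moreover have "coeff ?d (degree d) = 0" by simp
    ultimately have "degree ?d < degree d" using \<open>?d \<noteq> 0\<close> by (cases "degree ?d = degree d") (use leading_coeff_0_iff[of ?d] in auto)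
    then show False using Dmin[OF 1 2] d(3) by simp
  qed
  then have "coprime (lead_coeff d) p" using p by (metis coprime_commute prime_imp_coprime)
  then obtain c v where "c * lead_coeff d + v * p = 1"
    using bezout_int[of "lead_coeff d" p] by auto
  then have "lead_coeff d * c - 1 = p * (- v)" by (simp add: algebra_simps)
  then have c: "p dvd lead_coeff d * c - 1" by (metis dvd_triv_left)
  have main: "\<exists>\<beta> t. b = \<beta> * d + psmult p t" if "b \<in> J'" "\<forall>i\<ge>n. coeff b i = 0" for b n
    using that
  proof (induction n arbitrary: b)
    case 0
    then have "b = 0" by (simp add: poly_eq_iff)
    then show ?case by (intro exI[of _ 0]) simp
  next
    case (Suc n)
    show ?case
    proof (cases "p dvd coeff b n")
      case True
      then obtain t where t: "monom (coeff b n) n = psmult p t" using monom_p by blast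
      have "b - psmult p t \<in> J'" using J'p[OF Suc.prems(1), of "- t"] by simp
      moreover have "coeff (b - psmult p t) i = 0" if "i \<ge> n" for i
        unfolding t[symmetric] using Suc.prems(2) that by (cases "i = n") auto
      ultimately obtain \<beta> s where "b - psmult p t = \<beta> * d + psmult p s" using Suc.IH by blast
      then have "b = \<beta> * d + psmult p (s + t)" by (simp add: smult_add_right algebra_simps)
      then show ?thesis by blast
    next
      case False
      have nb: "\<not> [:p:] dvd b" using False by (auto simp: const_poly_dvd_iff)
      have "degree b \<le> n" using Suc.prems(2) by (intro degree_le) auto
      then have Dn: "D \<le> n" using Dmin[OF Suc.prems(1) nb] by simp
      \<comment> \<open>As \<open>c\<close> inverts the leading coefficient of \<open>d\<close>
        modulo \<open>p\<close>, subtracting \<open>?m * d\<close> leaves a coefficient at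
        \<open>n\<close> divisible by \<open>p\<close>, which \<open>psmult p t\<close>
        removes.\<close>
      let ?a = "coeff b n"
      let ?m = "monom (?a * c) (n - D)"
      have "p dvd ?a - ?a * c * lead_coeff d"
      proof -
        have "?a - ?a * c * lead_coeff d = - ?a * (lead_coeff d * c - 1)" by (simp add: algebra_simps)
        then show ?thesis using c by (metis dvd_mult)
      qed
      then obtain t where t: "monom (?a - ?a * c * lead_coeff d) n = psmult p t" using monom_p by blast
      let ?b = "b - ?m * d - psmult p t"
      have "?b \<in> J'" using J'p[OF J'm[OF Suc.prems(1) d(1), of "- ?m"], of "- t"] by simp
      moreover have "coeff ?b i = 0" if "i \<ge> n" for i
      proof (cases "i = n")
        case True
        have "coeff (?m * d) n = ?a * c * lead_coeff d" using Dn by (simp add: coeff_monom_mult d(3))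
        then show ?thesis unfolding t[symmetric] using True by simp
      next
        case False
        then have "i > n" using that by simp
        then have "coeff d (i - (n - D)) = 0" by (intro coeff_eq_0) (use d(3) Dn in linarith)
        then show ?thesis unfolding t[symmetric] using Suc.prems(2) \<open>i > n\<close> by (simp add: coeff_monom_mult)
      qed
      ultimately obtain \<beta> s where "?b = \<beta> * d + psmult p s" using Suc.IH by blast
      then have "b = (\<beta> + ?m) * d + psmult p (s + t)" by (simp add: smult_add_right algebra_simps)
      then show ?thesis by blast
    qed
  qed
  \<comment> \<open>The generator \<open>d\<close> is only known to lie in \<open>J'\<close>; it is
    traded for the element \<open>j\<close> of \<open>J\<close>, and the difference goes into the
    multiple of \<open>p\<close>.\<close>
  obtain j t where jt: "d = j + psmult p t" "j \<in> J" using d(1) unfolding J'_def by blast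
  show thesis
  proof (rule that[OF jt(2)])
    fix b assume "b \<in> J"
    then have "b \<in> J'" using J'I[of b 0] by simp
    moreover have "\<forall>i\<ge>Suc (degree b). coeff b i = 0" by (auto intro: coeff_eq_0)
    ultimately obtain \<beta> s where "b = \<beta> * d + psmult p s" using main by blast
    then have "b = \<beta> * j + psmult p (\<beta> * t + s)" unfolding jt by (simp add: smult_add_right algebra_simps)
    then show "\<exists>\<beta> t. b = \<beta> * j + psmult p t" by blast
  qed
qed

section \<open>Monic integer polynomials\<close>

text \<open>Pseudo-division by a monic polynomial is genuine division. Bounding coefficients rather
  than the degree covers the remainder 0 uniformly.\<close>

lemma monic_division:
  fixes f r :: "'a :: idom poly"
  assumes "lead_coeff f = 1"
  obtains h r' where "r = f * h + r'" "\<And>i. i \<ge> degree f \<Longrightarrow> coeff r' i = 0"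
proof -
  have "f \<noteq> 0" using assms by auto
  obtain h r' where hr: "pseudo_divmod r f = (h, r')" by fastforce
  have "r = f * h + r'" "r' = 0 \<or> degree r' < degree f"
    using pseudo_divmod[OF \<open>f \<noteq> 0\<close> hr] assms by auto
  then show thesis by (intro that[of h r']) (auto intro: coeff_eq_0)
qed

lemma coeff_tail_zero_degree: "degree f > 0 \<Longrightarrow> (\<And>i. i \<ge> degree f \<Longrightarrow> coeff r i = 0) \<Longrightarrow> degree r < degree f"
  using leading_coeff_0_iff[of r] by (cases "degree r < degree f") (auto simp: not_less)

text \<open>The quotient by integral division equals \<open>t\<close>; otherwise the integral
  remainder would be a nonzero multiple of \<open>f\<close> of degree below
  \<open>degree f\<close>.\<close>

lemma rat_poly_monic_quotient:
  fixes f a :: "int poly"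
  assumes "lead_coeff f = 1" "degree f > 0" "rat_poly f * t = rat_poly a"
  obtains t' where "t = rat_poly t'"
proof -
  obtain h r where hr: "a = f * h + r" "\<And>i. i \<ge> degree f \<Longrightarrow> coeff r i = 0" using monic_division[OF assms(1)] by blast
  have "degree r < degree f" using coeff_tail_zero_degree[OF assms(2) hr(2)] by simp
  have eq: "rat_poly f * (t - rat_poly h) = rat_poly r"
    using assms(3) hr(1) by (simp add: rat_poly_hom algebra_simps)
  have "t - rat_poly h = 0"
  proof (rule ccontr)
    assume n: "t - rat_poly h \<noteq> 0"
    have "rat_poly f \<noteq> 0" using assms(1) by auto
    have "degree f \<le> degree (rat_poly f * (t - rat_poly h))"
      using n \<open>rat_poly f \<noteq> 0\<close> by (simp add: degree_mult_eq degree_rat_poly)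
    then show False using \<open>degree r < degree f\<close> unfolding eq by (simp add: degree_rat_poly)
  qed
  then show thesis using that by simp
qed

lemma tau_add: "tau f (a + b) = tau f a + tau f b"
  by (simp add: tau_def poly_mod_add_left)

lemma tau_diff: "tau f (a - b) = tau f a - tau f b"
  by (simp add: tau_def poly_mod_diff_left)

lemma tau_smult: "tau f (psmult c a) = c * tau f a"
  by (simp add: tau_def mod_smult_left)

lemma tau_mult_self [simp]: "tau f (f * a) = 0"
  by (simp add: tau_def)

lemma tau_small: "degree a < degree f \<Longrightarrow> tau f a = coeff a (degree f - 1)"
  by (simp add: tau_def mod_poly_less)

lemma tau_rat_poly_int:
  assumes "lead_coeff f = 1" "degree f > 0"
  shows "tau (rat_poly f) (rat_poly r) \<in> \<int>"
proof -
  obtain h r' where hr: "r = f * h + r'" "\<And>i. i \<ge> degree f \<Longrightarrow> coeff r' i = 0" using monic_division[OF assms(1)] by blast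
  have "degree r' < degree f" using coeff_tail_zero_degree[OF assms(2) hr(2)] by simp
  then show ?thesis unfolding hr(1) by (simp add: rat_poly_hom tau_add tau_small degree_rat_poly coeff_map_poly)
qed

text \<open>The trace form pairs the powers of \<open>x\<close> perfectly, so it detects membership in \<open>(f, p)\<close>.\<close>

lemma tau_detects_mod_prime:
  fixes f r :: "int poly" and p :: int
  assumes f: "lead_coeff f = 1" "degree f > 0"
    and "\<And>i. \<exists>k::int. tau (rat_poly f) (rat_poly (monom 1 i * r)) = of_int (p * k)"
  obtains h k where "r = f * h + psmult p k"
proof -
  have "\<exists>h k. r = f * h + psmult p k"
    if "\<forall>i\<ge>n. coeff r i = 0" "\<forall>i. \<exists>k::int. tau (rat_poly f) (rat_poly (monom 1 i * r)) = of_int (p * k)"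
    for r n
    using that
  proof (induction n arbitrary: r)
    case 0
    then have "r = 0" by (simp add: poly_eq_iff)
    then show ?case by (intro exI[of _ 0]) simp
  next
    case (Suc n)
    let ?a = "coeff r n"
    show ?case
    proof (cases "n < degree f")
      case True
      \<comment> \<open>This power of \<open>x\<close> moves the coefficient at \<open>n\<close> to
        the place that \<open>tau\<close> reads; the degree stays below \<open>degree f\<close>, so
        no reduction interferes.\<close>
      let ?q = "monom 1 (degree f - 1 - n) * r"
      have co: "coeff ?q i = (if i < degree f - 1 - n then 0 else coeff r (i - (degree f - 1 - n)))" for i
        by (simp add: coeff_monom_mult)
      have "coeff ?q i = 0" if "i \<ge> degree f" for i
        unfolding co using Suc.prems(1) that True by simp
      then have "degree ?q < degree f" using coeff_tail_zero_degree[OF f(2)] by blast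
      then have "tau (rat_poly f) (rat_poly ?q) = of_int (coeff ?q (degree f - 1))"
        by (simp add: tau_small degree_rat_poly coeff_map_poly)
      also have "coeff ?q (degree f - 1) = ?a" unfolding co using True by simp
      finally obtain k where "?a = p * k" using Suc.prems(2)[rule_format, of "degree f - 1 - n"] by (metis of_int_eq_iff)
      then have m: "monom ?a n = psmult p (monom k n)" by (simp add: smult_monom)
      have "\<exists>h k. r - monom ?a n = f * h + psmult p k"
      proof (rule Suc.IH)
        show "\<forall>i\<ge>n. coeff (r - monom ?a n) i = 0" using Suc.prems(1) by (auto simp: not_less_eq_eq Suc_le_eq)
        show "\<forall>i. \<exists>l::int. tau (rat_poly f) (rat_poly (monom 1 i * (r - monom ?a n))) = of_int (p * l)"
        proof
          fix i
          obtain l1 where l1: "tau (rat_poly f) (rat_poly (monom 1 i * r)) = of_int (p * l1)" using Suc.prems(2) by blast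
          obtain l2 where l2: "tau (rat_poly f) (rat_poly (monom 1 i * monom k n)) = of_int l2"
            using tau_rat_poly_int[OF f] by (metis Ints_cases)
          have "rat_poly (monom 1 i * (r - monom ?a n)) =
            rat_poly (monom 1 i * r) - psmult (of_int p) (rat_poly (monom 1 i * monom k n))"
            by (simp only: m right_diff_distrib mult_smult_right rat_poly_hom rat_poly_smult)
          then have "tau (rat_poly f) (rat_poly (monom 1 i * (r - monom ?a n))) = of_int (p * (l1 - l2))"
            by (simp only: tau_diff tau_smult l1 l2) (simp add: algebra_simps)
          then show "\<exists>l::int. tau (rat_poly f) (rat_poly (monom 1 i * (r - monom ?a n))) = of_int (p * l)" by blast
        qed
      qed
      then obtain h k' where "r - monom ?a n = f * h + psmult p k'" by blast
      then have "r = f * h + psmult p (k' + monom k n)" by (simp add: m smult_add_right algebra_simps)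
      then show ?thesis by blast
    next
      case False
      \<comment> \<open>Here the top term is removed by a multiple of the monic \<open>f\<close>,
        which \<open>tau\<close> does not see.\<close>
      let ?m = "monom ?a (n - degree f)"
      have "\<exists>h k. r - f * ?m = f * h + psmult p k"
      proof (rule Suc.IH)
        show "\<forall>i\<ge>n. coeff (r - f * ?m) i = 0"
        proof (intro allI impI)
          fix i assume "i \<ge> n"
          show "coeff (r - f * ?m) i = 0"
          proof (cases "i = n")
            case True
            then show ?thesis using False f(1) by (simp add: mult.commute[of f] coeff_monom_mult)
          next
            case ne: False
            then have "coeff f (i - (n - degree f)) = 0" using \<open>i \<ge> n\<close> False by (intro coeff_eq_0) linarith
            then show ?thesis using Suc.prems(1) ne \<open>i \<ge> n\<close> by (simp add: mult.commute[of f] coeff_monom_mult)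
          qed
        qed
        show "\<forall>i. \<exists>l::int. tau (rat_poly f) (rat_poly (monom 1 i * (r - f * ?m))) = of_int (p * l)"
        proof
          fix i
          have "rat_poly (monom 1 i * (r - f * ?m)) =
            rat_poly (monom 1 i * r) - rat_poly f * rat_poly (monom 1 i * ?m)"
            by (simp only: right_diff_distrib rat_poly_hom ac_simps)
          then show "\<exists>l::int. tau (rat_poly f) (rat_poly (monom 1 i * (r - f * ?m))) = of_int (p * l)"
            using Suc.prems(2) by (simp only: tau_diff tau_mult_self diff_zero)
        qed
      qed
      then obtain h k' where "r - f * ?m = f * h + psmult p k'" by blast
      then have "r = f * (h + ?m) + psmult p k'" by (simp add: algebra_simps)
      then show ?thesis by blast
    qed
  qed
  moreover have "\<forall>i\<ge>Suc (degree r). coeff r i = 0" by (auto intro: coeff_eq_0)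
  ultimately show thesis using that assms(3) by blast
qed

lemma clear_denominators:
  fixes q :: "rat poly"
  obtains d :: int and q' where "d > 0" "psmult (of_int d) q = rat_poly q'"
proof -
  have "\<exists>d>0. \<exists>q'. psmult (of_int d) q = rat_poly q'"
  proof (induction q)
    case (pCons a q)
    then obtain d q' where d: "d > 0" "psmult (of_int d) q = rat_poly q'" by blast
    obtain m n where mn: "quotient_of a = (m, n)" by fastforce
    have n: "n > 0" "a = of_int m / of_int n" using quotient_of_denom_pos[OF mn] quotient_of_div[OF mn] by auto
    have "psmult (of_int (d * n)) (pCons a q) = rat_poly (pCons (d * m) (psmult n q'))"
    proof -
      have "psmult (of_int (d * n)) q = psmult (of_int n) (rat_poly q')"
        unfolding d(2)[symmetric] by (simp add: mult.commute)
      then show ?thesis using n by (simp add: rat_poly_smult of_int_hom.map_poly_pCons_hom)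
    qed
    moreover have "d * n > 0" using d n by simp
    ultimately show ?case by (intro exI conjI)
  next
    case 0
    have "psmult (of_int 1) 0 = rat_poly 0" by simp
    then show ?case by (intro exI[of _ 1] conjI exI) simp_all
  qed
  then show thesis using that by blast
qed

section \<open>Integral pairs and exact division by \<open>P\<close>\<close>

locale mumford_int =
  fixes g :: nat and f :: "int poly" and U V R :: "rat poly" and P :: "int poly" and M :: nat
  assumes degree_f: "degree f = 2 * g + 1" and monic_f: "lead_coeff f = 1"
    and monic_U: "lead_coeff U = 1" and degree_U: "degree U \<le> g"
    and UV: "U * V = rat_poly f - R ^ 2"
    and degree_R: "R = 0 \<or> degree R < degree U"
    and M_pos: "M > 0" and P: "psmult (of_nat M) U = rat_poly P"
    and primitive_P: "\<And>p::int. prime p \<Longrightarrow> \<not> [:p:] dvd P"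
begin

abbreviation "fQ \<equiv> rat_poly f"

text \<open>A pair \<open>(a, b)\<close> stands for \<open>a + b y\<close>, so that \<open>y (a, b) = (b f, a)\<close>.\<close>

definition mem :: "rat poly \<Rightarrow> rat poly \<Rightarrow> bool" where
  "mem a b \<longleftrightarrow> U dvd a + b * R"

definition memZ :: "int poly \<Rightarrow> int poly \<Rightarrow> bool" where
  "memZ a b \<longleftrightarrow> mem (rat_poly a) (rat_poly b)"

text \<open>The form of \<open>W\<^sub>D\<close> on representatives, without its sign:
  \<open>a * c - b * d * fQ\<close> is the part free of \<open>y\<close> in
  \<open>(a + b y) (c - d y)\<close>. The division by \<open>U\<close> is exact on
  \<open>I\<^sub>D\<close>.\<close>

definition bt :: "rat poly \<Rightarrow> rat poly \<Rightarrow> rat poly \<Rightarrow> rat poly \<Rightarrow> rat" where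
  "bt a b c d = tau fQ ((a * c - b * d * fQ) div U)"

lemma fQ_eq: "fQ = U * V + R ^ 2"
  using UV by simp

lemma U_nz: "U \<noteq> 0" using monic_U by auto
lemma f_pos: "degree f > 0" using degree_f by simp
lemma f_nz: "f \<noteq> 0" using monic_f by auto
lemma P_nz: "P \<noteq> 0"
proof
  assume "P = 0"
  then have "psmult (of_nat M) U = 0" using P by simp
  then show False using U_nz M_pos by simp
qed

lemma memE:
  assumes "mem a b" obtains x where "a = U * x - b * R"
proof -
  obtain x where "a + b * R = U * x" using assms unfolding mem_def dvd_def by blast
  then show thesis using that[of x] by (simp add: eq_diff_eq)
qed

lemma memI: "a = U * x - b * R \<Longrightarrow> mem a b"
  unfolding mem_def by simp

lemma mem_add: "mem a b \<Longrightarrow> mem c d \<Longrightarrow> mem (a + c) (b + d)"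
  unfolding mem_def using dvd_add[of U "a + b * R" "c + d * R"] by (simp add: algebra_simps)

lemma mem_mult: "mem a b \<Longrightarrow> mem (c * a) (c * b)"
  unfolding mem_def using dvd_mult[of U "a + b * R" c] by (simp add: algebra_simps)

lemma mem_smult: "mem a b \<Longrightarrow> mem (psmult c a) (psmult c b)"
  using mem_mult[of a b "[:c:]"] by simp

lemma mem_diff: "mem a b \<Longrightarrow> mem c d \<Longrightarrow> mem (a - c) (b - d)"
  unfolding mem_def using dvd_diff[of U "a + b * R" "c + d * R"] by (simp add: algebra_simps)

text \<open>The reason is \<open>b f + a R = R (a + b R) + b U V\<close>.\<close>

lemma mem_y: "mem a b \<Longrightarrow> mem (b * fQ) a"
proof -
  assume "mem a b"
  then obtain x where "a = U * x - b * R" by (rule memE)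
  then have "U * x = a + b * R" by simp
  then have "U * x * R = a * R + b * R * R" by (simp add: algebra_simps)
  then have "b * fQ = U * (b * V + x * R) - a * R"
    unfolding fQ_eq by (simp add: algebra_simps power2_eq_square)
  then show ?thesis by (rule memI)
qed

text \<open>Modulo \<open>U\<close> both pairs are multiples of \<open>(- R, 1)\<close>. So their
  determinant vanishes, and the product becomes \<open>b d (R^2 - f) = - b d U V\<close>.\<close>

lemma mem_dot_dvd: assumes "mem a b" "mem c d" shows "U dvd a * c - b * d * fQ" "U dvd a * d - c * b"
proof -
  obtain x where x: "a = U * x - b * R" using assms(1) by (rule memE)
  obtain z where z: "c = U * z - d * R" using assms(2) by (rule memE)
  have "a * c - b * d * fQ = U * (U * x * z - x * d * R - z * b * R - b * d * V)"
    unfolding x z fQ_eq by (simp add: algebra_simps power2_eq_square)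
  then show "U dvd a * c - b * d * fQ" by simp
  have "a * d - c * b = U * (x * d - z * b)" unfolding x z by (simp add: algebra_simps)
  then show "U dvd a * d - c * b" by simp
qed

text \<open>\<open>U\<close> and \<open>P\<close> are associated over the rationals, so this is
  Gauss' lemma for the primitive \<open>P\<close> once the quotient is cleared of
  denominators.\<close>

lemma U_dvd_imp_P_dvd:
  assumes "U dvd rat_poly s" shows "P dvd s"
proof -
  obtain q where q: "rat_poly s = U * q" using assms by blast
  obtain d q' where d: "d > 0" "psmult (of_int d) q = rat_poly q'" by (rule clear_denominators)
  have "rat_poly (P * q') = psmult (of_nat M) U * psmult (of_int d) q"
    by (simp add: rat_poly_hom P d)
  also have "\<dots> = rat_poly (psmult (int M * d) s)"
    by (simp add: rat_poly_smult q mult.commute)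
  finally have "psmult (int M * d) s = P * q'" unfolding rat_poly_inject ..
  moreover have "int M * d \<noteq> 0" using d(1) M_pos by simp
  ultimately show ?thesis by (intro primitive_dvd_cancel[OF primitive_P])
qed

lemma memZ_dot_dvd:
  assumes "memZ a b" "memZ c d" shows "P dvd a * c - b * d * f" "P dvd a * d - c * b"
  using mem_dot_dvd[OF assms[unfolded memZ_def]] by (auto intro!: U_dvd_imp_P_dvd simp: rat_poly_hom)

lemma memZ_add: "memZ a b \<Longrightarrow> memZ c d \<Longrightarrow> memZ (a + c) (b + d)"
  unfolding memZ_def by (simp add: rat_poly_hom mem_add)

lemma memZ_diff: "memZ a b \<Longrightarrow> memZ c d \<Longrightarrow> memZ (a - c) (b - d)"
  unfolding memZ_def by (simp add: rat_poly_hom mem_diff)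

lemma memZ_mult: "memZ a b \<Longrightarrow> memZ (c * a) (c * b)"
  unfolding memZ_def by (simp add: rat_poly_hom mem_mult)

lemma memZ_smult: "memZ a b \<Longrightarrow> memZ (psmult c a) (psmult c b)"
  using memZ_mult[of a b "[:c:]"] by simp

lemma memZ_y: "memZ a b \<Longrightarrow> memZ (b * f) a"
  unfolding memZ_def by (simp add: rat_poly_hom mem_y)

lemma memZ_P: "memZ P 0" "memZ 0 P"
  unfolding memZ_def mem_def P[symmetric] by (simp_all add: dvd_smult)

text \<open>The integral pairs are saturated, being cut out of all pairs over Z[x] by a condition
  over the rationals. This is what allows division by \<open>p\<close> later.\<close>

lemma memZ_smult_cancel:
  assumes "memZ (psmult c a) (psmult c b)" "c \<noteq> 0" shows "memZ a b"
  using mem_smult[OF assms(1)[unfolded memZ_def], of "1 / of_int c"] assms(2)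
  unfolding memZ_def by (simp add: rat_poly_smult)

text \<open>This is \<open>t (y - R)\<close> for a common denominator \<open>t\<close> of
  \<open>R\<close>; together with \<open>(P, 0)\<close> it has determinant
  \<open>t P\<close>.\<close>

lemma unit_element_memZ:
  obtains t r where "t \<noteq> 0" "memZ (- r) [:t:]"
proof -
  obtain t r where tr: "t > 0" "psmult (of_int t) R = rat_poly r" by (rule clear_denominators)
  have "memZ (- r) [:t:]" unfolding memZ_def mem_def using tr by (simp add: rat_poly_hom)
  then show thesis using tr(1) that by (metis less_irrefl)
qed

text \<open>
  Modulo \<open>p\<close> the module of integral pairs is free, being a submodule of \<open>F\<^sub>p[x]\<^sup>2\<close>. That its
  determinant is exactly \<open>P\<close> up to a unit is seen by comparing with the elements \<open>(P, 0)\<close> and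
  \<open>(- r, t)\<close>, whose determinant is \<open>P\<close> times a constant, to high \<open>p\<close>-adic precision.
\<close>

lemma generators_mod_prime:
  fixes p :: int
  assumes p: "prime p"
  shows "\<exists>a1 b1 a2 b2 h \<alpha> \<gamma>. memZ a1 b1 \<and> memZ a2 b2 \<and> a1 * b2 - a2 * b1 = P * h \<and>
    h * \<alpha> = 1 + psmult p \<gamma> \<and>
    (\<forall>a b. memZ a b \<longrightarrow> (\<exists>\<mu> \<nu> a' b'. memZ a' b' \<and>
       a = \<mu> * a1 + \<nu> * a2 + psmult p a' \<and> b = \<mu> * b1 + \<nu> * b2 + psmult p b'))"
proof -
  have p0: "p \<noteq> 0" using p by auto
  \<comment> \<open>An echelon form over F_p[x]: \<open>b2\<close> generates the second components,
    and \<open>a1\<close> the first components of those pairs whose second component vanishes modulo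
    \<open>p\<close>.\<close>
  define J2 where "J2 = {b. \<exists>a. memZ a b}"
  have "\<exists>d\<in>J2. \<forall>b\<in>J2. \<exists>\<beta> t. b = \<beta> * d + psmult p t"
  proof (rule ideal_principal_mod_prime[OF p, of J2 P])
    show "P \<in> J2" using memZ_P unfolding J2_def by blast
    show "a + b \<in> J2" if "a \<in> J2" "b \<in> J2" for a b
      using that memZ_add unfolding J2_def by blast
    show "c * a \<in> J2" if "a \<in> J2" for a c
      using that memZ_mult unfolding J2_def by blast
    show "\<not> [:p:] dvd P" using primitive_P[OF p] .
  qed blast
  then obtain b2 where b2: "b2 \<in> J2" "\<And>b. b \<in> J2 \<Longrightarrow> \<exists>\<beta> t. b = \<beta> * b2 + psmult p t" by blast
  obtain a2 where a2: "memZ a2 b2" using b2(1) unfolding J2_def by blast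
  define J1 where "J1 = {a. \<exists>b. memZ a b \<and> [:p:] dvd b}"
  have "\<exists>d\<in>J1. \<forall>b\<in>J1. \<exists>\<beta> t. b = \<beta> * d + psmult p t"
  proof (rule ideal_principal_mod_prime[OF p, of J1 P])
    show "P \<in> J1" using memZ_P unfolding J1_def by (auto intro!: exI[of _ 0])
    show "a + b \<in> J1" if "a \<in> J1" "b \<in> J1" for a b
      using that memZ_add dvd_add unfolding J1_def by blast
    show "c * a \<in> J1" if "a \<in> J1" for a c
      using that memZ_mult dvd_mult unfolding J1_def by blast
    show "\<not> [:p:] dvd P" using primitive_P[OF p] .
  qed blast
  then obtain a1 where a1: "a1 \<in> J1" "\<And>b. b \<in> J1 \<Longrightarrow> \<exists>\<beta> t. b = \<beta> * a1 + psmult p t" by blast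
  obtain b1 where b1: "memZ a1 b1" "[:p:] dvd b1" using a1(1) unfolding J1_def by blast
  obtain b1' where b1': "b1 = psmult p b1'" using b1(2) unfolding const_dvd_iff_smult by blast
  have gen: "\<exists>\<mu> \<nu> a' b'. memZ a' b' \<and> a = \<mu> * a1 + \<nu> * a2 + psmult p a' \<and>
    b = \<mu> * b1 + \<nu> * b2 + psmult p b'" if ab: "memZ a b" for a b
  proof -
    obtain \<nu> t where nu: "b = \<nu> * b2 + psmult p t" using b2(2) ab unfolding J2_def by blast
    have m1: "memZ (a - \<nu> * a2) (b - \<nu> * b2)" by (intro memZ_diff memZ_mult ab a2)
    moreover have "[:p:] dvd b - \<nu> * b2" using nu by (auto simp: const_dvd_iff_smult)
    ultimately have "a - \<nu> * a2 \<in> J1" unfolding J1_def by blast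
    then obtain \<mu> s where mu: "a - \<nu> * a2 = \<mu> * a1 + psmult p s" using a1(2) by blast
    have e1: "a = \<mu> * a1 + \<nu> * a2 + psmult p s" using mu by (simp add: algebra_simps)
    have e2: "b = \<mu> * b1 + \<nu> * b2 + psmult p (t - \<mu> * b1')"
      unfolding nu b1' by (simp add: smult_diff_right)
    \<comment> \<open>The remainder is an integral pair with both components divisible by
      \<open>p\<close>; by saturation the quotient is an integral pair again.\<close>
    have "memZ (a - \<nu> * a2 - \<mu> * a1) (b - \<nu> * b2 - \<mu> * b1)" by (intro memZ_diff memZ_mult ab a2 b1)
    also have "a - \<nu> * a2 - \<mu> * a1 = psmult p s" using e1 by simp
    also have "b - \<nu> * b2 - \<mu> * b1 = psmult p (t - \<mu> * b1')" using e2 by (simp add: algebra_simps)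
    finally have "memZ s (t - \<mu> * b1')" using memZ_smult_cancel p0 by blast
    then show ?thesis using e1 e2 by blast
  qed
  \<comment> \<open>Feeding the remainder back into \<open>gen\<close> gives the representation to
    any \<open>p\<close>-adic precision.\<close>
  have genk: "\<exists>\<mu> \<nu> a' b'. memZ a' b' \<and> a = \<mu> * a1 + \<nu> * a2 + [:p:] ^ k * a' \<and>
    b = \<mu> * b1 + \<nu> * b2 + [:p:] ^ k * b'" if "memZ a b" for a b k
    using that
  proof (induction k arbitrary: a b)
    case 0
    then show ?case by (intro exI[of _ 0] exI[of _ a] exI[of _ b]) simp
  next
    case (Suc k)
    then obtain \<mu> \<nu> a' b' where 1: "memZ a' b'" "a = \<mu> * a1 + \<nu> * a2 + [:p:] ^ k * a'"
      "b = \<mu> * b1 + \<nu> * b2 + [:p:] ^ k * b'" by blast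
    obtain \<mu>' \<nu>' a'' b'' where 2: "memZ a'' b''" "a' = \<mu>' * a1 + \<nu>' * a2 + [:p:] * a''"
      "b' = \<mu>' * b1 + \<nu>' * b2 + [:p:] * b''" using gen[OF 1(1)] by auto
    have "a = (\<mu> + [:p:] ^ k * \<mu>') * a1 + (\<nu> + [:p:] ^ k * \<nu>') * a2 + [:p:] ^ Suc k * a''"
      "b = (\<mu> + [:p:] ^ k * \<mu>') * b1 + (\<nu> + [:p:] ^ k * \<nu>') * b2 + [:p:] ^ Suc k * b''"
      unfolding 1(2,3) 2(2,3) power_Suc by (simp_all only: algebra_simps)
    then show ?case using 2(1) by blast
  qed
  obtain h where h: "a1 * b2 - a2 * b1 = P * h" using memZ_dot_dvd(2)[OF b1(1) a2] by blast
  have pp: "prime_elem [:p:]" using p by (rule prime_elem_const)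
  \<comment> \<open>As \<open>p\<close> divides \<open>b1\<close>, it would divide
    \<open>a1 * b2\<close>. But \<open>a1\<close> and \<open>b2\<close> generate, modulo
    \<open>p\<close>, ideals containing \<open>P\<close>, which is not 0 modulo
    \<open>p\<close>.\<close>
  have ndvd_h: "\<not> [:p:] dvd h"
  proof
    assume "[:p:] dvd h"
    then have "[:p:] dvd a1 * b2 - a2 * b1" unfolding h by (rule dvd_mult)
    then have p_dvd: "[:p:] dvd a1 * b2" using dvd_mult[OF b1(2), of a2] by (metis dvd_diff_left_iff)
    have nd: "\<not> [:p:] dvd d" if "\<exists>\<beta> t. P = \<beta> * d + psmult p t" for d
    proof
      assume "[:p:] dvd d"
      moreover from that obtain \<beta> t where Pt: "P = \<beta> * d + psmult p t" by blast
      moreover have "[:p:] dvd psmult p t" unfolding const_dvd_iff_smult by blast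
      ultimately have "[:p:] dvd P" by (metis dvd_add dvd_mult)
      then show False using primitive_P[OF p] by simp
    qed
    have "P \<in> J1" "P \<in> J2" using memZ_P unfolding J1_def J2_def by (auto intro!: exI[of _ 0])
    then have "\<not> [:p:] dvd a1" "\<not> [:p:] dvd b2" using nd[OF a1(2)] nd[OF b2(2)] by simp_all
    then show False using p_dvd unfolding prime_elem_dvd_mult_iff[OF pp] by simp
  qed
  obtain t r where tr: "t \<noteq> 0" "memZ (- r) [:t:]" by (rule unit_element_memZ)
  \<comment> \<open>Modulo \<open>p ^ k\<close> both \<open>(P, 0)\<close> and
    \<open>(- r, t)\<close> are combinations of the generators. Compare determinants: the exact one
    is \<open>P * [:t:]\<close>, that of the combinations is a multiple of \<open>P * h\<close>, and
    the error terms contain determinants of integral pairs, so they are divisible by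
    \<open>P\<close> as well and \<open>P\<close> cancels.\<close>
  have hk: "\<exists>\<alpha> \<gamma>. [:t:] = h * \<alpha> + [:p:] ^ k * \<gamma>" for k
  proof -
    obtain \<mu> \<nu> a b where v: "memZ a b" "P = \<mu> * a1 + \<nu> * a2 + [:p:] ^ k * a"
      "0 = \<mu> * b1 + \<nu> * b2 + [:p:] ^ k * b" using genk[OF memZ_P(1)] by blast
    obtain \<mu>' \<nu>' a' b' where v': "memZ a' b'" "- r = \<mu>' * a1 + \<nu>' * a2 + [:p:] ^ k * a'"
      "[:t:] = \<mu>' * b1 + \<nu>' * b2 + [:p:] ^ k * b'" using genk[OF tr(2)] by blast
    define q where "q = [:p:] ^ k"
    define X Y X' Y' where XY: "X = \<mu> * a1 + \<nu> * a2" "Y = \<mu> * b1 + \<nu> * b2"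
      "X' = \<mu>' * a1 + \<nu>' * a2" "Y' = \<mu>' * b1 + \<nu>' * b2"
    have X: "memZ X Y" "memZ X' Y'" unfolding XY by (intro memZ_add memZ_mult b1(1) a2)+
    obtain s1 where s1: "X * b' - a' * Y = P * s1" using memZ_dot_dvd(2)[OF X(1) v'(1)] by blast
    obtain s2 where s2: "a * [:t:] - (- r) * b = P * s2" using memZ_dot_dvd(2)[OF v(1) tr(2)] by blast
    have vX: "X + q * a = P" "Y + q * b = 0" "X' + q * a' = - r" "Y' + q * b' = [:t:]"
      unfolding XY q_def by (simp_all only: v(2)[symmetric] v(3)[symmetric] v'(2)[symmetric] v'(3)[symmetric])
    have "P * [:t:] = P * [:t:] - (- r) * 0" by simp
    also have "\<dots> = (X + q * a) * [:t:] - (- r) * (Y + q * b)"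
      unfolding vX ..
    also have "\<dots> = (X * [:t:] - (- r) * Y) + q * (a * [:t:] - (- r) * b)"
      by (simp add: algebra_simps)
    also have "X * [:t:] - (- r) * Y = X * (Y' + q * b') - (X' + q * a') * Y"
      unfolding vX ..
    also have "\<dots> = (X * Y' - X' * Y) + q * (X * b' - a' * Y)" by (simp add: algebra_simps)
    also have "X * Y' - X' * Y = (\<mu> * \<nu>' - \<nu> * \<mu>') * (a1 * b2 - a2 * b1)"
      unfolding XY by (simp add: algebra_simps)
    finally have "P * [:t:] = P * (h * (\<mu> * \<nu>' - \<nu> * \<mu>') + q * (s1 + s2))"
      unfolding h s1 s2 by (simp only: algebra_simps)
    then have "[:t:] = h * (\<mu> * \<nu>' - \<nu> * \<mu>') + q * (s1 + s2)" using P_nz by (simp only: mult_cancel_left) simp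
    then show ?thesis unfolding q_def by blast
  qed
  have "\<not> is_unit p" using p by auto
  then obtain t' where t': "t = p ^ multiplicity p t * t'" "\<not> p dvd t'"
    using multiplicity_decompose'[OF tr(1)] by blast
  define j where "j = multiplicity p t"
  have cpow: "[:p:] ^ j = [:p ^ j:]" by (induction j) auto
  \<comment> \<open>One power of \<open>p\<close> more than \<open>t\<close> contains. After
    cancelling \<open>p ^ j\<close>, possible as \<open>p\<close> does not divide \<open>h\<close>,
    there remains \<open>h * \<alpha>' = t'\<close> modulo \<open>p\<close> with \<open>t'\<close>
    prime to \<open>p\<close>.\<close>
  obtain \<alpha> \<gamma> where ag: "[:t:] = h * \<alpha> + [:p:] ^ Suc j * \<gamma>" using hk by blast
  have "[:t:] = [:p:] ^ j * [:t':]" using t'(1) unfolding cpow j_def[symmetric] by (simp add: mult.commute)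
  then have ha: "h * \<alpha> = [:p:] ^ j * ([:t':] - [:p:] * \<gamma>)" using ag by (simp add: algebra_simps)
  then have "[:p:] ^ j dvd \<alpha>" using prime_elem_power_dvd_cancel[OF pp ndvd_h] by (metis dvd_triv_left)
  then obtain \<alpha>' where \<alpha>': "\<alpha> = [:p:] ^ j * \<alpha>'" by blast
  have "[:p:] ^ j * (h * \<alpha>') = [:p:] ^ j * ([:t':] - [:p:] * \<gamma>)" using ha unfolding \<alpha>' by (simp only: ac_simps)
  then have ha': "h * \<alpha>' = [:t':] - [:p:] * \<gamma>" using p0 by (simp only: mult_cancel_left) auto
  have "coprime t' p" using t'(2) p by (metis coprime_commute prime_imp_coprime)
  then obtain u v where uv: "u * t' + v * p = 1" using bezout_int[of t' p] by auto
  have "h * ([:u:] * \<alpha>') = [:u:] * (h * \<alpha>')" by (simp only: ac_simps)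
  also have "\<dots> = [:u * t':] - [:p:] * ([:u:] * \<gamma>)" unfolding ha' by (simp add: smult_diff_right mult.commute)
  also have "u * t' = 1 - p * v" using uv by (simp add: algebra_simps)
  also have "[:1 - p * v:] - [:p:] * ([:u:] * \<gamma>) = 1 + psmult p (- ([:v:] + [:u:] * \<gamma>))"
    by (rule poly_eqI) (simp add: coeff_pCons algebra_simps split: nat.split)
  finally have unit: "h * ([:u:] * \<alpha>') = 1 + psmult p (- ([:v:] + [:u:] * \<gamma>))" .
  have gen': "\<forall>a b. memZ a b \<longrightarrow> (\<exists>\<mu> \<nu> a' b'. memZ a' b' \<and>
       a = \<mu> * a1 + \<nu> * a2 + psmult p a' \<and> b = \<mu> * b1 + \<nu> * b2 + psmult p b')"
    by (intro allI impI) (rule gen)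
  show ?thesis
    by (rule exI[of _ a1], rule exI[of _ b1], rule exI[of _ a2], rule exI[of _ b2], rule exI[of _ h],
        rule exI[of _ "[:u:] * \<alpha>'"], rule exI[of _ "- ([:v:] + [:u:] * \<gamma>)"])
      (intro conjI b1(1) a2 h unit gen')
qed

text \<open>Cramer's rule modulo \<open>p\<close>. Pairing with \<open>y (c, d) = (d f, c)\<close>
  gives \<open>f\<close> times a determinant, so perfectness of the determinant form yields an
  integral pair \<open>(c, d)\<close> whose \<open>y\<close>-multiple pairs like
  \<open>(a, b)\<close> modulo \<open>p\<close>. The difference then pairs to 0 modulo
  \<open>p\<close> with everything.\<close>

lemma self_dual_mod_prime:
  fixes p :: int
  assumes p: "prime p" and ab: "memZ a b"
    and dual: "\<And>a' b'. memZ a' b' \<Longrightarrow> \<exists>h k. a' * a - b' * b * f = P * (f * h + psmult p k)"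
  obtains c d a' b' where "memZ c d" "memZ a' b'" "a = d * f + psmult p a'" "b = c + psmult p b'"
proof -
  have p0: "p \<noteq> 0" using p by auto
  obtain a1 b1 a2 b2 h \<alpha> \<gamma> where gen: "memZ a1 b1" "memZ a2 b2" "a1 * b2 - a2 * b1 = P * h"
    "h * \<alpha> = 1 + psmult p \<gamma>"
    "\<forall>a b. memZ a b \<longrightarrow> (\<exists>\<mu> \<nu> a' b'. memZ a' b' \<and>
       a = \<mu> * a1 + \<nu> * a2 + psmult p a' \<and> b = \<mu> * b1 + \<nu> * b2 + psmult p b')"
    using generators_mod_prime[OF p] by (elim exE conjE) (rule that)
  obtain h1 k1 where 1: "a1 * a - b1 * b * f = P * (f * h1 + psmult p k1)" using dual[OF gen(1)] by blast
  obtain h2 k2 where 2: "a2 * a - b2 * b * f = P * (f * h2 + psmult p k2)" using dual[OF gen(2)] by blast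
  \<comment> \<open>The Cramer solution, modulo \<open>p\<close>, of
    \<open>a1 * d - b1 * c = P * h1\<close> and \<open>a2 * d - b2 * c = P * h2\<close>;
    \<open>\<alpha>\<close> inverts \<open>h\<close>, the determinant divided by
    \<open>P\<close>.\<close>
  define c where "c = \<alpha> * (h1 * a2 - h2 * a1)"
  define d where "d = \<alpha> * (h1 * b2 - h2 * b1)"
  have cd: "memZ c d" unfolding c_def d_def by (intro memZ_mult memZ_diff gen)
  define a0 where "a0 = a - d * f"
  define b0 where "b0 = b - c"
  have m0: "memZ a0 b0" unfolding a0_def b0_def by (intro memZ_diff ab memZ_y cd)
  have Ph: "P * (h * \<alpha>) = P + P * psmult p \<gamma>" unfolding gen(4) by (simp add: algebra_simps)
  have d1: "a1 * a0 - b1 * b0 * f = P * psmult p (k1 - f * h1 * \<gamma>)"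
  proof -
    have "a1 * a0 - b1 * b0 * f = (a1 * a - b1 * b * f) - f * (a1 * d - b1 * c)"
      unfolding a0_def b0_def by (simp add: algebra_simps)
    also have "a1 * d - b1 * c = \<alpha> * h1 * (a1 * b2 - a2 * b1)" unfolding c_def d_def by (simp add: algebra_simps)
    also have "\<dots> = h1 * (P * (h * \<alpha>))" unfolding gen(3) by (simp only: ac_simps)
    finally show ?thesis unfolding Ph 1 by (simp add: algebra_simps smult_diff_right)
  qed
  have d2: "a2 * a0 - b2 * b0 * f = P * psmult p (k2 - f * h2 * \<gamma>)"
  proof -
    have "a2 * a0 - b2 * b0 * f = (a2 * a - b2 * b * f) - f * (a2 * d - b2 * c)"
      unfolding a0_def b0_def by (simp add: algebra_simps)
    also have "a2 * d - b2 * c = \<alpha> * h2 * (a1 * b2 - a2 * b1)" unfolding c_def d_def by (simp add: algebra_simps)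
    also have "\<dots> = h2 * (P * (h * \<alpha>))" unfolding gen(3) by (simp only: ac_simps)
    finally show ?thesis unfolding Ph 2 by (simp add: algebra_simps smult_diff_right)
  qed
  have all: "\<exists>k. x * a0 - z * b0 * f = P * psmult p k" if xz: "memZ x z" for x z
  proof -
    obtain \<mu> \<nu> x' z' where x: "memZ x' z'" "x = \<mu> * a1 + \<nu> * a2 + psmult p x'"
      "z = \<mu> * b1 + \<nu> * b2 + psmult p z'" using gen(5) xz by blast
    obtain s where s: "x' * a0 - z' * b0 * f = P * s" using memZ_dot_dvd(1)[OF x(1) m0] by blast
    have "x * a0 - z * b0 * f = \<mu> * (a1 * a0 - b1 * b0 * f) + \<nu> * (a2 * a0 - b2 * b0 * f)
      + psmult p (x' * a0 - z' * b0 * f)" unfolding x by (simp add: algebra_simps smult_diff_right)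
    also have "\<dots> = P * psmult p (\<mu> * (k1 - f * h1 * \<gamma>) + \<nu> * (k2 - f * h2 * \<gamma>) + s)"
      unfolding d1 d2 s by (simp add: algebra_simps smult_diff_right smult_add_right)
    finally show ?thesis by blast
  qed
  \<comment> \<open>Testing against \<open>P\<close> and \<open>P y\<close> isolates the two
    components. For the second, \<open>f\<close> can be cancelled because a monic polynomial is not
    0 modulo \<open>p\<close>.\<close>
  obtain a' where "P * a0 = P * psmult p a'" using all[OF memZ_P(1)] by auto
  then have a': "a0 = psmult p a'" using P_nz by (simp only: mult_cancel_left) simp
  obtain k where k: "- (P * b0 * f) = P * psmult p k" using all[OF memZ_P(2)] by auto
  have "P * (b0 * f) = P * psmult p (- k)" using arg_cong[OF k, of uminus] by (simp add: ac_simps)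
  then have "b0 * f = psmult p (- k)" using P_nz by (simp only: mult_cancel_left) simp
  then have "[:p:] dvd b0 * f" unfolding const_dvd_iff_smult by blast
  moreover have "\<not> [:p:] dvd f"
  proof
    assume "[:p:] dvd f"
    then have "p dvd lead_coeff f" unfolding const_poly_dvd_iff by blast
    then show False using monic_f p by (auto simp: not_prime_unit)
  qed
  ultimately have "[:p:] dvd b0" using prime_elem_dvd_mult_iff[OF prime_elem_const[OF p]] by blast
  then obtain b' where b': "b0 = psmult p b'" unfolding const_dvd_iff_smult by blast
  have "memZ a' b'" using m0 p0 unfolding a' b' by (rule memZ_smult_cancel)
  moreover have "a = d * f + psmult p a'" "b = c + psmult p b'"
    using a' b' unfolding a0_def b0_def by (auto simp: algebra_simps)
  ultimately show thesis using that cd by blast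
qed

section \<open>The rational form and the removal of denominators\<close>

lemma bt_commute: "bt a b c d = bt c d a b"
  unfolding bt_def by (simp only: ac_simps)

lemma bt_add_right: "bt a b (c + c') (d + d') = bt a b c d + bt a b c' d'"
proof -
  have "a * (c + c') - b * (d + d') * fQ = (a * c - b * d * fQ) + (a * c' - b * d' * fQ)"
    by (simp add: algebra_simps)
  then show ?thesis unfolding bt_def by (simp only: poly_div_add_left tau_add)
qed

lemma bt_smult_right: "bt a b (psmult k c) (psmult k d) = k * bt a b c d"
proof -
  have "a * psmult k c - b * psmult k d * fQ = psmult k (a * c - b * d * fQ)"
    by (simp add: smult_diff_right)
  then show ?thesis unfolding bt_def by (simp only: div_smult_left tau_smult)
qed

lemma bt_add_left: "bt (a + a') (b + b') c d = bt a b c d + bt a' b' c d"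
  using bt_add_right bt_commute by metis

lemma bt_smult_left: "bt (psmult k a) (psmult k b) c d = k * bt a b c d"
  using bt_smult_right bt_commute by metis

lemma bt_diff_right: "bt a b (c - c') (d - d') = bt a b c d - bt a b c' d'"
  using bt_add_right[of a b "c - c'" c' "d - d'" d'] by simp

text \<open>Against \<open>y (c, d)\<close> the product is \<open>f\<close> times a determinant, and
  \<open>tau\<close> kills multiples of \<open>f\<close>.\<close>

lemma bt_y: assumes "mem a b" "mem c d" shows "bt a b (d * fQ) c = 0"
proof -
  have "a * (d * fQ) - b * c * fQ = fQ * (a * d - c * b)" by (simp add: algebra_simps)
  moreover have "fQ * (a * d - c * b) div U = fQ * ((a * d - c * b) div U)"
    using mem_dot_dvd(2)[OF assms] by (simp add: div_mult_swap)
  ultimately show ?thesis unfolding bt_def by simp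
qed

text \<open>The source of the factor \<open>M\<close>: the left side divides by \<open>U\<close>,
  while \<open>r\<close> is the quotient by \<open>P\<close>.\<close>

lemma bt_memZ:
  assumes "a * c - b * d * f = P * r"
  shows "bt (rat_poly a) (rat_poly b) (rat_poly c) (rat_poly d) = of_nat M * tau fQ (rat_poly r)"
proof -
  have "rat_poly a * rat_poly c - rat_poly b * rat_poly d * fQ = rat_poly (P * r)"
    unfolding assms[symmetric] by (simp add: rat_poly_hom)
  also have "\<dots> = U * psmult (of_nat M) (rat_poly r)"
    by (simp add: rat_poly_hom P[symmetric])
  finally show ?thesis unfolding bt_def using U_nz
    by (simp only: nonzero_mult_div_cancel_left tau_smult not_False_eq_True)
qed

lemma bt_memZ_int:
  assumes "memZ a b" "memZ c d"
  shows "bt (rat_poly a) (rat_poly b) (rat_poly c) (rat_poly d) / of_nat M \<in> \<int>"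
proof -
  obtain r where "a * c - b * d * f = P * r" using memZ_dot_dvd(1)[OF assms] by blast
  then show ?thesis using M_pos tau_rat_poly_int[OF monic_f f_pos, of r] by (simp only: bt_memZ) simp
qed

text \<open>Induction on a common denominator \<open>k\<close> of the pair. For a prime
  \<open>p\<close> dividing \<open>k\<close>, duality modulo \<open>p\<close> splits the numerator
  into \<open>y\<close> times an integral pair and \<open>p\<close> times an integral pair; dropping
  the first part turns \<open>k\<close> into \<open>k / p\<close>.\<close>

lemma self_dual:
  assumes "mem c b"
    and "\<And>a' b'. memZ a' b' \<Longrightarrow> bt (rat_poly a') (rat_poly b') c b / of_nat M \<in> \<int>"
  obtains a0 b0 c' d' where "memZ a0 b0" "mem c' d'" "c = rat_poly a0 + d' * fQ" "b = rat_poly b0 + c'"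
proof -
  have "\<exists>a0 b0 c' d'. memZ a0 b0 \<and> mem c' d' \<and> c = rat_poly a0 + d' * fQ \<and> b = rat_poly b0 + c'"
    if "k > 0" "psmult (of_nat k) c = rat_poly a" "psmult (of_nat k) b = rat_poly b'" "mem c b"
      "\<And>a' b'. memZ a' b' \<Longrightarrow> bt (rat_poly a') (rat_poly b') c b / of_nat M \<in> \<int>"
    for k a b' c b
    using that
  proof (induction k arbitrary: a b' c b rule: less_induct)
    case (less k)
    show ?case
    proof (cases "k = 1")
      case True
      have "memZ a b'" using less.prems(2-4) True unfolding memZ_def by simp
      then show ?thesis using less.prems(2,3) True
        by (intro exI[of _ a] exI[of _ b'] exI[of _ 0]) (simp add: mem_def)
    next
      case False
      then obtain p where p: "prime p" "p dvd k" using prime_factor_nat by blast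
      then obtain k' where k': "k = p * k'" by blast
      have "p > 1" using p(1) prime_gt_1_nat by blast
      have pZ: "prime (int p)" using p(1) by simp
      have "k' > 0" "k' < k" using less.prems(1) \<open>p > 1\<close> unfolding k' by auto
      have mZ: "memZ a b'" unfolding memZ_def less.prems(2,3)[symmetric] by (rule mem_smult) (rule less.prems(4))
      have dual: "\<exists>h l. a' * a - b'' * b' * f = P * (f * h + psmult (int p) l)" if m: "memZ a' b''" for a' b''
      proof -
        obtain r where r: "a' * a - b'' * b' * f = P * r" using memZ_dot_dvd(1)[OF m mZ] by blast
        \<comment> \<open>The hypothesis applies to \<open>x ^ i\<close> times the test pair too, so
          every \<open>tau (x ^ i r)\<close> is a multiple of \<open>k\<close>, hence of
          \<open>p\<close>. This is what puts \<open>r\<close> into the ideal generated by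
          \<open>f\<close> and \<open>p\<close>.\<close>
        have tau_i: "\<exists>l::int. tau fQ (rat_poly (monom 1 i * r)) = of_int (int p * l)" for i
        proof -
          have "(monom 1 i * a') * a - (monom 1 i * b'') * b' * f = monom 1 i * (a' * a - b'' * b' * f)"
            by (simp add: algebra_simps)
          also have "\<dots> = P * (monom 1 i * r)" unfolding r by (simp only: ac_simps)
          finally have "bt (rat_poly (monom 1 i * a')) (rat_poly (monom 1 i * b'')) (rat_poly a) (rat_poly b') =
            of_nat M * tau fQ (rat_poly (monom 1 i * r))" by (rule bt_memZ)
          then have "tau fQ (rat_poly (monom 1 i * r)) =
            of_nat k * (bt (rat_poly (monom 1 i * a')) (rat_poly (monom 1 i * b'')) c b / of_nat M)"
            unfolding less.prems(2,3)[symmetric] bt_smult_right using M_pos by (simp add: field_simps)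
          moreover obtain z where "bt (rat_poly (monom 1 i * a')) (rat_poly (monom 1 i * b'')) c b / of_nat M = of_int z"
            using less.prems(5)[OF memZ_mult[OF m]] by (metis Ints_cases)
          ultimately have "tau fQ (rat_poly (monom 1 i * r)) = of_int (int p * (int k' * z))"
            unfolding k' by simp
          then show ?thesis by blast
        qed
        obtain h l where "r = f * h + psmult (int p) l"
          by (rule tau_detects_mod_prime[OF monic_f f_pos tau_i])
        then show ?thesis using r by blast
      qed
      obtain e d a1 b1 where ed: "memZ e d" "memZ a1 b1" "a = d * f + psmult (int p) a1"
        "b' = e + psmult (int p) b1" by (rule self_dual_mod_prime[OF pZ mZ dual])
      let ?k = "1 / of_nat k :: rat"
      \<comment> \<open>The \<open>y\<close>-part may be divided by \<open>k\<close> without regard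
        to integrality, as all of \<open>y I\<^sub>D\<close> is allowed in the conclusion.\<close>
      define e' d' where ed': "e' = psmult ?k (rat_poly e)" "d' = psmult ?k (rat_poly d)"
      have m': "mem e' d'" unfolding ed' using ed(1) by (intro mem_smult) (simp add: memZ_def)
      define c1 b2 where cb: "c1 = c - d' * fQ" "b2 = b - e'"
      have "k \<noteq> 0" using less.prems(1) by simp
      have kc: "c = psmult ?k (rat_poly a)" "b = psmult ?k (rat_poly b')"
        unfolding less.prems(2,3)[symmetric] using \<open>k \<noteq> 0\<close> by simp_all
      have kp: "of_nat k' * ?k * of_nat p = 1" using \<open>k \<noteq> 0\<close> unfolding k' by simp
      have c1: "psmult (of_nat k') c1 = rat_poly a1"
      proof -
        have "c1 = psmult ?k (rat_poly a - rat_poly d * fQ)"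
          unfolding cb kc(1) ed' by (simp add: smult_diff_right)
        also have "rat_poly a - rat_poly d * fQ = psmult (of_nat p) (rat_poly a1)"
          unfolding ed(3) by (simp add: rat_poly_hom rat_poly_smult)
        finally show ?thesis using kp by (simp only: smult_smult mult.assoc smult_1_left)
      qed
      have b2: "psmult (of_nat k') b2 = rat_poly b1"
      proof -
        have "b2 = psmult ?k (rat_poly b' - rat_poly e)"
          unfolding cb kc(2) ed' by (simp add: smult_diff_right)
        also have "rat_poly b' - rat_poly e = psmult (of_nat p) (rat_poly b1)"
          unfolding ed(4) by (simp add: rat_poly_hom rat_poly_smult)
        finally show ?thesis using kp by (simp only: smult_smult mult.assoc smult_1_left)
      qed
      have "mem c1 b2" unfolding cb by (intro mem_diff less.prems(4) mem_y m')
      moreover have "bt (rat_poly a') (rat_poly b'') c1 b2 / of_nat M \<in> \<int>" if m: "memZ a' b''" for a' b''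
        unfolding cb bt_diff_right bt_y[OF m[unfolded memZ_def] m'] using less.prems(5)[OF m] by simp
      ultimately obtain a0 b0 c0 d0 where 0: "memZ a0 b0" "mem c0 d0" "c1 = rat_poly a0 + d0 * fQ" "b2 = rat_poly b0 + c0"
        using less.IH[OF \<open>k' < k\<close> \<open>k' > 0\<close> c1 b2] by blast
      have "c = rat_poly a0 + (d0 + d') * fQ" "b = rat_poly b0 + (c0 + e')"
        using 0(3,4) unfolding cb by (auto simp: algebra_simps)
      then show ?thesis using 0(1) mem_add[OF 0(2) m'] by blast
    qed
  qed
  note main = this
  obtain d1 a where d1: "d1 > 0" "psmult (of_int d1) c = rat_poly a" by (rule clear_denominators)
  obtain d2 b' where d2: "d2 > 0" "psmult (of_int d2) b = rat_poly b'" by (rule clear_denominators)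
  have 1: "psmult (of_nat (nat (d1 * d2))) c = rat_poly (psmult d2 a)"
    using d1 d2 by (simp add: rat_poly_smult d1(2)[symmetric] mult.commute)
  have 2: "psmult (of_nat (nat (d1 * d2))) b = rat_poly (psmult d1 b')"
    using d1 d2 by (simp add: rat_poly_smult d2(2)[symmetric])
  have "nat (d1 * d2) > 0" using d1 d2 by simp
  then show thesis using main[OF _ 1 2 assms] that by blast
qed

end

section \<open>Triangular bases\<close>

text \<open>In each degree the leading coefficients, together with 0, form a group of rationals with
  bounded denominators, hence a cyclic one. Elements realizing the generators form a basis by
  descending elimination. The bound on the degrees used is kept because it records the
  filtration.\<close>

lemma triangular_Z_basis:
  fixes G :: "rat poly set"
  assumes diff: "\<And>a b. a \<in> G \<Longrightarrow> b \<in> G \<Longrightarrow> a - b \<in> G"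
    and denom: "\<And>s. \<exists>d::int>0. \<forall>a\<in>G. degree a = s \<longrightarrow> of_int d * lead_coeff a \<in> \<int>"
  shows "\<exists>e. (\<forall>s \<in> degree ` (G - {0}). e s \<in> G \<and> e s \<noteq> 0 \<and> degree (e s) = s) \<and>
    (\<forall>a\<in>G. \<exists>n :: nat \<Rightarrow> int. (\<forall>s. degree a < s \<longrightarrow> n s = 0) \<and>
       a = (\<Sum>s \<in> {s \<in> degree ` (G - {0}). s \<le> degree a}. psmult (of_int (n s)) (e s)))"
proof -
  define S where "S = degree ` (G - {0})"
  have neg: "- a \<in> G" if "a \<in> G" for a using diff[OF diff[OF that that] that] by simp
  have add: "a + b \<in> G" if "a \<in> G" "b \<in> G" for a b using diff[OF that(1) neg[OF that(2)]] by simp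
  have nat_mult: "psmult (of_nat k) a \<in> G" if "a \<in> G" for k a
  proof (induction k)
    case 0 then show ?case using diff[OF that that] by simp
  next
    case (Suc k) then show ?case using add[OF that Suc] by (simp add: smult_add_left)
  qed
  have int_mult: "psmult (of_int k) a \<in> G" if "a \<in> G" for k a
    by (cases k) (use nat_mult[OF that] neg in \<open>fastforce simp del: of_nat_Suc\<close>)+
  have ex: "\<exists>e\<in>G. e \<noteq> 0 \<and> degree e = s \<and> (\<forall>a\<in>G. degree a = s \<longrightarrow> (\<exists>k::int. lead_coeff a = of_int k * lead_coeff e))"
    if s: "s \<in> S" for s
  proof -
    obtain d :: int where d: "d > 0" "\<And>a. a \<in> G \<Longrightarrow> degree a = s \<Longrightarrow> of_int d * lead_coeff a \<in> \<int>"
      using denom by blast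
    \<comment> \<open>Scaling by \<open>d\<close> makes the leading coefficients integers; by
      division with remainder the least positive one divides all others.\<close>
    define Q where "Q k \<longleftrightarrow> k > 0 \<and> (\<exists>a\<in>G. degree a = s \<and> of_int d * lead_coeff a = of_nat k)" for k :: nat
    have "\<exists>k. Q k"
    proof -
      obtain a where a: "a \<in> G" "a \<noteq> 0" "degree a = s" using s unfolding S_def by blast
      obtain z where z: "of_int d * lead_coeff a = of_int z" using d(2)[OF a(1,3)] by (metis Ints_cases)
      have "z \<noteq> 0" using z a(2) d(1) by auto
      show ?thesis
      proof (cases "z > 0")
        case True
        then have "Q (nat z)" unfolding Q_def using a z by (auto intro!: bexI[of _ a])
        then show ?thesis ..
      next
        case False
        then have "Q (nat (- z))" unfolding Q_def using a z neg[OF a(1)] \<open>z \<noteq> 0\<close> by (auto intro!: bexI[of _ "- a"])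
        then show ?thesis ..
      qed
    qed
    then have "Q (LEAST k. Q k)" by (rule LeastI_ex)
    then obtain e where e: "e \<in> G" "degree e = s" "of_int d * lead_coeff e = of_nat (LEAST k. Q k)" "(LEAST k. Q k) > 0"
      unfolding Q_def by blast
    define k where "k = (LEAST k. Q k)"
    have "e \<noteq> 0" using e(3,4) by auto
    moreover have "\<exists>q::int. lead_coeff a = of_int q * lead_coeff e" if a: "a \<in> G" "degree a = s" for a
    proof -
      obtain z where z: "of_int d * lead_coeff a = of_int z" using d(2)[OF a] by (metis Ints_cases)
      define q where "q = z div int k"
      have "k > 0" using e(4) unfolding k_def .
      have zq: "z = q * int k + z mod int k" unfolding q_def by simp
      have "z mod int k = 0"
      proof (rule ccontr)
        assume nz: "z mod int k \<noteq> 0"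
        let ?b = "a - psmult (of_int q) e"
        have b: "?b \<in> G" by (intro diff int_mult a e)
        have cb: "coeff ?b s = lead_coeff a - of_int q * lead_coeff e" using a(2) e(2) by simp
        have "of_int d * coeff ?b s = of_int d * lead_coeff a - of_int q * (of_int d * lead_coeff e)"
          unfolding cb by (simp add: right_diff_distrib mult.left_commute)
        also have "\<dots> = of_int z - of_int q * of_nat k" unfolding z e(3) k_def ..
        also have "\<dots> = of_int (z - q * int k)" by simp
        also have "z - q * int k = z mod int k" using zq by linarith
        finally have bs: "of_int d * coeff ?b s = of_int (z mod int k)" .
        then have "coeff ?b s \<noteq> 0" using nz by (metis mult_zero_right of_int_eq_0_iff)
        moreover have "degree ?b \<le> s" using a(2) e(2) by (intro degree_diff_le) (auto intro: degree_smult_le[THEN order_trans])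
        ultimately have db: "degree ?b = s" by (metis le_antisym le_degree)
        have "z mod int k > 0" "z mod int k < int k" 
          using nz pos_mod_sign[of "int k" z] pos_mod_bound[of "int k" z] \<open>k > 0\<close> by linarith+
        then have "Q (nat (z mod int k))" unfolding Q_def using b db bs by (intro conjI bexI[of _ ?b]) auto
        then have "k \<le> nat (z mod int k)" unfolding k_def by (rule Least_le)
        then show False using \<open>z mod int k < int k\<close> \<open>z mod int k > 0\<close> by linarith
      qed
      then have zq2: "z = q * int k" using zq by linarith
      have "of_int d * lead_coeff a = of_int q * of_nat k" unfolding z zq2 by simp
      also have "\<dots> = of_int d * (of_int q * lead_coeff e)" unfolding k_def e(3)[symmetric] by simp
      finally show ?thesis using d(1) by auto
    qed
    ultimately show ?thesis using e(1,2) by blast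
  qed
  then obtain e where e: "\<And>s. s \<in> S \<Longrightarrow> e s \<in> G \<and> e s \<noteq> 0 \<and> degree (e s) = s"
    "\<And>s a. s \<in> S \<Longrightarrow> a \<in> G \<Longrightarrow> degree a = s \<Longrightarrow> \<exists>k::int. lead_coeff a = of_int k * lead_coeff (e s)"
    by metis
  have rep: "\<exists>n :: nat \<Rightarrow> int. (\<forall>s. s \<ge> N \<longrightarrow> n s = 0) \<and> a = (\<Sum>s | s \<in> S \<and> s < N. psmult (of_int (n s)) (e s))"
    if "a \<in> G" "\<forall>i\<ge>N. coeff a i = 0" for a N
    using that
  proof (induction N arbitrary: a)
    case 0
    then have "a = 0" by (simp add: poly_eq_iff)
    then show ?case by (intro exI[of _ "\<lambda>_. 0"]) simp
  next
    case (Suc N)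
    have deg: "degree a \<le> N" using Suc.prems(2) by (intro degree_le) auto
    have split: "{s. s \<in> S \<and> s < Suc N} = (if N \<in> S then insert N {s. s \<in> S \<and> s < N} else {s. s \<in> S \<and> s < N})"
      by (auto simp: less_Suc_eq)
    show ?case
    proof (cases "coeff a N = 0")
      case True
      then have "\<forall>i\<ge>N. coeff a i = 0" using Suc.prems(2) by (metis Suc_leI le_neq_implies_less)
      then obtain n where n: "\<forall>s. s \<ge> N \<longrightarrow> n s = (0::int)" "a = (\<Sum>s | s \<in> S \<and> s < N. psmult (of_int (n s)) (e s))"
        using Suc.IH[OF Suc.prems(1)] by blast
      have "a = (\<Sum>s | s \<in> S \<and> s < Suc N. psmult (of_int (n s)) (e s))"
        unfolding split by (subst n(2)) (use n(1) in \<open>auto simp: sum.insert_if\<close>)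
      then show ?thesis using n(1) by (intro exI[of _ n]) auto
    next
      case False
      then have "degree a = N" using deg by (metis le_antisym le_degree)
      moreover have "a \<noteq> 0" using False by auto
      ultimately have NS: "N \<in> S" using Suc.prems(1) unfolding S_def by blast
      obtain k :: int where k: "coeff a N = of_int k * lead_coeff (e N)"
        using e(2)[OF NS Suc.prems(1) \<open>degree a = N\<close>] \<open>degree a = N\<close> by auto
      let ?b = "a - psmult (of_int k) (e N)"
      have "?b \<in> G" using e(1)[OF NS] by (intro diff int_mult Suc.prems(1)) auto
      moreover have "\<forall>i\<ge>N. coeff ?b i = 0"
      proof (intro allI impI)
        fix i assume "i \<ge> N"
        show "coeff ?b i = 0"
        proof (cases "i = N")
          case True
          then show ?thesis using k e(1)[OF NS] by simp
        next
          case ne: False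
          then have "coeff (e N) i = 0" using e(1)[OF NS] \<open>i \<ge> N\<close> by (intro coeff_eq_0) auto
          then show ?thesis using Suc.prems(2) ne \<open>i \<ge> N\<close> by simp
        qed
      qed
      ultimately obtain n where n: "\<forall>s. s \<ge> N \<longrightarrow> n s = (0::int)" "?b = (\<Sum>s | s \<in> S \<and> s < N. psmult (of_int (n s)) (e s))"
        using Suc.IH by blast
      have "a = psmult (of_int k) (e N) + (\<Sum>s | s \<in> S \<and> s < N. psmult (of_int (n s)) (e s))"
        unfolding n(2)[symmetric] by simp
      also have "\<dots> = (\<Sum>s | s \<in> S \<and> s < Suc N. psmult (of_int ((n(N := k)) s)) (e s))"
        unfolding split using NS by simp
      finally show ?thesis using n(1) by (intro exI[of _ "n(N := k)"]) auto
    qed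
  qed
  show ?thesis
  proof (intro exI[of _ e] conjI ballI)
    fix s assume "s \<in> degree ` (G - {0})"
    then show "e s \<in> G" "e s \<noteq> 0" "degree (e s) = s" using e(1) unfolding S_def by blast+
  next
    fix a assume "a \<in> G"
    moreover have "\<forall>i\<ge>Suc (degree a). coeff a i = 0" by (auto intro: coeff_eq_0)
    ultimately obtain n where n: "\<forall>s. s \<ge> Suc (degree a) \<longrightarrow> n s = (0::int)"
      "a = (\<Sum>s | s \<in> S \<and> s < Suc (degree a). psmult (of_int (n s)) (e s))" using rep by blast
    show "\<exists>n :: nat \<Rightarrow> int. (\<forall>s. degree a < s \<longrightarrow> n s = 0) \<and>
       a = (\<Sum>s \<in> {s \<in> degree ` (G - {0}). s \<le> degree a}. psmult (of_int (n s)) (e s))"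
    proof (intro exI[of _ n] conjI allI impI)
      show "a = (\<Sum>s \<in> {s \<in> degree ` (G - {0}). s \<le> degree a}. psmult (of_int (n s)) (e s))"
        using n(2) unfolding less_Suc_eq_le S_def .
    qed (use n(1) in auto)
  qed
qed

lemma coeff_mult_bounds:
  fixes p q :: "'a :: comm_ring_1 poly"
  assumes "degree p \<le> m" "degree q \<le> n"
  shows "coeff (p * q) (m + n) = coeff p m * coeff q n"
proof (cases "degree p = m \<and> degree q = n")
  case True
  then show ?thesis using coeff_mult_degree_sum[of p q] by simp
next
  case False
  then have "degree p < m \<or> degree q < n" using assms by auto
  then have "degree (p * q) < m + n" using degree_mult_le[of p q] assms by linarith
  then show ?thesis using False assms coeff_eq_0[of p m] coeff_eq_0[of q n] coeff_eq_0[of "p * q" "m + n"]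
    by auto
qed

lemma rat_square_nat:
  fixes l :: rat
  assumes "l\<^sup>2 = of_nat M"
  obtains N where "M = N ^ 2"
proof -
  obtain p q where pq: "quotient_of l = (p, q)" by fastforce
  have q: "q > 0" "coprime p q" "l = of_int p / of_int q"
    using quotient_of_denom_pos[OF pq] quotient_of_coprime[OF pq] quotient_of_div[OF pq] by auto
  have "of_int (p\<^sup>2) = (of_int (int M * q\<^sup>2) :: rat)"
    using assms q(1) unfolding q(3) by (simp add: field_simps power_divide)
  then have eq: "p\<^sup>2 = int M * q\<^sup>2" unfolding of_int_eq_iff .
  have "coprime (p\<^sup>2) (q\<^sup>2)" using q(2) by simp
  moreover have "q\<^sup>2 dvd p\<^sup>2" unfolding eq by simp
  ultimately have "is_unit (q\<^sup>2)" by (meson coprime_common_divisor dvd_refl)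
  then have "q\<^sup>2 = 1" by simp
  then have "int M = p\<^sup>2" using eq by simp
  then have "M = (nat \<bar>p\<bar>) ^ 2" by (metis nat_abs_int_diff nat_int nat_power_eq power2_abs abs_ge_zero)
  then show thesis using that by blast
qed

context mumford_int
begin

section \<open>Pole orders\<close>

text \<open>
  The degree of \<open>psi a b\<close> is the pole order of \<open>a + b y\<close> at infinity, as \<open>x\<close> and \<open>y\<close> have poles of
  orders \<open>2\<close> and \<open>2 g + 1\<close>.
\<close>

definition psi :: "rat poly \<Rightarrow> rat poly \<Rightarrow> rat poly" where
  "psi a b = pcompose a (monom 1 2) + monom 1 (2 * g + 1) * pcompose b (monom 1 2)"

lemma coeff_pcompose_sq: "coeff (pcompose (p :: rat poly) (monom 1 2)) k = (if even k then coeff p (k div 2) else 0)"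
proof (cases "even k")
  case True
  then show ?thesis using coeff_pcompose_monom[of 0 2 p "k div 2"] by simp
next
  case False
  then have "k = 2 * (k div 2) + 1" by simp
  then show ?thesis using coeff_pcompose_monom[of 1 2 p "k div 2"] False by simp
qed

lemma coeff_psi_even: "coeff (psi a b) (2 * i) = coeff a i"
  unfolding psi_def by (simp add: coeff_pcompose_sq coeff_monom_mult)

lemma coeff_psi_odd: "coeff (psi a b) (2 * g + 1 + 2 * j) = coeff b j"
  unfolding psi_def by (simp add: coeff_pcompose_sq coeff_monom_mult)

lemma coeff_psi_gap: "odd k \<Longrightarrow> k < 2 * g + 1 \<Longrightarrow> coeff (psi a b) k = 0"
  unfolding psi_def by (simp add: coeff_pcompose_sq coeff_monom_mult)

lemma odd_order_cases:
  assumes "odd k" obtains "k < 2 * g + 1" | j where "k = 2 * g + 1 + 2 * j"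
proof (cases "k < 2 * g + 1")
  case False
  then have "k = 2 * g + 1 + 2 * ((k - (2 * g + 1)) div 2)" using assms by presburger
  then show thesis using that(2) by blast
qed (use that in blast)

lemma psi_eq_0_iff: "psi a b = 0 \<longleftrightarrow> a = 0 \<and> b = 0"
proof
  assume "psi a b = 0"
  then have "coeff a i = 0" "coeff b i = 0" for i
    using coeff_psi_even[of a b i] coeff_psi_odd[of a b i] by simp_all
  then show "a = 0 \<and> b = 0" by (simp add: poly_eq_iff)
qed (simp add: psi_def)

lemma psi_diff: "psi (a - c) (b - d) = psi a b - psi c d"
  unfolding psi_def by (simp add: pcompose_diff algebra_simps)

lemma psi_smult: "psi (psmult k a) (psmult k b) = psmult k (psi a b)"
  unfolding psi_def by (simp add: pcompose_smult smult_add_right)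

lemma psi_sum: "psi (\<Sum>s\<in>S. a s) (\<Sum>s\<in>S. b s) = (\<Sum>s\<in>S. psi (a s) (b s))"
  unfolding psi_def by (simp add: pcompose_sum sum.distrib sum_distrib_left)

lemma psi_inject: "psi a b = psi c d \<longleftrightarrow> a = c \<and> b = d"
  using psi_eq_0_iff[of "a - c" "b - d"] unfolding psi_diff by simp

text \<open>For complementary orders the product divided by \<open>U\<close> has degree at most
  \<open>2 * g\<close>, so \<open>tau\<close> reads its top coefficient without reduction modulo
  \<open>f\<close>. Even orders contribute through \<open>a * c\<close> and odd ones through
  \<open>- b * d * fQ\<close>, whence the sign. Stating it for bounds \<open>s\<close> and
  \<open>t\<close> instead of exact orders allows a top coefficient to vanish.\<close>

lemma bt_top_aux:
  assumes "mem a b" "mem c d" "s + t = 4 * g + 2 * degree U"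
    and p: "\<And>i. i > s \<Longrightarrow> coeff (psi a b) i = 0" and q: "\<And>i. i > t \<Longrightarrow> coeff (psi c d) i = 0"
  shows "bt a b c d = (if even s then 1 else - 1) * coeff (psi a b) s * coeff (psi c d) t"
proof -
  let ?m = "degree U"
  let ?x = "a * c - b * d * fQ"
  have a: "coeff a i = 0" if "2 * i > s" for i using p[OF that] coeff_psi_even by simp
  have c: "coeff c i = 0" if "2 * i > t" for i using q[OF that] coeff_psi_even by simp
  have b: "coeff b j = 0" if "2 * g + 1 + 2 * j > s" for j using p[OF that] coeff_psi_odd by simp
  have d: "coeff d j = 0" if "2 * g + 1 + 2 * j > t" for j using q[OF that] coeff_psi_odd by simp
  have da: "degree a \<le> s div 2" by (intro degree_le allI impI a) linarith
  have dc: "degree c \<le> t div 2" by (intro degree_le allI impI c) linarith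
  have fd: "degree fQ = 2 * g + 1" by (simp add: degree_rat_poly degree_f)
  have lead_f: "coeff fQ (2 * g + 1) = 1" using monic_f by (simp add: coeff_map_poly degree_f)
  have main: "degree ?x \<le> 2 * g + ?m \<and>
    coeff ?x (2 * g + ?m) = (if even s then 1 else - 1) * coeff (psi a b) s * coeff (psi c d) t"
  proof (cases "even s")
    case True
    then have "even t" using assms(3) by presburger
    obtain i where i: "s = 2 * i" using True by (elim evenE)
    obtain j where j: "t = 2 * j" using \<open>even t\<close> by (elim evenE)
    have ij: "i + j = 2 * g + ?m" using assms(3) i j by linarith
    have dac: "degree (a * c) \<le> 2 * g + ?m" using degree_mult_le[of a c] da dc i j ij by simp
    \<comment> \<open>Odd orders bounded by an even number are strictly smaller, so this product
      cannot reach the top degree.\<close>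
    have "degree (b * d * fQ) < 2 * g + ?m \<or> b * d * fQ = 0"
    proof (cases "b = 0 \<or> d = 0")
      case False
      then have nz: "coeff b (degree b) \<noteq> 0" "coeff d (degree d) \<noteq> 0" by auto
      have "2 * g + 1 + 2 * degree b \<le> s" using b nz(1) not_less by blast
      then have 1: "g + 1 + degree b \<le> i" unfolding i by linarith
      have "2 * g + 1 + 2 * degree d \<le> t" using d nz(2) not_less by blast
      then have "g + 1 + degree d \<le> j" unfolding j by linarith
      with 1 have "degree b + degree d + (2 * g + 1) < 2 * g + ?m" using ij by linarith
      moreover have "degree (b * d * fQ) \<le> degree b + degree d + (2 * g + 1)"
        using degree_mult_le[of "b * d" fQ] degree_mult_le[of b d] fd by linarith
      ultimately show ?thesis by linarith
    qed auto
    then have dbd: "degree (b * d * fQ) \<le> 2 * g + ?m" "coeff (b * d * fQ) (2 * g + ?m) = 0"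
      by (auto intro: coeff_eq_0)
    have "coeff (a * c) (2 * g + ?m) = coeff a i * coeff c j"
      unfolding ij[symmetric] by (rule coeff_mult_bounds) (use da dc i j in auto)
    then show ?thesis using True dac dbd i j coeff_psi_even by (auto intro: degree_diff_le)
  next
    case False
    then have "odd t" using assms(3) by presburger
    \<comment> \<open>With both orders odd, halving loses 1/2 twice, so \<open>a * c\<close> stays
      below the top degree.\<close>
    have dac: "degree (a * c) < 2 * g + ?m"
    proof -
      obtain i j where "s = 2 * i + 1" "t = 2 * j + 1" using False \<open>odd t\<close> by (elim oddE)
      then have "s div 2 + t div 2 < 2 * g + ?m" using assms(3) by simp
      then show ?thesis using degree_mult_le[of a c] da dc by linarith
    qed
    \<comment> \<open>An odd order below \<open>2 * g + 1\<close> falls into a gap of the pole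
      orders: its coefficient is 0, and the corresponding second component vanishes.\<close>
    show ?thesis
    proof (cases "s < 2 * g + 1 \<or> t < 2 * g + 1")
      case True
      have "b = 0 \<or> d = 0"
        using True b d by (auto simp: poly_eq_iff)
      moreover have "coeff (psi a b) s * coeff (psi c d) t = 0"
        using True False \<open>odd t\<close> coeff_psi_gap by auto
      ultimately show ?thesis using dac coeff_eq_0[OF dac] by (auto simp: mult.assoc)
    next
      case big: False
      obtain i where i: "s = 2 * g + 1 + 2 * i" using False big by (elim odd_order_cases) auto
      obtain j where j: "t = 2 * g + 1 + 2 * j" using \<open>odd t\<close> big by (elim odd_order_cases) auto
      have ij: "i + j + (2 * g + 1) = 2 * g + ?m" using assms(3) i j by linarith
      have db: "degree b \<le> i" by (intro degree_le allI impI b) (use i in linarith)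
      have dd: "degree d \<le> j" by (intro degree_le allI impI d) (use j in linarith)
      have dbd: "degree (b * d) \<le> i + j" using degree_mult_le[of b d] db dd by linarith
      have dx: "degree (b * d * fQ) \<le> 2 * g + ?m" using degree_mult_le[of "b * d" fQ] dbd fd ij by linarith
      have "coeff (b * d * fQ) (2 * g + ?m) = coeff b i * coeff d j"
        unfolding ij[symmetric] using coeff_mult_bounds[OF dbd, of fQ "2 * g + 1"] coeff_mult_bounds[OF db dd] fd lead_f
        by simp
      then show ?thesis using False dac coeff_eq_0[OF dac] dx i j coeff_psi_odd
        by (auto intro!: degree_diff_le)
    qed
  qed
  obtain y where y: "?x = U * y" using mem_dot_dvd(1)[OF assms(1,2)] by blast
  have "degree y \<le> 2 * g"
  proof (cases "y = 0")
    case False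
    then have "degree ?x = ?m + degree y" unfolding y using U_nz by (simp add: degree_mult_eq)
    then show ?thesis using main by linarith
  qed simp
  then have "coeff ?x (?m + 2 * g) = coeff y (2 * g)"
    unfolding y using coeff_mult_bounds[of U ?m y "2 * g"] monic_U by simp
  moreover have "bt a b c d = tau fQ y" unfolding bt_def y using U_nz by simp
  moreover have "tau fQ y = coeff y (2 * g)"
    using \<open>degree y \<le> 2 * g\<close> fd by (subst tau_small) auto
  ultimately show ?thesis using main by (simp add: add.commute)
qed

lemma bt_top:
  assumes "mem a b" "mem c d" "degree (psi a b) + degree (psi c d) = 4 * g + 2 * degree U"
  shows "bt a b c d = (if even (degree (psi a b)) then 1 else - 1) * lead_coeff (psi a b) * lead_coeff (psi c d)"
  by (rule bt_top_aux[OF assms]) (auto intro: coeff_eq_0)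

text \<open>The bound for the first pair is raised to the order complementary to the second pair,
  where its coefficient is 0.\<close>

lemma bt_low:
  assumes "mem a b" "mem c d" "degree (psi a b) + degree (psi c d) < 4 * g + 2 * degree U"
  shows "bt a b c d = 0"
proof -
  let ?s = "4 * g + 2 * degree U - degree (psi c d)"
  have s: "?s > degree (psi a b)" using assms(3) by linarith
  then have "coeff (psi a b) ?s = 0" by (intro coeff_eq_0)
  moreover have "bt a b c d = (if even ?s then 1 else - 1) * coeff (psi a b) ?s * coeff (psi c d) (degree (psi c d))"
    by (rule bt_top_aux[OF assms(1,2)]) (use s assms(3) in \<open>auto intro: coeff_eq_0\<close>)
  ultimately show ?thesis by simp
qed

text \<open>The orders of \<open>U x^i\<close> for \<open>i \<le> 2 g - m\<close> and of
  \<open>(y - R) x^j\<close> for \<open>j < m\<close>, where \<open>m = degree U\<close>; there are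
  \<open>2 g + 1\<close> of them. The set is symmetric about \<open>2 g + m\<close>.\<close>

definition Ord :: "nat set" where
  "Ord = {s. even s \<and> 2 * degree U \<le> s \<and> s \<le> 4 * g \<or> odd s \<and> 2 * g + 1 \<le> s \<and> s < 2 * g + 1 + 2 * degree U}"

lemma finite_Ord: "finite Ord"
  by (rule finite_subset[of _ "{..4 * g + 2 * degree U}"]) (auto simp: Ord_def)

lemma Ord_compl: assumes "s \<in> Ord" shows "4 * g + 2 * degree U - s \<in> Ord" "s \<le> 4 * g + 2 * degree U"
  using assms degree_U unfolding Ord_def by (auto; presburger)+

lemma Ord_mid: "2 * g + degree U \<in> Ord"
  using degree_U unfolding Ord_def by (cases "even (degree U)") (auto, presburger+)

text \<open>Every class of \<open>I\<^sub>D\<close> modulo \<open>y I\<^sub>D\<close> has exactly one representative with the following property.\<close>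

definition memF :: "rat poly \<Rightarrow> rat poly \<Rightarrow> bool" where
  "memF c d \<longleftrightarrow> mem c d \<and> degree c \<le> 2 * g \<and> (\<forall>j\<ge>degree U. coeff d j = 0)"

lemma memF_diff: "memF a b \<Longrightarrow> memF c d \<Longrightarrow> memF (a - c) (b - d)"
  unfolding memF_def by (auto intro: mem_diff degree_diff_le)

lemma memF_add: "memF a b \<Longrightarrow> memF c d \<Longrightarrow> memF (a + c) (b + d)"
  unfolding memF_def by (auto intro: mem_add degree_add_le)

lemma memF_smult: "memF a b \<Longrightarrow> memF (psmult k a) (psmult k b)"
  unfolding memF_def using mem_smult[of a b k] by (auto intro: order_trans[OF degree_smult_le] simp del: smult_eq_0_iff)

text \<open>Subtracting \<open>y (c', d') = (d' f, c')\<close> permits two successive divisions: the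
  quotient of \<open>c\<close> by \<open>f\<close> fixes \<open>d'\<close>, after which
  \<open>c'\<close> still ranges over a class modulo \<open>U\<close>, and so \<open>b - c'\<close>
  can be reduced modulo \<open>U\<close>.\<close>

lemma memF_reduce:
  assumes "mem c b" obtains c' d' where "mem c' d'" "memF (c - d' * fQ) (b - c')"
proof -
  define d' where "d' = c div fQ"
  define x where "x = (b + d' * R) div U"
  define c' where "c' = U * x - d' * R"
  have m: "mem c' d'" unfolding c'_def by (rule memI, rule refl)
  have "c - d' * fQ = c mod fQ" unfolding d'_def by (simp add: minus_div_mult_eq_mod)
  then have "degree (c - d' * fQ) \<le> 2 * g"
    using degree_mod_less[of fQ c] f_nz degree_f by (auto simp: degree_rat_poly)
  moreover have "b - c' = (b + d' * R) mod U" unfolding c'_def x_def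
    by (simp add: minus_mult_div_eq_mod[symmetric] algebra_simps)
  then have "\<forall>j\<ge>degree U. coeff (b - c') j = 0"
    using degree_mod_less[OF U_nz, of "b + d' * R"] by (auto intro: coeff_eq_0)
  ultimately have "memF (c - d' * fQ) (b - c')" unfolding memF_def using mem_diff[OF assms mem_y[OF m]] by blast
  then show thesis using that m by blast
qed

lemma degree_psi_Ord:
  assumes "memF c d" "psi c d \<noteq> 0" shows "degree (psi c d) \<in> Ord"
proof -
  let ?s = "degree (psi c d)"
  have nz: "coeff (psi c d) ?s \<noteq> 0" using assms(2) by simp
  have hi: "coeff (psi c d) i = 0" if "i > ?s" for i using that by (rule coeff_eq_0)
  have m: "mem c d" "degree c \<le> 2 * g" "\<forall>j\<ge>degree U. coeff d j = 0" using assms(1) unfolding memF_def by auto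
  show ?thesis
  proof (cases "even ?s")
    case True
    then obtain i where i: "?s = 2 * i" by (elim evenE)
    have "coeff c i \<noteq> 0" using nz coeff_psi_even unfolding i by metis
    then have "i \<le> 2 * g" using m(2) le_degree le_trans by blast
    moreover have "degree U \<le> i"
    \<comment> \<open>An even order below \<open>2 * degree U\<close> is also below
      \<open>2 * g + 1\<close>, which forces \<open>d = 0\<close>; then \<open>U\<close> divides a
      polynomial of smaller degree.\<close>
    proof (rule ccontr)
      assume less: "\<not> degree U \<le> i"
      have "coeff d j = 0" for j using hi[of "2 * g + 1 + 2 * j"] less degree_U unfolding i coeff_psi_odd by simp
      then have "d = 0" by (simp add: poly_eq_iff)
      then have "U dvd c" using m(1) unfolding mem_def by simp
      moreover have "degree c \<le> i" using hi[of "2 * _"] unfolding i coeff_psi_even by (intro degree_le) auto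
      ultimately have "c = 0" using less dvd_imp_degree_le by (metis le_trans)
      then show False using \<open>coeff c i \<noteq> 0\<close> by simp
    qed
    ultimately show ?thesis unfolding Ord_def using i by simp
  next
    case False
    show ?thesis using False
    proof (cases rule: odd_order_cases)
      case 1
      then show ?thesis using nz coeff_psi_gap[OF False] by blast
    next
      case (2 j)
      then have "coeff d j \<noteq> 0" using nz coeff_psi_odd by metis
      then have "j < degree U" using m(3) not_le by blast
      then show ?thesis unfolding Ord_def using 2 False by simp
    qed
  qed
qed

lemma Ord_element:
  assumes "s \<in> Ord" obtains c d where "memF c d" "degree (psi c d) = s" "lead_coeff (psi c d) = 1"
proof -
  have "\<exists>c d. memF c d \<and> coeff (psi c d) s = 1 \<and> (\<forall>i>s. coeff (psi c d) i = 0)"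
  proof (cases "even s")
    case True
    then obtain k where k: "s = 2 * k" by (elim evenE)
    then have k': "degree U \<le> k" "k \<le> 2 * g" using assms unfolding Ord_def by auto
    let ?c = "U * monom 1 (k - degree U)"
    have dc: "degree ?c \<le> k" using degree_mult_le[of U "monom 1 (k - degree U)"] k' by (simp add: degree_monom_eq)
    have "coeff ?c k = 1" using coeff_mult_bounds[of U "degree U" "monom 1 (k - degree U)" "k - degree U"] k' monic_U
      by (simp add: degree_monom_eq)
    moreover have "memF ?c 0" unfolding memF_def mem_def using dc k' by simp
    moreover have "coeff (psi ?c 0) i = 0" if "i > s" for i
    proof (cases "even i")
      case True
      then obtain j where j: "i = 2 * j" by (elim evenE)
      then show ?thesis using that k dc by (simp add: coeff_psi_even coeff_eq_0)
    next
      case False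
      show ?thesis
      proof (rule odd_order_cases[OF False])
        show ?thesis if "i < 2 * g + 1" using that False by (intro coeff_psi_gap)
        show ?thesis if "i = 2 * g + 1 + 2 * j" for j unfolding that coeff_psi_odd by simp
      qed
    qed
    ultimately show ?thesis unfolding k by (intro exI[of _ ?c] exI[of _ 0]) (simp add: coeff_psi_even)
  next
    case False
    have "\<not> s < 2 * g + 1" using False assms unfolding Ord_def by auto
    then obtain j where j: "s = 2 * g + 1 + 2 * j" using odd_order_cases[OF False] by blast
    then have j': "j < degree U" using assms unfolding Ord_def by auto
    \<comment> \<open>This is \<open>(y - R) x^j\<close>. Since
      \<open>degree R < degree U \<le> g\<close>, the part \<open>R x^j\<close> has order at most
      \<open>2 g + 2 j\<close>, below that of \<open>y x^j\<close>.\<close>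
    let ?d = "monom 1 j :: rat poly" and ?c = "- (R * monom 1 j)"
    have dc: "coeff ?c i = 0" if "i > g + j" for i
      using degree_R degree_U degree_mult_le[of R "monom 1 j"] that
      by (cases "R = 0") (auto simp: degree_monom_eq intro!: coeff_eq_0)
    have "degree ?c \<le> g + j" using dc by (intro degree_le) blast
    then have "memF ?c ?d" unfolding memF_def mem_def using j' degree_U by auto
    moreover have "coeff (psi ?c ?d) s = 1" unfolding j coeff_psi_odd by simp
    moreover have "coeff (psi ?c ?d) i = 0" if "i > s" for i
    proof (cases "even i")
      case True
      then obtain k where k: "i = 2 * k" by (elim evenE)
      show ?thesis unfolding k coeff_psi_even by (rule dc) (use that j k in linarith)
    next
      case False
      show ?thesis
      proof (rule odd_order_cases[OF False])
        show ?thesis if "i < 2 * g + 1" using that False by (intro coeff_psi_gap)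
        show ?thesis if "i = 2 * g + 1 + 2 * j'" for j' unfolding that coeff_psi_odd using that \<open>i > s\<close> j by simp
      qed
    qed
    ultimately show ?thesis by blast
  qed
  then obtain c d where cd: "memF c d" "coeff (psi c d) s = 1" "\<forall>i>s. coeff (psi c d) i = 0" by blast
  have "degree (psi c d) \<le> s" using cd(3) by (intro degree_le) blast
  then have "degree (psi c d) = s" using cd(2) by (metis le_antisym le_degree zero_neq_one)
  then show thesis using that cd by blast
qed

section \<open>The unimodular lattice\<close>

text \<open>The integral pairs plus \<open>y I\<^sub>D\<close>: all representatives of the classes
  in the lattice before it is scaled.\<close>

definition inM :: "rat poly \<Rightarrow> rat poly \<Rightarrow> bool" where
  "inM c d \<longleftrightarrow> (\<exists>a b u v. memZ a b \<and> mem u v \<and> c = rat_poly a + v * fQ \<and> d = rat_poly b + u)"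

lemma inM_mem: "inM c d \<Longrightarrow> mem c d"
  unfolding inM_def memZ_def by (auto intro: mem_add mem_y)

lemma inM_diff: assumes "inM a b" "inM c d" shows "inM (a - c) (b - d)"
proof -
  obtain a' b' u v where 1: "memZ a' b'" "mem u v" "a = rat_poly a' + v * fQ" "b = rat_poly b' + u"
    using assms(1) unfolding inM_def by blast
  obtain c' d' u' v' where 2: "memZ c' d'" "mem u' v'" "c = rat_poly c' + v' * fQ" "d = rat_poly d' + u'"
    using assms(2) unfolding inM_def by blast
  have "a - c = rat_poly (a' - c') + (v - v') * fQ" "b - d = rat_poly (b' - d') + (u - u')"
    unfolding 1 2 by (simp_all add: rat_poly_hom algebra_simps)
  then show ?thesis unfolding inM_def using memZ_diff[OF 1(1) 2(1)] mem_diff[OF 1(2) 2(2)] by blast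
qed

lemma inM_memZ: "memZ a b \<Longrightarrow> inM (rat_poly a) (rat_poly b)"
  unfolding inM_def by (intro exI[of _ a] exI[of _ b] exI[of _ 0]) (simp add: mem_def)

lemma inM_add_y: assumes "inM c d" "mem u v" shows "inM (c + v * fQ) (d + u)"
proof -
  obtain a' b' u' v' where 1: "memZ a' b'" "mem u' v'" "c = rat_poly a' + v' * fQ" "d = rat_poly b' + u'"
    using assms(1) unfolding inM_def by blast
  have "c + v * fQ = rat_poly a' + (v' + v) * fQ" "d + u = rat_poly b' + (u' + u)"
    unfolding 1 by (simp_all add: algebra_simps)
  then show ?thesis unfolding inM_def using 1(1) mem_add[OF 1(2) assms(2)] by blast
qed

lemma inM_int:
  assumes "inM a b" "inM c d" shows "bt a b c d / of_nat M \<in> \<int>"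
proof -
  obtain a' b' u v where 1: "memZ a' b'" "mem u v" "a = rat_poly a' + v * fQ" "b = rat_poly b' + u"
    using assms(1) unfolding inM_def by blast
  obtain c' d' u' v' where 2: "memZ c' d'" "mem u' v'" "c = rat_poly c' + v' * fQ" "d = rat_poly d' + u'"
    using assms(2) unfolding inM_def by blast
  have "bt a b c d = bt a b (rat_poly c') (rat_poly d')"
    unfolding 2(3,4) bt_add_right bt_y[OF inM_mem[OF assms(1)] 2(2)] by simp
  also have "\<dots> = bt (rat_poly a') (rat_poly b') (rat_poly c') (rat_poly d')"
    unfolding 1(3,4) bt_add_left using bt_y[OF 2(1)[unfolded memZ_def] 1(2)] by (simp add: bt_commute)
  finally show ?thesis using bt_memZ_int[OF 1(1) 2(1)] by simp
qed

lemma inM_multiple: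
  assumes "mem c d" obtains k :: int where "k > 0" "inM (psmult (of_int k) c) (psmult (of_int k) d)"
proof -
  obtain d1 a where d1: "d1 > 0" "psmult (of_int d1) c = rat_poly a" by (rule clear_denominators)
  obtain d2 b where d2: "d2 > 0" "psmult (of_int d2) d = rat_poly b" by (rule clear_denominators)
  have 1: "psmult (of_int (d1 * d2)) c = rat_poly (psmult d2 a)"
    by (simp add: rat_poly_smult d1(2)[symmetric] mult.commute)
  have 2: "psmult (of_int (d1 * d2)) d = rat_poly (psmult d1 b)"
    by (simp add: rat_poly_smult d2(2)[symmetric])
  have "memZ (psmult d2 a) (psmult d1 b)"
    unfolding memZ_def 1[symmetric] 2[symmetric] by (rule mem_smult[OF assms])
  then have "inM (psmult (of_int (d1 * d2)) c) (psmult (of_int (d1 * d2)) d)"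
    unfolding 1 2 by (rule inM_memZ)
  moreover have "d1 * d2 > 0" using d1(1) d2(1) by simp
  ultimately show thesis using that by blast
qed

text \<open>A basis over the integers adapted to the filtration, with one reduced element for each
  order. That a vector involves only orders up to its own is used for the squareness of
  \<open>M\<close>.\<close>

definition zbasis :: "(nat \<Rightarrow> rat poly) \<Rightarrow> (nat \<Rightarrow> rat poly) \<Rightarrow> bool" where
  "zbasis ec ed \<longleftrightarrow> (\<forall>s\<in>Ord. memF (ec s) (ed s) \<and> inM (ec s) (ed s) \<and> degree (psi (ec s) (ed s)) = s \<and> psi (ec s) (ed s) \<noteq> 0) \<and>
    (\<forall>c d. memF c d \<longrightarrow> inM c d \<longrightarrow> (\<exists>n :: nat \<Rightarrow> int. (\<forall>s. degree (psi c d) < s \<longrightarrow> n s = 0) \<and>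
      c = (\<Sum>s\<in>Ord. psmult (of_int (n s)) (ec s)) \<and> d = (\<Sum>s\<in>Ord. psmult (of_int (n s)) (ed s))))"

text \<open>Bounded denominators come from integrality of the form: pairing with a monic element of
  complementary order returns the leading coefficient up to sign, and a fixed multiple of that
  element lies in the lattice.\<close>

lemma zbasis_exists: "\<exists>ec ed. zbasis ec ed"
proof -
  define G where "G = {psi c d | c d. memF c d \<and> inM c d}"
  have GI: "memF c d \<Longrightarrow> inM c d \<Longrightarrow> psi c d \<in> G" for c d unfolding G_def by blast
  have diff: "a - b \<in> G" if ab: "a \<in> G" "b \<in> G" for a b
  proof -
    obtain c d c' d' where "a = psi c d" "memF c d" "inM c d" "b = psi c' d'" "memF c' d'" "inM c' d'"
      using ab unfolding G_def by blast
    then show ?thesis using GI[OF memF_diff inM_diff, of c d c' d'] by (simp add: psi_diff)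
  qed
  have denom: "\<exists>d::int>0. \<forall>a\<in>G. degree a = s \<longrightarrow> of_int d * lead_coeff a \<in> \<int>" for s
  proof (cases "s \<in> Ord")
    case True
    obtain c0 d0 where 0: "memF c0 d0" "degree (psi c0 d0) = 4 * g + 2 * degree U - s" "lead_coeff (psi c0 d0) = 1"
      using Ord_element[OF Ord_compl(1)[OF True]] by blast
    have m0: "mem c0 d0" using 0(1) unfolding memF_def by blast
    obtain k :: int where k: "k > 0" "inM (psmult (of_int k) c0) (psmult (of_int k) d0)"
      using inM_multiple[OF m0] by blast
    have "of_int k * lead_coeff a \<in> \<int>" if a: "a \<in> G" "degree a = s" for a
    proof -
      obtain c d where cd: "a = psi c d" "memF c d" "inM c d" using a(1) unfolding G_def by blast
      have "bt c d c0 d0 = (if even s then 1 else - 1) * lead_coeff a"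
        using bt_top[OF inM_mem[OF cd(3)] m0] 0 a(2) cd(1) Ord_compl(2)[OF True] by simp
      then have eq: "of_int k * lead_coeff a = (if even s then 1 else - 1) * (bt c d (psmult (of_int k) c0) (psmult (of_int k) d0) / of_nat M) * of_nat M"
        using M_pos unfolding bt_smult_right by (auto simp: field_simps)
      show ?thesis unfolding eq by (intro Ints_mult inM_int[OF cd(3) k(2)]) auto
    qed
    then show ?thesis using k(1) by blast
  next
    case False
    have "of_int 1 * lead_coeff a \<in> \<int>" if a: "a \<in> G" "degree a = s" for a
    proof -
      obtain c d where cd: "a = psi c d" "memF c d" using a(1) unfolding G_def by blast
      have "a = 0" using degree_psi_Ord[OF cd(2)] a(2) cd(1) False by blast
      then show ?thesis by simp
    qed
    then show ?thesis by (intro exI[of _ 1]) simp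
  qed
  have SG: "degree ` (G - {0}) = Ord"
  proof
    show "degree ` (G - {0}) \<subseteq> Ord" unfolding G_def using degree_psi_Ord by auto
    show "Ord \<subseteq> degree ` (G - {0})"
    proof
      fix s assume "s \<in> Ord"
      then obtain c0 d0 where 0: "memF c0 d0" "degree (psi c0 d0) = s" "lead_coeff (psi c0 d0) = 1"
        using Ord_element by blast
      have m0: "mem c0 d0" using 0(1) unfolding memF_def by blast
      obtain k :: int where k: "k > 0" "inM (psmult (of_int k) c0) (psmult (of_int k) d0)"
        using inM_multiple[OF m0] by blast
      let ?a = "psmult (of_int k) (psi c0 d0)"
      have "?a \<in> G" using GI[OF memF_smult[OF 0(1)] k(2)] unfolding psi_smult .
      moreover have "?a \<noteq> 0" "degree ?a = s" using k(1) 0(2,3) by auto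
      ultimately show "s \<in> degree ` (G - {0})" by (intro image_eqI[of _ _ ?a]) auto
    qed
  qed
  obtain e where e: "\<And>s. s \<in> Ord \<Longrightarrow> e s \<in> G \<and> e s \<noteq> 0 \<and> degree (e s) = s"
    "\<And>a. a \<in> G \<Longrightarrow> \<exists>n :: nat \<Rightarrow> int. (\<forall>s. degree a < s \<longrightarrow> n s = 0) \<and>
       a = (\<Sum>s | s \<in> Ord \<and> s \<le> degree a. psmult (of_int (n s)) (e s))"
    using triangular_Z_basis[of G, OF diff denom, unfolded SG] by blast
  have "\<forall>s\<in>Ord. \<exists>c d. e s = psi c d \<and> memF c d \<and> inM c d" using e(1) unfolding G_def by blast
  then obtain ec ed where ecd: "\<And>s. s \<in> Ord \<Longrightarrow> e s = psi (ec s) (ed s) \<and> memF (ec s) (ed s) \<and> inM (ec s) (ed s)"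
    by metis
  have "zbasis ec ed" unfolding zbasis_def
  proof (intro conjI ballI allI impI)
    fix c d assume cd: "memF c d" "inM c d"
    obtain n :: "nat \<Rightarrow> int" where n: "\<forall>s. degree (psi c d) < s \<longrightarrow> n s = 0"
      "psi c d = (\<Sum>s | s \<in> Ord \<and> s \<le> degree (psi c d). psmult (of_int (n s)) (e s))"
      using e(2)[OF GI[OF cd]] by blast
    have "psi c d = (\<Sum>s\<in>Ord. psmult (of_int (n s)) (e s))"
      by (subst n(2), rule sum.mono_neutral_left) (use n(1) finite_Ord in auto)
    also have "\<dots> = psi (\<Sum>s\<in>Ord. psmult (of_int (n s)) (ec s)) (\<Sum>s\<in>Ord. psmult (of_int (n s)) (ed s))"
      unfolding psi_sum psi_smult by (rule sum.cong) (use ecd in auto)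
    finally have "c = (\<Sum>s\<in>Ord. psmult (of_int (n s)) (ec s)) \<and> d = (\<Sum>s\<in>Ord. psmult (of_int (n s)) (ed s))"
      unfolding psi_inject .
    then show "\<exists>n :: nat \<Rightarrow> int. (\<forall>s. degree (psi c d) < s \<longrightarrow> n s = 0) \<and>
      c = (\<Sum>s\<in>Ord. psmult (of_int (n s)) (ec s)) \<and> d = (\<Sum>s\<in>Ord. psmult (of_int (n s)) (ed s))"
      using n(1) by blast
  qed (use e(1) ecd in auto)
  then show ?thesis by blast
qed

lemma bt_sum_left:
  "bt (\<Sum>s\<in>S. psmult (k s) (a s)) (\<Sum>s\<in>S. psmult (k s) (b s)) c d = (\<Sum>s\<in>S. k s * bt (a s) (b s) c d)"
proof (induction S rule: infinite_finite_induct)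
  case (insert x F)
  then show ?case by (simp add: bt_add_left bt_smult_left)
qed (simp_all add: bt_def tau_def)

text \<open>Triangularity: a correction of order \<open>4 * g + 2 * degree U - N\<close> pairs
  nontrivially with the basis element at \<open>N\<close> and trivially with all those of smaller
  order. So the values are adjusted one order at a time, upwards.\<close>

lemma solve_dual:
  assumes "zbasis ec ed"
  obtains c d where "memF c d" "\<And>s. s \<in> Ord \<Longrightarrow> bt (ec s) (ed s) c d = l s"
proof -
  have e: "memF (ec s) (ed s)" "mem (ec s) (ed s)" "degree (psi (ec s) (ed s)) = s" "psi (ec s) (ed s) \<noteq> 0"
    if "s \<in> Ord" for s using assms that unfolding zbasis_def memF_def by blast+
  have "\<exists>c d. memF c d \<and> (\<forall>s\<in>Ord. s < N \<longrightarrow> bt (ec s) (ed s) c d = l s)" for N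
  proof (induction N)
    case 0
    have "memF 0 0" unfolding memF_def mem_def by simp
    then show ?case by blast
  next
    case (Suc N)
    then obtain c d where cd: "memF c d" "\<forall>s\<in>Ord. s < N \<longrightarrow> bt (ec s) (ed s) c d = l s" by blast
    show ?case
    proof (cases "N \<in> Ord")
      case True
      obtain c0 d0 where 0: "memF c0 d0" "degree (psi c0 d0) = 4 * g + 2 * degree U - N" "lead_coeff (psi c0 d0) = 1"
        using Ord_element[OF Ord_compl(1)[OF True]] by blast
      have m0: "mem c0 d0" using 0(1) unfolding memF_def by blast
      let ?b = "bt (ec N) (ed N) c0 d0"
      have b: "?b = (if even (degree (psi (ec N) (ed N))) then 1 else - 1) * lead_coeff (psi (ec N) (ed N)) * lead_coeff (psi c0 d0)"
        by (rule bt_top[OF e(2)[OF True] m0]) (use e(3)[OF True] 0(2) Ord_compl(2)[OF True] in simp)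
      have "lead_coeff (psi (ec N) (ed N)) \<noteq> 0" using e(4)[OF True] by simp
      then have "?b \<noteq> 0" unfolding b 0(3) by (simp del: leading_coeff_0_iff)
      define k where "k = (l N - bt (ec N) (ed N) c d) / ?b"
      have "bt (ec s) (ed s) (c + psmult k c0) (d + psmult k d0) = l s" if s: "s \<in> Ord" "s < Suc N" for s
      proof (cases "s = N")
        case True
        then show ?thesis using \<open>?b \<noteq> 0\<close> unfolding bt_add_right bt_smult_right k_def by simp
      next
        case False
        then have "bt (ec s) (ed s) c0 d0 = 0"
          using s Ord_compl(2)[OF True] e(3)[OF s(1)] 0(2) by (intro bt_low[OF e(2)[OF s(1)] m0]) simp
        then show ?thesis using False s cd(2) unfolding bt_add_right bt_smult_right by simp
      qed
      then show ?thesis using memF_add[OF cd(1) memF_smult[OF 0(1)]] by blast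
    next
      case False
      then show ?thesis using cd by (metis less_Suc_eq)
    qed
  qed
  then obtain c d where "memF c d" "\<forall>s\<in>Ord. s < Suc (Max Ord) \<longrightarrow> bt (ec s) (ed s) c d = l s" by blast
  then show thesis using that finite_Ord by (metis Max_ge less_Suc_eq_le)
qed

lemma zbasis_rep:
  assumes "zbasis ec ed" "inM c d"
  obtains n :: "nat \<Rightarrow> int" and u v where "mem u v" "c = (\<Sum>s\<in>Ord. psmult (of_int (n s)) (ec s)) + v * fQ"
    "d = (\<Sum>s\<in>Ord. psmult (of_int (n s)) (ed s)) + u"
proof -
  obtain u v where uv: "mem u v" "memF (c - v * fQ) (d - u)" by (rule memF_reduce[OF inM_mem[OF assms(2)]])
  have "mem (- u) (- v)" using mem_smult[OF uv(1), of "- 1"] by simp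
  then have "inM (c - v * fQ) (d - u)" using inM_add_y[OF assms(2), of "- u" "- v"] by simp
  then obtain n :: "nat \<Rightarrow> int" where "c - v * fQ = (\<Sum>s\<in>Ord. psmult (of_int (n s)) (ec s))"
    "d - u = (\<Sum>s\<in>Ord. psmult (of_int (n s)) (ed s))"
    using assms(1) uv(2) unfolding zbasis_def by blast
  then show thesis using that[OF uv(1), of n] by (simp add: algebra_simps)
qed

text \<open>Every integral pair is an integer combination of the basis modulo
  \<open>y I\<^sub>D\<close>, on which the form vanishes, so \<open>self_dual\<close> needs testing
  on the basis only.\<close>

lemma inM_dual:
  assumes "zbasis ec ed" "mem c d" "\<And>s. s \<in> Ord \<Longrightarrow> bt (ec s) (ed s) c d / of_nat M \<in> \<int>"
  shows "inM c d"
proof -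
  have "bt (rat_poly a) (rat_poly b) c d / of_nat M \<in> \<int>" if ab: "memZ a b" for a b
  proof -
    obtain n :: "nat \<Rightarrow> int" and u v where n: "mem u v" "rat_poly a = (\<Sum>s\<in>Ord. psmult (of_int (n s)) (ec s)) + v * fQ"
      "rat_poly b = (\<Sum>s\<in>Ord. psmult (of_int (n s)) (ed s)) + u"
      using zbasis_rep[OF assms(1) inM_memZ[OF ab]] by blast
    have "bt (rat_poly a) (rat_poly b) c d / of_nat M = (\<Sum>s\<in>Ord. of_int (n s) * (bt (ec s) (ed s) c d / of_nat M))"
      unfolding n(2,3) bt_add_left bt_sum_left using bt_y[OF assms(2) n(1)]
      by (simp add: bt_commute sum_divide_distrib)
    also have "\<dots> \<in> \<int>" using assms(3) by (intro Ints_sum Ints_mult Ints_of_int)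
    finally show ?thesis .
  qed
  then obtain a0 b0 c' d' where "memZ a0 b0" "mem c' d'" "c = rat_poly a0 + d' * fQ" "d = rat_poly b0 + c'"
    using self_dual[OF assms(2)] by metis
  then show ?thesis unfolding inM_def by blast
qed

text \<open>
  The elements of pole order less than \<open>2 g + m\<close> span a maximal isotropic subspace \<open>X\<close>, and
  \<open>X\<^sup>\<bottom> / X\<close> has dimension 1. The lattice induces a unimodular lattice there, so it has a
  generator of norm \<open>\<plusminus>1\<close>; but the norm of this generator is \<open>\<plusminus>l\<^sup>2 / M\<close> for a rational number \<open>l\<close>.
\<close>

lemma M_square: "\<exists>N. M = N ^ 2"
proof -
  obtain ec ed where z: "zbasis ec ed" using zbasis_exists by blast
  have e: "memF (ec s) (ed s)" "mem (ec s) (ed s)" "inM (ec s) (ed s)" "degree (psi (ec s) (ed s)) = s" "psi (ec s) (ed s) \<noteq> 0"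
    if "s \<in> Ord" for s using z that unfolding zbasis_def memF_def by blast+
  define k where "k = 2 * g + degree U"
  have k: "k \<in> Ord" unfolding k_def by (rule Ord_mid)
  have T: "4 * g + 2 * degree U = 2 * k" unfolding k_def by simp
  \<comment> \<open>For the form divided by \<open>M\<close>, this is the dual vector to the basis
    element of middle order.\<close>
  obtain c d where cd: "memF c d" "\<And>s. s \<in> Ord \<Longrightarrow> bt (ec s) (ed s) c d = (if s = k then of_nat M else 0)"
    using solve_dual[OF z, of "\<lambda>s. if s = k then of_nat M else 0"] by blast
  have m: "mem c d" using cd(1) unfolding memF_def by blast
  have inM: "inM c d" by (rule inM_dual[OF z m]) (use cd(2) M_pos in auto)
  have nz: "psi c d \<noteq> 0"
  proof
    assume "psi c d = 0"
    then have "bt (ec k) (ed k) c d = 0" unfolding psi_eq_0_iff by (simp add: bt_def tau_def)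
    then show False using cd(2)[OF k] M_pos by simp
  qed
  let ?t = "degree (psi c d)"
  have t: "?t \<in> Ord" by (rule degree_psi_Ord[OF cd(1) nz])
  obtain n :: "nat \<Rightarrow> int" where n: "\<forall>s. ?t < s \<longrightarrow> n s = 0"
    "c = (\<Sum>s\<in>Ord. psmult (of_int (n s)) (ec s))" "d = (\<Sum>s\<in>Ord. psmult (of_int (n s)) (ed s))"
    using z cd(1) inM unfolding zbasis_def by blast
  have "\<not> ?t < k"
  proof
    assume "?t < k"
    then have "bt (ec k) (ed k) c d = 0" using e(4)[OF k] T by (intro bt_low[OF e(2)[OF k] m]) simp
    then show False using cd(2)[OF k] M_pos by simp
  qed
  \<comment> \<open>An element of complementary order \<open>2 * k - ?t < k\<close> pairs
    nontrivially with \<open>(c, d)\<close> by leading coefficients. Yet a multiple of it is a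
    combination of basis elements of order below \<open>k\<close>, all orthogonal to
    \<open>(c, d)\<close>.\<close>
  moreover have "\<not> ?t > k"
  proof
    assume less: "?t > k"
    obtain c0 d0 where 0: "memF c0 d0" "degree (psi c0 d0) = 2 * k - ?t" "lead_coeff (psi c0 d0) = 1"
      using Ord_element[OF Ord_compl(1)[OF t]] unfolding T by blast
    have m0: "mem c0 d0" using 0(1) unfolding memF_def by blast
    obtain q :: int where q: "q > 0" "inM (psmult (of_int q) c0) (psmult (of_int q) d0)"
      using inM_multiple[OF m0] by blast
    have dq: "degree (psi (psmult (of_int q) c0) (psmult (of_int q) d0)) = 2 * k - ?t"
      unfolding psi_smult using q(1) 0(2) by simp
    obtain n' :: "nat \<Rightarrow> int" where n': "\<forall>s. 2 * k - ?t < s \<longrightarrow> n' s = 0"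
      "psmult (of_int q) c0 = (\<Sum>s\<in>Ord. psmult (of_int (n' s)) (ec s))"
      "psmult (of_int q) d0 = (\<Sum>s\<in>Ord. psmult (of_int (n' s)) (ed s))"
      using conjunct2[OF z[unfolded zbasis_def], rule_format, OF memF_smult[OF 0(1)] q(2), unfolded dq] by blast
    have "of_int q * bt c0 d0 c d = (\<Sum>s\<in>Ord. of_int (n' s) * bt (ec s) (ed s) c d)"
      unfolding bt_smult_left[symmetric] n'(2,3) bt_sum_left ..
    also have "\<dots> = 0"
    proof (rule sum.neutral, rule ballI)
      fix s assume s: "s \<in> Ord"
      have "2 * k - ?t < k" using less Ord_compl(2)[OF t] T by linarith
      then show "of_int (n' s) * bt (ec s) (ed s) c d = 0" using n'(1) cd(2)[OF s] by (cases "s = k") auto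
    qed
    finally have "bt c0 d0 c d = 0" using q(1) by simp
    moreover have "bt c0 d0 c d = (if even (2 * k - ?t) then 1 else - 1) * lead_coeff (psi c d)"
      using bt_top[OF m0 m] 0 Ord_compl(2)[OF t] unfolding T by simp
    ultimately show False using nz by (auto split: if_splits)
  qed
  ultimately have tk: "?t = k" by linarith
  define l where "l = lead_coeff (psi (ec k) (ed k))"
  have bk: "bt (ec k) (ed k) (ec k) (ed k) = (if even k then 1 else - 1) * l\<^sup>2"
    using bt_top[OF e(2)[OF k] e(2)[OF k]] e(4)[OF k] unfolding l_def T by (simp add: power2_eq_square)
  \<comment> \<open>Expand \<open>(c, d)\<close> in the basis: orders above \<open>k\<close> do not
    occur, and orders below \<open>k\<close> are orthogonal to the element at
    \<open>k\<close>.\<close>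
  have "of_nat M = bt (ec k) (ed k) c d" using cd(2)[OF k] by simp
  also have "\<dots> = bt c d (ec k) (ed k)" by (rule bt_commute)
  also have "\<dots> = (\<Sum>s\<in>Ord. of_int (n s) * bt (ec s) (ed s) (ec k) (ed k))"
    unfolding n(2,3) bt_sum_left ..
  also have "\<dots> = (\<Sum>s\<in>{k}. of_int (n s) * bt (ec s) (ed s) (ec k) (ed k))"
  proof (rule sum.mono_neutral_right[OF finite_Ord])
    show "\<forall>s\<in>Ord - {k}. of_int (n s) * bt (ec s) (ed s) (ec k) (ed k) = 0"
    proof
      fix s assume s: "s \<in> Ord - {k}"
      show "of_int (n s) * bt (ec s) (ed s) (ec k) (ed k) = 0"
      proof (cases "s > k")
        case True
        then show ?thesis using n(1) tk by simp
      next
        case False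
        then have "bt (ec s) (ed s) (ec k) (ed k) = 0"
          using s e(4) k T by (intro bt_low e(2)) auto
        then show ?thesis by simp
      qed
    qed
  qed (use k in simp)
  finally have eq: "of_nat M = of_int (n k) * bt (ec k) (ed k) (ec k) (ed k)" by simp
  \<comment> \<open>The norm of the element at \<open>k\<close> is \<open>r * M\<close>, and
    \<open>n k * r = 1\<close> forces \<open>\<bar>r\<bar> = 1\<close>; by leading coefficients the
    same norm is the square of \<open>l\<close> up to sign.\<close>
  obtain r where r: "bt (ec k) (ed k) (ec k) (ed k) / of_nat M = of_int r"
    using inM_int[OF e(3)[OF k] e(3)[OF k]] by (metis Ints_cases)
  then have bM: "bt (ec k) (ed k) (ec k) (ed k) = of_int r * of_nat M" using M_pos by (simp add: field_simps)
  have "of_int (n k * r) = (1 :: rat)" using eq M_pos unfolding bM by simp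
  then have "n k * r = 1" by linarith
  then have "\<bar>r\<bar> = 1" by (auto simp: zmult_eq_1_iff)
  then have "\<bar>bt (ec k) (ed k) (ec k) (ed k)\<bar> = of_nat M" unfolding bM by (auto simp: abs_mult)
  then have "l\<^sup>2 = of_nat M" unfolding bk by (auto simp: abs_mult split: if_splits)
  then show ?thesis using rat_square_nat by metis
qed

section \<open>The lattice in \<open>W\<^sub>D\<close>\<close>

abbreviation cls :: "rat poly \<Rightarrow> rat poly \<Rightarrow> (rat poly \<times> rat poly) set" where
  "cls c d \<equiv> W_class fQ U R (c, d)"

abbreviation "W \<equiv> W_space fQ U R"

lemma carrier_W: "carrier W = {cls c d | c d. mem c d}"
proof -
  have "ideal_D U R = {(c, d). mem c d}"
    unfolding ideal_D_def by (auto simp: mult.commute elim!: memE intro: memI)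
  then show ?thesis by (auto simp: W_space_def)
qed

lemma cls_eq_iff: "cls c d = cls c' d' \<longleftrightarrow> (\<exists>u v. mem u v \<and> c = c' + v * fQ \<and> d = d' + u)"
proof
  assume "cls c d = cls c' d'"
  then obtain a b where "c = c' + b * fQ" "d = d' + (a * U - b * R)" unfolding W_class_eq_iff by auto
  moreover have "mem (a * U - b * R) b" by (rule memI[of _ a]) (simp add: mult.commute)
  ultimately show "\<exists>u v. mem u v \<and> c = c' + v * fQ \<and> d = d' + u" by blast
next
  assume "\<exists>u v. mem u v \<and> c = c' + v * fQ \<and> d = d' + u"
  then obtain u v where uv: "mem u v" "c = c' + v * fQ" "d = d' + u" by blast
  obtain x where "u = U * x - v * R" using uv(1) by (rule memE)
  then have "fst (c, d) = fst (c', d') + v * fQ \<and> snd (c, d) = snd (c', d') + (x * U - v * R)"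
    using uv by (simp add: mult.commute)
  then show "cls c d = cls c' d'" unfolding W_class_eq_iff by blast
qed

lemma W_form_cls:
  assumes "mem a b" "mem c d"
  shows "W_form fQ U (cls a b) (cls c d) = (- 1) ^ degree U * bt a b c d"
proof -
  obtain x where x: "a = U * x - b * R" using assms(1) by (rule memE)
  obtain z where z: "c = U * z - d * R" using assms(2) by (rule memE)
  have "a * c - b * d * fQ = U * (x * z * U - (x * d + b * z) * R - b * d * V)"
    unfolding x z fQ_eq by (simp add: algebra_simps power2_eq_square)
  then have "bt a b c d = tau fQ (x * z * U - (x * d + b * z) * R - b * d * V)"
    unfolding bt_def using U_nz by simp
  then show ?thesis using W_form_class[OF UV U_nz, of x b z d] unfolding x z by (simp add: mult.commute)
qed

lemma cls_closed: "mem c d \<Longrightarrow> cls c d \<in> carrier W"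
  unfolding carrier_W by blast

sublocale W: vectorspace class_ring W
  by (rule vectorspace_W)

lemma finsum_cls:
  assumes "finite S" "\<And>s. s \<in> S \<Longrightarrow> mem (a s) (b s)"
  shows "(\<Oplus>\<^bsub>W\<^esub>s\<in>S. k s \<odot>\<^bsub>W\<^esub> cls (a s) (b s)) =
    cls (\<Sum>s\<in>S. psmult (k s) (a s)) (\<Sum>s\<in>S. psmult (k s) (b s))"
  using assms
proof (induction S rule: finite_induct)
  case empty
  then show ?case by (simp add: W_zero)
next
  case (insert x F)
  have c: "k s \<odot>\<^bsub>W\<^esub> cls (a s) (b s) \<in> carrier W" if "s \<in> insert x F" for s
    unfolding W_smult using insert.prems[OF that] by (intro cls_closed) (simp add: mem_smult)
  then show ?case using insert by (subst W.finsum_insert) (auto simp: W_add W_smult)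
qed

text \<open>A nonzero reduced pair has its order in \<open>Ord\<close>, and the basis element of
  complementary order pairs nontrivially with it.\<close>

lemma memF_nondegenerate:
  assumes z: "zbasis ec ed" and cd: "memF c d" "\<And>s. s \<in> Ord \<Longrightarrow> bt (ec s) (ed s) c d = 0"
  shows "c = 0 \<and> d = 0"
proof (rule ccontr)
  assume "\<not> (c = 0 \<and> d = 0)"
  then have nz: "psi c d \<noteq> 0" unfolding psi_eq_0_iff .
  have t: "degree (psi c d) \<in> Ord" by (rule degree_psi_Ord[OF cd(1) nz])
  define s where "s = 4 * g + 2 * degree U - degree (psi c d)"
  have s: "s \<in> Ord" "s + degree (psi c d) = 4 * g + 2 * degree U"
    unfolding s_def using Ord_compl[OF t] by auto
  have e: "mem (ec s) (ed s)" "degree (psi (ec s) (ed s)) = s" "psi (ec s) (ed s) \<noteq> 0"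
    using z s(1) unfolding zbasis_def memF_def by blast+
  have m: "mem c d" using cd(1) unfolding memF_def by blast
  have "bt (ec s) (ed s) c d = (if even (degree (psi (ec s) (ed s))) then 1 else - 1) *
    lead_coeff (psi (ec s) (ed s)) * lead_coeff (psi c d)"
    by (rule bt_top[OF e(1) m]) (simp add: e(2) s(2))
  moreover have "lead_coeff (psi (ec s) (ed s)) \<noteq> 0" "lead_coeff (psi c d) \<noteq> 0" using e(3) nz by simp_all
  ultimately show False using cd(2)[OF s(1)] by (simp del: leading_coeff_0_iff split: if_splits)
qed

lemma bt_cls_zero:
  assumes "mem a b" "mem c d" "cls c d = cls 0 0" shows "bt a b c d = 0"
proof -
  obtain u v where "mem u v" "c = 0 + v * fQ" "d = 0 + u" using assms(3) unfolding cls_eq_iff by blast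
  then show ?thesis using bt_y[OF assms(1)] by simp
qed

lemma cls_nondegenerate:
  assumes z: "zbasis ec ed" and cd: "mem c d" "\<And>s. s \<in> Ord \<Longrightarrow> bt (ec s) (ed s) c d = 0"
  shows "cls c d = cls 0 0"
proof -
  obtain u v where uv: "mem u v" "memF (c - v * fQ) (d - u)" by (rule memF_reduce[OF cd(1)])
  have "bt (ec s) (ed s) (c - v * fQ) (d - u) = 0" if s: "s \<in> Ord" for s
  proof -
    have e: "mem (ec s) (ed s)" using z s unfolding zbasis_def memF_def by blast
    show ?thesis unfolding bt_diff_right using bt_y[OF e uv(1)] cd(2)[OF s] by simp
  qed
  then have "c - v * fQ = 0 \<and> d - u = 0" using memF_nondegenerate[OF z uv(2)] by blast
  then show ?thesis unfolding cls_eq_iff using uv(1) by auto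
qed

lemma inM_smult_int: "inM c d \<Longrightarrow> inM (psmult (of_int k) c) (psmult (of_int k) d)"
proof -
  assume "inM c d"
  then obtain a b u v where 1: "memZ a b" "mem u v" "c = rat_poly a + v * fQ" "d = rat_poly b + u"
    unfolding inM_def by blast
  have "psmult (of_int k) c = rat_poly (psmult k a) + psmult (of_int k) v * fQ"
    "psmult (of_int k) d = rat_poly (psmult k b) + psmult (of_int k) u"
    unfolding 1 by (simp_all add: rat_poly_smult smult_add_right)
  then show ?thesis unfolding inM_def using memZ_smult[OF 1(1)] mem_smult[OF 1(2)] by blast
qed

lemma inM_0: "inM 0 0"
  using inM_memZ[of 0 0] by (simp add: memZ_def mem_def)

lemma inM_add: "inM a b \<Longrightarrow> inM c d \<Longrightarrow> inM (a + c) (b + d)"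
  using inM_diff[of a b "- c" "- d"] inM_smult_int[of c d "- 1"] by simp

lemma inM_sum: "(\<And>s. s \<in> S \<Longrightarrow> inM (a s) (b s)) \<Longrightarrow> inM (\<Sum>s\<in>S. a s) (\<Sum>s\<in>S. b s)"
  by (induction S rule: infinite_finite_induct) (simp_all add: inM_0 inM_add)

lemma inM_x: "inM c d \<Longrightarrow> inM ([:0, 1:] * c) ([:0, 1:] * d)"
proof -
  assume "inM c d"
  then obtain a b u v where 1: "memZ a b" "mem u v" "c = rat_poly a + v * fQ" "d = rat_poly b + u"
    unfolding inM_def by blast
  have x: "[:0, 1:] = rat_poly [:0, 1:]" by (simp add: of_int_hom.map_poly_pCons_hom)
  have "[:0, 1:] * c = rat_poly ([:0, 1:] * a) + ([:0, 1:] * v) * fQ"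
    "[:0, 1:] * d = rat_poly ([:0, 1:] * b) + [:0, 1:] * u"
    unfolding 1 rat_poly_hom x[symmetric] by (simp_all only: algebra_simps)
  then show ?thesis unfolding inM_def using memZ_mult[OF 1(1)] mem_mult[OF 1(2)] by blast
qed

text \<open>With \<open>r = 1 / N\<close> the form is divided by \<open>M\<close>, which makes it
  integral and unimodular here.\<close>

definition lat :: "rat \<Rightarrow> (rat poly \<times> rat poly) set set" where
  "lat r = {cls (psmult r c) (psmult r d) | c d. inM c d}"

lemma latI: "inM c d \<Longrightarrow> cls (psmult r c) (psmult r d) \<in> lat r"
  unfolding lat_def by blast

lemma latE:
  assumes "v \<in> lat r"
  obtains c d where "v = cls (psmult r c) (psmult r d)" "inM c d"
  using assms unfolding lat_def by blast

lemma W_op_lattice: "W_op fQ U R ` lat r \<subseteq> lat r"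
proof
  fix w assume "w \<in> W_op fQ U R ` lat r"
  then obtain c d where cd: "w = W_op fQ U R (cls (psmult r c) (psmult r d))" "inM c d"
    unfolding lat_def by blast
  have "w = cls (psmult r ([:0, 1:] * c)) (psmult r ([:0, 1:] * d))"
    unfolding cd(1) W_op_class fst_conv snd_conv by (simp only: mult_smult_right)
  then show "w \<in> lat r" using latI[OF inM_x[OF cd(2)]] by simp
qed

context
  fixes r :: rat and ec ed :: "nat \<Rightarrow> rat poly"
  assumes z: "zbasis ec ed" and r: "r\<^sup>2 = 1 / of_nat M"
begin

definition ek :: "nat \<Rightarrow> (rat poly \<times> rat poly) set" where
  "ek s = cls (psmult r (ec s)) (psmult r (ed s))"

lemma r_nz: "r \<noteq> 0" using r M_pos by auto

lemma zbasis_elem: assumes "s \<in> Ord" shows "memF (ec s) (ed s)" "mem (ec s) (ed s)" "inM (ec s) (ed s)"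
  "mem (psmult r (ec s)) (psmult r (ed s))"
  using z assms mem_smult unfolding zbasis_def memF_def by blast+

lemma finsum_ek:
  "(\<Oplus>\<^bsub>W\<^esub>s\<in>Ord. k s \<odot>\<^bsub>W\<^esub> ek s) =
    cls (psmult r (\<Sum>s\<in>Ord. psmult (k s) (ec s))) (psmult r (\<Sum>s\<in>Ord. psmult (k s) (ed s)))"
proof -
  have "psmult r (\<Sum>s\<in>Ord. psmult (k s) (e s)) = (\<Sum>s\<in>Ord. psmult (k s) (psmult r (e s)))"
    for e :: "nat \<Rightarrow> rat poly" by (induction rule: infinite_finite_induct) (simp_all add: smult_add_right mult.commute)
  then show ?thesis unfolding ek_def using finsum_cls[OF finite_Ord zbasis_elem(4)] by simp
qed

lemma ek_closed: "s \<in> Ord \<Longrightarrow> ek s \<in> carrier W"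
  unfolding ek_def by (intro cls_closed zbasis_elem(4))

text \<open>The coefficient at \<open>s\<close> is read off by pairing with a dual vector from
  \<open>solve_dual\<close>.\<close>

lemma ek_independent:
  assumes "(\<Oplus>\<^bsub>W\<^esub>s\<in>Ord. k s \<odot>\<^bsub>W\<^esub> ek s) = \<zero>\<^bsub>W\<^esub>" "s \<in> Ord" shows "k s = 0"
proof -
  let ?c = "\<Sum>s\<in>Ord. psmult (k s) (ec s)" and ?d = "\<Sum>s\<in>Ord. psmult (k s) (ed s)"
  have "mem (\<Sum>s\<in>S. psmult (k s) (ec s)) (\<Sum>s\<in>S. psmult (k s) (ed s))" if "S \<subseteq> Ord" for S
    using that by (induction S rule: infinite_finite_induct) (auto simp: mem_def[of 0 0] intro!: mem_add mem_smult zbasis_elem(2))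
  then have m: "mem ?c ?d" by blast
  obtain c d where cd: "memF c d" "\<And>t. t \<in> Ord \<Longrightarrow> bt (ec t) (ed t) c d = (if t = s then 1 else 0)"
    using solve_dual[OF z, of "\<lambda>t. if t = s then 1 else 0"] by blast
  have mcd: "mem c d" using cd(1) unfolding memF_def by blast
  have "bt c d (psmult r ?c) (psmult r ?d) = 0"
    using assms(1) unfolding finsum_ek W_zero by (rule bt_cls_zero[OF mcd mem_smult[OF m]])
  then have "bt ?c ?d c d = 0" using r_nz unfolding bt_smult_right by (simp add: bt_commute)
  moreover have "bt ?c ?d c d = (\<Sum>t\<in>Ord. k t * (if t = s then 1 else 0))"
    unfolding bt_sum_left by (rule sum.cong) (use cd(2) in auto)
  moreover have "(\<Sum>t\<in>Ord. k t * (if t = s then 1 else 0)) = k s"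
    using assms(2) finite_Ord by (simp add: if_distrib[of "(*) _"] sum.delta cong: if_cong)
  ultimately show ?thesis by simp
qed

text \<open>Needed because a basis is a set of cosets whereas coefficients are indexed by orders. A
  coincidence would be a linear relation with coefficients 1 and - 1.\<close>

lemma inj_ek: "inj_on ek Ord"
proof (rule inj_onI, rule ccontr)
  fix s t assume st: "s \<in> Ord" "t \<in> Ord" "ek s = ek t" "s \<noteq> t"
  define k :: "nat \<Rightarrow> rat" where "k = (\<lambda>i. if i = s then 1 else if i = t then - 1 else 0)"
  have "(\<Sum>i\<in>Ord. psmult (k i) (e i)) = e s - e t" for e :: "nat \<Rightarrow> rat poly"
  proof -
    have "(\<Sum>i\<in>Ord. psmult (k i) (e i)) = (\<Sum>i\<in>{s, t}. psmult (k i) (e i))"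
      by (rule sum.mono_neutral_right) (use st finite_Ord in \<open>auto simp: k_def\<close>)
    then show ?thesis using st(4) by (simp add: k_def)
  qed
  then have "(\<Oplus>\<^bsub>W\<^esub>s\<in>Ord. k s \<odot>\<^bsub>W\<^esub> ek s) = cls (psmult r (ec s - ec t)) (psmult r (ed s - ed t))"
    unfolding finsum_ek by simp
  also have "\<dots> = \<zero>\<^bsub>W\<^esub>"
    using st(3) unfolding ek_def cls_eq_iff W_zero by (auto simp: smult_diff_right)
  finally have "k s = 0" using ek_independent st(1) by blast
  then show False unfolding k_def by simp
qed

lemma finsum_image:
  "(\<Oplus>\<^bsub>W\<^esub>b\<in>ek ` Ord. k b \<odot>\<^bsub>W\<^esub> b) = (\<Oplus>\<^bsub>W\<^esub>s\<in>Ord. k (ek s) \<odot>\<^bsub>W\<^esub> ek s)"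
  by (rule W.finsum_reindex[OF _ inj_ek]) (auto simp: ek_closed intro!: W.smult_closed)

lemma basis_ek: "W.basis (ek ` Ord)"
  unfolding W.basis_def
proof (intro conjI)
  show car: "ek ` Ord \<subseteq> carrier W" using ek_closed by blast
  show "W.lin_indpt (ek ` Ord)"
  proof (rule W.finite_lin_indpt2[OF finite_imageI[OF finite_Ord] car])
    fix a assume "W.lincomb a (ek ` Ord) = \<zero>\<^bsub>W\<^esub>"
    then have "(\<Oplus>\<^bsub>W\<^esub>s\<in>Ord. a (ek s) \<odot>\<^bsub>W\<^esub> ek s) = \<zero>\<^bsub>W\<^esub>" unfolding W.lincomb_def finsum_image .
    then have "a (ek s) = 0" if "s \<in> Ord" for s using ek_independent[of "\<lambda>s. a (ek s)"] that by blast
    then show "\<forall>v\<in>ek ` Ord. a v = \<zero>\<^bsub>class_ring\<^esub>" by (simp add: class_ring_simps)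
  qed
  show "W.span (ek ` Ord) = carrier W"
  proof
    show "W.span (ek ` Ord) \<subseteq> carrier W" by (rule W.span_is_subset2[OF car])
    show "carrier W \<subseteq> W.span (ek ` Ord)"
    proof
      fix X assume "X \<in> carrier W"
      then obtain c d where X: "X = cls c d" "mem c d" unfolding carrier_W by blast
      obtain k :: int where k: "k > 0" "inM (psmult (of_int k) c) (psmult (of_int k) d)"
        by (rule inM_multiple[OF X(2)])
      obtain n :: "nat \<Rightarrow> int" and u v where n: "mem u v"
        "psmult (of_int k) c = (\<Sum>s\<in>Ord. psmult (of_int (n s)) (ec s)) + v * fQ"
        "psmult (of_int k) d = (\<Sum>s\<in>Ord. psmult (of_int (n s)) (ed s)) + u"
        by (rule zbasis_rep[OF z k(2)])
      \<comment> \<open>Here \<open>k\<close> undoes the clearing of denominators and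
        \<open>r\<close> the scaling of the lattice.\<close>
      define q where "q s = of_int (n s) / (of_int k * r)" for s
      have sum_q: "psmult r (\<Sum>s\<in>Ord. psmult (q s) (e s)) =
        psmult (1 / of_int k) (\<Sum>s\<in>Ord. psmult (of_int (n s)) (e s))" for e :: "nat \<Rightarrow> rat poly"
        unfolding q_def using r_nz
        by (induction rule: infinite_finite_induct) (simp_all add: smult_add_right)
      have "c = psmult (1 / of_int k) (psmult (of_int k) c)"
        "d = psmult (1 / of_int k) (psmult (of_int k) d)" using k(1) by simp_all
      then have "c = psmult r (\<Sum>s\<in>Ord. psmult (q s) (ec s)) + psmult (1 / of_int k) v * fQ"
        "d = psmult r (\<Sum>s\<in>Ord. psmult (q s) (ed s)) + psmult (1 / of_int k) u"
        unfolding n(2,3) sum_q by (simp_all add: smult_add_right)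
      then have "X = (\<Oplus>\<^bsub>W\<^esub>s\<in>Ord. q s \<odot>\<^bsub>W\<^esub> ek s)"
        unfolding X(1) finsum_ek cls_eq_iff using mem_smult[OF n(1)] by blast
      also have "\<dots> = (\<Oplus>\<^bsub>W\<^esub>s\<in>Ord. q (inv_into Ord ek (ek s)) \<odot>\<^bsub>W\<^esub> ek s)"
        by (rule W.finsum_cong') (auto simp: inj_ek ek_closed intro!: W.smult_closed)
      also have "\<dots> = W.lincomb (\<lambda>b. q (inv_into Ord ek b)) (ek ` Ord)"
        unfolding W.lincomb_def finsum_image ..
      finally show "X \<in> W.span (ek ` Ord)"
        unfolding W.finite_span[OF finite_imageI[OF finite_Ord] car] by auto
    qed
  qed
qed

lemma lattice_Z_span: "lat r = Z_span W (ek ` Ord)"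
proof
  show "lat r \<subseteq> Z_span W (ek ` Ord)"
  proof
    fix X assume "X \<in> lat r"
    then obtain c d where X: "X = cls (psmult r c) (psmult r d)" "inM c d" by (rule latE)
    obtain n :: "nat \<Rightarrow> int" and u v where n: "mem u v"
      "c = (\<Sum>s\<in>Ord. psmult (of_int (n s)) (ec s)) + v * fQ"
      "d = (\<Sum>s\<in>Ord. psmult (of_int (n s)) (ed s)) + u"
      by (rule zbasis_rep[OF z X(2)])
    have "psmult r c = psmult r (\<Sum>s\<in>Ord. psmult (of_int (n s)) (ec s)) + psmult r v * fQ"
      "psmult r d = psmult r (\<Sum>s\<in>Ord. psmult (of_int (n s)) (ed s)) + psmult r u"
      unfolding n(2,3) by (simp_all add: smult_add_right)
    then have "X = (\<Oplus>\<^bsub>W\<^esub>s\<in>Ord. of_int (n s) \<odot>\<^bsub>W\<^esub> ek s)"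
      unfolding X(1) finsum_ek cls_eq_iff using mem_smult[OF n(1)] by blast
    also have "\<dots> = (\<Oplus>\<^bsub>W\<^esub>s\<in>Ord. of_int (n (inv_into Ord ek (ek s))) \<odot>\<^bsub>W\<^esub> ek s)"
      by (rule W.finsum_cong') (auto simp: inj_ek ek_closed intro!: W.smult_closed)
    also have "\<dots> = (\<Oplus>\<^bsub>W\<^esub>b\<in>ek ` Ord. of_int (n (inv_into Ord ek b)) \<odot>\<^bsub>W\<^esub> b)"
      unfolding finsum_image ..
    finally have "X = (\<Oplus>\<^bsub>W\<^esub>b\<in>ek ` Ord. of_int ((\<lambda>b. n (inv_into Ord ek b)) b) \<odot>\<^bsub>W\<^esub> b)" .
    then show "X \<in> Z_span W (ek ` Ord)" unfolding Z_span_def mem_Collect_eq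
      by (intro exI[of _ "\<lambda>b. n (inv_into Ord ek b)"]) simp
  qed
  show "Z_span W (ek ` Ord) \<subseteq> lat r"
  proof
    fix X assume "X \<in> Z_span W (ek ` Ord)"
    then obtain n where "X = (\<Oplus>\<^bsub>W\<^esub>b\<in>ek ` Ord. of_int (n b) \<odot>\<^bsub>W\<^esub> b)" unfolding Z_span_def by blast
    then have X: "X = (\<Oplus>\<^bsub>W\<^esub>s\<in>Ord. of_int (n (ek s)) \<odot>\<^bsub>W\<^esub> ek s)" unfolding finsum_image .
    show "X \<in> lat r" unfolding X finsum_ek by (intro latI inM_sum inM_smult_int zbasis_elem(3))
  qed
qed

lemma form_lattice:
  assumes "inM a b" "inM c d"
  shows "W_form fQ U (cls (psmult r a) (psmult r b)) (cls (psmult r c) (psmult r d)) =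
    (- 1) ^ degree U * (bt a b c d / of_nat M)"
proof -
  have "bt (psmult r a) (psmult r b) (psmult r c) (psmult r d) = r\<^sup>2 * bt a b c d"
    unfolding bt_smult_left bt_smult_right by (simp add: power2_eq_square)
  then show ?thesis using W_form_cls[OF mem_smult mem_smult, OF inM_mem[OF assms(1)] inM_mem[OF assms(2)], of r r]
    unfolding r by simp
qed

lemma lattice_add:
  assumes "inM a b" "inM c d"
  shows "cls (psmult r a) (psmult r b) \<oplus>\<^bsub>W\<^esub> cls (psmult r c) (psmult r d) =
    cls (psmult r (a + c)) (psmult r (b + d))"
  unfolding W_add by (simp add: smult_add_right)

lemma lattice_form_int:
  assumes "v \<in> lat r" "w \<in> lat r" shows "W_form fQ U v w \<in> \<int>"
proof -
  obtain a b where 1: "v = cls (psmult r a) (psmult r b)" "inM a b" using assms(1) by (rule latE)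
  obtain c d where 2: "w = cls (psmult r c) (psmult r d)" "inM c d" using assms(2) by (rule latE)
  show ?thesis unfolding 1(1) 2(1) form_lattice[OF 1(2) 2(2)] by (intro Ints_mult inM_int[OF 1(2) 2(2)]) simp
qed

lemma lattice_form_inj:
  assumes "v \<in> lat r" "w \<in> lat r" "\<And>x. x \<in> lat r \<Longrightarrow> W_form fQ U v x = W_form fQ U w x"
  shows "v = w"
proof -
  obtain a b where 1: "v = cls (psmult r a) (psmult r b)" "inM a b" using assms(1) by (rule latE)
  obtain c d where 2: "w = cls (psmult r c) (psmult r d)" "inM c d" using assms(2) by (rule latE)
  have "bt (ec s) (ed s) (a - c) (b - d) = 0" if s: "s \<in> Ord" for s
  proof -
    have "bt a b (ec s) (ed s) = bt c d (ec s) (ed s)"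
      using assms(3)[OF latI[OF zbasis_elem(3)[OF s]]] M_pos
      unfolding 1(1) 2(1) form_lattice[OF 1(2) zbasis_elem(3)[OF s]] form_lattice[OF 2(2) zbasis_elem(3)[OF s]] by simp
    then show ?thesis unfolding bt_diff_right by (simp add: bt_commute)
  qed
  then have "cls (a - c) (b - d) = cls 0 0"
    by (intro cls_nondegenerate[OF z] mem_diff inM_mem 1(2) 2(2))
  then obtain u v' where uv: "mem u v'" "a - c = 0 + v' * fQ" "b - d = 0 + u" unfolding cls_eq_iff by blast
  have "psmult r a = psmult r c + psmult r v' * fQ"
    "psmult r b = psmult r d + psmult r u"
    using arg_cong[OF uv(2), of "psmult r"] arg_cong[OF uv(3), of "psmult r"]
    by (simp_all add: smult_diff_right algebra_simps)
  then show ?thesis unfolding 1(1) 2(1) cls_eq_iff using mem_smult[OF uv(1)] by blast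
qed

text \<open>Members of \<open>Z_dual\<close> are only required to be additive; integer coefficients
  are pulled out by way of natural multiples and negation.\<close>

lemma additive_sum:
  fixes l :: "(rat poly \<times> rat poly) set \<Rightarrow> rat"
  assumes add: "\<And>v w. v \<in> lat r \<Longrightarrow> w \<in> lat r \<Longrightarrow> l (v \<oplus>\<^bsub>W\<^esub> w) = l v + l w"
  defines "L \<equiv> \<lambda>c d. l (cls (psmult r c) (psmult r d))"
  assumes fin: "finite S" and S: "\<And>s. s \<in> S \<Longrightarrow> inM (a s) (b s)"
  shows "L (\<Sum>s\<in>S. psmult (of_int (n s)) (a s)) (\<Sum>s\<in>S. psmult (of_int (n s)) (b s)) =
    (\<Sum>s\<in>S. of_int (n s) * L (a s) (b s))"
proof -
  have Ladd: "L (c + c') (d + d') = L c d + L c' d'" if "inM c d" "inM c' d'" for c c' d d'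
    unfolding L_def lattice_add[OF that, symmetric] by (rule add) (intro latI that)+
  have L0: "L 0 0 = 0" using Ladd[OF inM_0 inM_0] by simp
  have Lneg: "L (- c) (- d) = - L c d" if "inM c d" for c d
    using Ladd[OF that, of "- c" "- d"] inM_smult_int[OF that, of "- 1"] L0 by simp
  have Lnat: "L (psmult (of_nat k) c) (psmult (of_nat k) d) = of_nat k * L c d" if "inM c d" for k c d
  proof (induction k)
    case (Suc k)
    have "inM (psmult (of_nat k) c) (psmult (of_nat k) d)" using inM_smult_int[OF that, of "int k"] by simp
    then have "L (c + psmult (of_nat k) c) (d + psmult (of_nat k) d) = L c d + of_nat k * L c d"
      using Ladd[OF that] Suc by metis
    then show ?case by (simp add: smult_add_left algebra_simps)
  qed (simp add: L0)
  have Lint: "L (psmult (of_int k) c) (psmult (of_int k) d) = of_int k * L c d" if "inM c d" for k c d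
  proof (cases "k \<ge> 0")
    case True
    then show ?thesis using Lnat[OF that, of "nat k"] by simp
  next
    case False
    have "inM (psmult (of_nat (nat (- k))) c) (psmult (of_nat (nat (- k))) d)"
      using inM_smult_int[OF that, of "- k"] False by simp
    from Lneg[OF this] show ?thesis using Lnat[OF that, of "nat (- k)"] False by simp
  qed
  show ?thesis using fin S
  proof (induction S rule: finite_induct)
    case (insert x F)
    have "inM (\<Sum>s\<in>F. psmult (of_int (n s)) (a s)) (\<Sum>s\<in>F. psmult (of_int (n s)) (b s))"
      using insert.prems by (intro inM_sum inM_smult_int) blast
    then show ?case using insert Ladd[OF inM_smult_int] Lint by simp
  qed (simp add: L0)
qed

text \<open>\<open>solve_dual\<close> gives a rational vector with the prescribed values on the
  basis, and \<open>inM_dual\<close> puts it into the lattice because these values are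
  integers.\<close>

lemma lattice_form_surj:
  assumes l: "l \<in> Z_dual W (lat r)"
  obtains v where "v \<in> lat r" "l = (\<lambda>w\<in>lat r. W_form fQ U v w)"
proof -
  have l_int: "\<And>v. v \<in> lat r \<Longrightarrow> l v \<in> \<int>" and l_ext: "l \<in> extensional (lat r)"
    and l_add: "\<And>v w. v \<in> lat r \<Longrightarrow> w \<in> lat r \<Longrightarrow> l (v \<oplus>\<^bsub>W\<^esub> w) = l v + l w"
    using l unfolding Z_dual_def by (auto simp: PiE_iff)
  define L where "L = (\<lambda>c d. l (cls (psmult r c) (psmult r d)))"
  define \<epsilon> :: rat where "\<epsilon> = (- 1) ^ degree U"
  have \<epsilon>: "\<epsilon> * \<epsilon> = 1" "\<epsilon> \<in> \<int>" unfolding \<epsilon>_def by (simp_all flip: power_mult_distrib)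
  \<comment> \<open>On the lattice the form is \<open>\<epsilon> * bt / M\<close>, and
    \<open>\<epsilon>\<close> is its own inverse; hence the factor.\<close>
  obtain c d where cd: "memF c d" "\<And>s. s \<in> Ord \<Longrightarrow> bt (ec s) (ed s) c d = \<epsilon> * of_nat M * L (ec s) (ed s)"
    using solve_dual[OF z, of "\<lambda>s. \<epsilon> * of_nat M * L (ec s) (ed s)"] by blast
  have m: "mem c d" using cd(1) unfolding memF_def by blast
  have inM: "inM c d"
  proof (rule inM_dual[OF z m])
    fix s assume s: "s \<in> Ord"
    have "bt (ec s) (ed s) c d / of_nat M = \<epsilon> * L (ec s) (ed s)" using cd(2)[OF s] M_pos by simp
    also have "\<dots> \<in> \<int>" unfolding L_def by (intro Ints_mult \<epsilon> l_int latI zbasis_elem(3) s)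
    finally show "bt (ec s) (ed s) c d / of_nat M \<in> \<int>" .
  qed
  let ?v = "cls (psmult r c) (psmult r d)"
  show thesis
  proof (rule that[OF latI[OF inM]])
    show "l = (\<lambda>w\<in>lat r. W_form fQ U ?v w)"
    proof (rule extensionalityI[OF l_ext])
      fix w assume "w \<in> lat r"
      then have "w \<in> Z_span W (ek ` Ord)" unfolding lattice_Z_span .
      then obtain n where "w = (\<Oplus>\<^bsub>W\<^esub>b\<in>ek ` Ord. of_int (n b) \<odot>\<^bsub>W\<^esub> b)" unfolding Z_span_def by blast
      then have w: "w = cls (psmult r (\<Sum>s\<in>Ord. psmult (of_int (n (ek s))) (ec s)))
          (psmult r (\<Sum>s\<in>Ord. psmult (of_int (n (ek s))) (ed s)))"
        unfolding finsum_image finsum_ek .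
      have iw: "inM (\<Sum>s\<in>Ord. psmult (of_int (n (ek s))) (ec s)) (\<Sum>s\<in>Ord. psmult (of_int (n (ek s))) (ed s))"
        by (intro inM_sum inM_smult_int zbasis_elem(3))
      have "l w = (\<Sum>s\<in>Ord. of_int (n (ek s)) * L (ec s) (ed s))"
        unfolding w L_def by (rule additive_sum[OF l_add finite_Ord zbasis_elem(3)])
      also have "\<dots> = (\<Sum>s\<in>Ord. of_int (n (ek s)) * (\<epsilon> * (bt (ec s) (ed s) c d / of_nat M)))"
        by (rule sum.cong) (use cd(2) M_pos \<epsilon>(1) in \<open>simp_all flip: mult.assoc\<close>)
      also have "\<dots> = \<epsilon> * ((\<Sum>s\<in>Ord. of_int (n (ek s)) * bt (ec s) (ed s) c d) / of_nat M)"
        by (simp add: sum_distrib_left sum_divide_distrib mult.left_commute)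
      also have "\<dots> = W_form fQ U ?v w"
        unfolding w form_lattice[OF inM iw] \<epsilon>_def[symmetric] by (subst bt_commute) (simp only: bt_sum_left)
      finally show "l w = (\<lambda>w\<in>lat r. W_form fQ U ?v w) w" using \<open>w \<in> lat r\<close> by simp
    qed (simp add: restrict_extensional)
  qed
qed

lemma Z_lattice_lat_aux: "Z_lattice W (W_form fQ U) (lat r)"
  unfolding Z_lattice_def
proof (intro conjI)
  show "\<exists>E. finite E \<and> vectorspace.basis class_ring W E \<and> lat r = Z_span W E"
    using basis_ek lattice_Z_span finite_Ord by blast
  show "\<forall>v\<in>lat r. \<forall>w\<in>lat r. W_form fQ U v w \<in> \<int>" using lattice_form_int by blast
  show "bij_betw (\<lambda>v. \<lambda>w\<in>lat r. W_form fQ U v w) (lat r) (Z_dual W (lat r))"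
    unfolding bij_betw_def
  proof
    show "inj_on (\<lambda>v. \<lambda>w\<in>lat r. W_form fQ U v w) (lat r)"
    proof (rule inj_onI, rule lattice_form_inj)
      fix v w x assume eq: "(\<lambda>x\<in>lat r. W_form fQ U v x) = (\<lambda>x\<in>lat r. W_form fQ U w x)" and x: "x \<in> lat r"
      show "W_form fQ U v x = W_form fQ U w x" using fun_cong[OF eq, of x] x by simp
    qed
    have "(\<lambda>w\<in>lat r. W_form fQ U v w) \<in> Z_dual W (lat r)" if v: "v \<in> lat r" for v
    proof -
      obtain a b where 1: "v = cls (psmult r a) (psmult r b)" "inM a b" using v by (rule latE)
      have "x \<oplus>\<^bsub>W\<^esub> y \<in> lat r \<and> W_form fQ U v (x \<oplus>\<^bsub>W\<^esub> y) = W_form fQ U v x + W_form fQ U v y"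
        if xy: "x \<in> lat r" "y \<in> lat r" for x y
      proof -
        obtain c d where 2: "x = cls (psmult r c) (psmult r d)" "inM c d" using xy(1) by (rule latE)
        obtain c' d' where 3: "y = cls (psmult r c') (psmult r d')" "inM c' d'" using xy(2) by (rule latE)
        have s: "inM (c + c') (d + d')" by (rule inM_add[OF 2(2) 3(2)])
        show ?thesis unfolding 1(1) 2(1) 3(1) lattice_add[OF 2(2) 3(2)]
            form_lattice[OF 1(2) 2(2)] form_lattice[OF 1(2) 3(2)] form_lattice[OF 1(2) s] bt_add_right
          using latI[OF s] by (simp add: algebra_simps add_divide_distrib)
      qed
      then show ?thesis unfolding Z_dual_def using lattice_form_int[OF v] by auto
    qed
    then show "(\<lambda>v. \<lambda>w\<in>lat r. W_form fQ U v w) ` lat r = Z_dual W (lat r)"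
      using lattice_form_surj by (auto simp: image_iff) (metis (no_types, lifting))
  qed
qed

end

lemma Z_lattice_lat: "r\<^sup>2 = 1 / of_nat M \<Longrightarrow> Z_lattice W (W_form fQ U) (lat r)"
  using zbasis_exists Z_lattice_lat_aux by blast

text \<open>Modulo \<open>p\<close> the monic \<open>f\<close> has larger degree than
  \<open>P\<close>, so it cannot divide \<open>P\<close>, which is not 0 modulo
  \<open>p\<close>.\<close>

lemma not_multiple_mod_f:
  fixes p :: int
  assumes "prime p" shows "P \<noteq> psmult p a + t * f"
proof
  assume eq: "P = psmult p a + t * f"
  \<comment> \<open>The coefficients of \<open>t\<close> are reduced to residues below
    \<open>p\<close>, so that a nonzero \<open>s\<close> has a leading coefficient not divisible by
    \<open>p\<close>.\<close>
  define q where "q = map_poly (\<lambda>c. c div p) t"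
  define s where "s = map_poly (\<lambda>c. c mod p) t"
  have t: "t = psmult p q + s"
    by (rule poly_eqI) (simp add: q_def s_def coeff_map_poly)
  have sf: "s * f = P - psmult p (a + q * f)"
    unfolding eq t by (simp add: algebra_simps smult_add_right)
  have "s = 0"
  proof (rule ccontr)
    assume s: "s \<noteq> 0"
    have d: "degree (s * f) = degree s + degree f" using s f_nz by (simp add: degree_mult_eq)
    have "degree P = degree U" using P M_pos by (metis degree_rat_poly degree_smult_eq of_nat_eq_0_iff less_irrefl)
    then have "degree P < degree (s * f)" unfolding d degree_f using degree_U by simp
    then have "coeff (s * f) (degree (s * f)) = - (p * coeff (a + q * f) (degree (s * f)))"
      unfolding sf using coeff_eq_0 by simp
    then have "p dvd lead_coeff (s * f)" by simp
    then have "p dvd lead_coeff s" using monic_f by (simp add: lead_coeff_mult)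
    moreover have "lead_coeff s = coeff t (degree s) mod p" unfolding s_def by (simp add: coeff_map_poly)
    ultimately have "lead_coeff s = 0" by (metis dvd_imp_mod_0 mod_mod_trivial)
    then show False using s by simp
  qed
  then have "P = psmult p (a + q * f)" using sf by simp
  then have "[:p:] dvd P" unfolding const_dvd_iff_smult by blast
  then show False using primitive_P[OF assms] by blast
qed

text \<open>For \<open>r = 1 / N\<close> this is the class of \<open>N U\<close>. Divisibility by
  \<open>p\<close> in the lattice would express \<open>P\<close> through \<open>p\<close> and
  \<open>f\<close>; the cofactor of \<open>f\<close> is at first only rational, but it is integral
  because \<open>f\<close> is monic.\<close>

lemma primitive_vector_U:
  assumes r: "r \<noteq> 0"
  shows "primitive_vector W (lat r) (cls (psmult (r * of_nat M) U) 0)"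
proof -
  have v: "cls (psmult (r * of_nat M) U) 0 = cls (psmult r (rat_poly P)) (psmult r (rat_poly 0))"
    unfolding P[symmetric] by simp
  have "cls (psmult (r * of_nat M) U) 0 \<in> lat r"
    unfolding v by (intro latI inM_memZ memZ_P)
  moreover have False if p: "prime p" and mem: "cls (psmult (r * of_nat M) U) 0 \<in> (\<lambda>w. of_nat p \<odot>\<^bsub>W\<^esub> w) ` lat r"
    for p :: nat
  proof -
    obtain c d where "cls (psmult (r * of_nat M) U) 0 = of_nat p \<odot>\<^bsub>W\<^esub> cls (psmult r c) (psmult r d)" "inM c d"
      using mem unfolding lat_def by blast
    then have cd: "cls (psmult r (rat_poly P)) 0 = cls (psmult (of_nat p) (psmult r c)) (psmult (of_nat p) (psmult r d))"
      "inM c d" unfolding v W_smult by (simp_all add: mult.commute)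
    obtain v where "psmult r (rat_poly P) = psmult (of_nat p) (psmult r c) + v * fQ"
      using cd(1) unfolding cls_eq_iff by blast
    then have "psmult (1 / r) (psmult r (rat_poly P)) = psmult (1 / r) (psmult (of_nat p) (psmult r c) + v * fQ)"
      by simp
    then have 1: "rat_poly P = psmult (of_nat p) c + psmult (1 / r) v * fQ"
      using r by (simp add: smult_add_right)
    obtain a v' where "c = rat_poly a + v' * fQ" using cd(2) unfolding inM_def by blast
    then have 2: "fQ * (psmult (of_nat p) v' + psmult (1 / r) v) = rat_poly (P - psmult (int p) a)"
      using 1 by (simp add: rat_poly_hom rat_poly_smult smult_add_right algebra_simps)
    obtain t where t: "psmult (of_nat p) v' + psmult (1 / r) v = rat_poly t"
      by (rule rat_poly_monic_quotient[OF monic_f f_pos 2])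
    have "rat_poly (f * t) = rat_poly (P - psmult (int p) a)" using 2 unfolding t rat_poly_hom .
    then have "P = psmult (int p) a + t * f" unfolding rat_poly_inject by (simp add: algebra_simps)
    then show False using not_multiple_mod_f[of "int p"] p by simp
  qed
  ultimately show ?thesis unfolding primitive_vector_def by blast
qed

end

section \<open>The compatible inner product\<close>

definition ev :: "real poly \<Rightarrow> complex \<Rightarrow> complex" where
  "ev p z = poly (map_poly of_real p) z"

lemma map_poly_of_real_simps:
  "map_poly complex_of_real (p + q) = map_poly of_real p + map_poly of_real q"
  "map_poly complex_of_real (p - q) = map_poly of_real p - map_poly of_real q"
  "map_poly complex_of_real (- p) = - map_poly of_real p"
  "map_poly complex_of_real (p * q) = map_poly of_real p * map_poly of_real q"
  "map_poly complex_of_real (psmult a p) = psmult (of_real a) (map_poly of_real p)"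
  by (rule poly_eqI; simp add: coeff_map_poly coeff_mult)+

lemma ev_simps [simp]:
  "ev (p + q) z = ev p z + ev q z" "ev (p - q) z = ev p z - ev q z" "ev (p * q) z = ev p z * ev q z"
  "ev (- p) z = - ev p z" "ev 0 z = 0" "ev 1 z = 1" "ev (psmult a p) z = of_real a * ev p z"
  "ev [:a:] z = of_real a" "ev (pCons a p) z = of_real a + z * ev p z"
  unfolding ev_def
  by (simp_all add: map_poly_of_real_simps of_real_hom.map_poly_pCons_hom)

lemma ev_cnj: "ev p (cnj z) = cnj (ev p z)"
  by (induction p) simp_all

lemma ev_sum: "ev (\<Sum>i\<in>I. p i) z = (\<Sum>i\<in>I. ev (p i) z)"
  by (induction I rule: infinite_finite_induct) simp_all

lemma ev_pcompose: "ev (pcompose p q) z = ev p (ev q z)"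
  by (induction p) (simp_all add: pcompose_pCons)

section \<open>Interpolation at the roots and the trace form\<close>

locale real_curve =
  fixes f U V R :: "real poly"
  assumes monic: "lead_coeff f = 1" and deg: "degree f > 0" and U_nz: "U \<noteq> 0"
    and UV: "U * V = f - R ^ 2" and coprime_U: "coprime U f"
    and sep: "\<And>z. ev f z = 0 \<Longrightarrow> ev (pderiv f) z \<noteq> 0"
begin

definition Z :: "complex set" where "Z = {z. ev f z = 0}"

definition fC :: "complex poly" where "fC = map_poly of_real f"

lemma fC_nz: "fC \<noteq> 0" and degree_fC: "degree fC = degree f" and monic_fC: "lead_coeff fC = 1"
proof -
  show d: "degree fC = degree f" unfolding fC_def by (simp add: degree_map_poly)
  show l: "lead_coeff fC = 1" unfolding d using monic by (simp add: fC_def coeff_map_poly)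
  show "fC \<noteq> 0" using l by auto
qed

lemma Z_eq: "Z = {z. poly fC z = 0}"
  unfolding Z_def ev_def fC_def ..

lemma finite_Z: "finite Z"
  unfolding Z_eq using poly_roots_finite[OF fC_nz] .

lemma pderiv_fC: "pderiv fC = map_poly of_real (pderiv f)"
  unfolding fC_def by (rule poly_eqI) (simp add: coeff_pderiv coeff_map_poly)

lemma rsquarefree_fC: "rsquarefree fC"
  unfolding rsquarefree_roots pderiv_fC using sep unfolding ev_def fC_def by blast

lemma fC_prod: "fC = (\<Prod>z\<in>Z. [:- z, 1:])"
  using complex_poly_decompose_rsquarefree[OF rsquarefree_fC] unfolding monic_fC Z_eq by simp

lemma card_Z: "card Z = degree f"
proof -
  have "degree fC = (\<Sum>z\<in>Z. degree [:- z, 1:])"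
    by (subst fC_prod, subst degree_prod_eq_sum_degree) auto
  then show ?thesis unfolding degree_fC by simp
qed

lemma cnj_Z: "cnj z \<in> Z \<longleftrightarrow> z \<in> Z"
  unfolding Z_def by (simp add: ev_cnj)

lemma bij_cnj: "bij_betw cnj Z Z"
  by (rule bij_betwI[of _ _ _ cnj]) (auto simp: cnj_Z)

lemma sum_cnj: "(\<Sum>z\<in>Z. h (cnj z)) = (\<Sum>z\<in>Z. h z)"
  by (rule sum.reindex_bij_betw[OF bij_cnj])

definition Q :: "complex \<Rightarrow> complex poly" where
  "Q z = (\<Prod>w\<in>Z - {z}. [:- w, 1:])"

lemma degree_Q: "z \<in> Z \<Longrightarrow> degree (Q z) = degree f - 1"
  unfolding Q_def using finite_Z card_Z by (subst degree_prod_eq_sum_degree) auto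

lemma lead_Q: "lead_coeff (Q z) = 1"
  unfolding Q_def by (simp add: lead_coeff_prod)

lemma poly_Q: "z \<in> Z \<Longrightarrow> w \<in> Z \<Longrightarrow> w \<noteq> z \<Longrightarrow> poly (Q z) w = 0"
  unfolding Q_def using finite_Z by (auto simp: poly_prod)

lemma poly_Q_self: "z \<in> Z \<Longrightarrow> poly (Q z) z = ev (pderiv f) z"
proof -
  assume z: "z \<in> Z"
  have "fC = [:- z, 1:] * Q z" unfolding fC_prod Q_def using prod.remove[OF finite_Z z] .
  then have "pderiv fC = [:- z, 1:] * pderiv (Q z) + Q z * pderiv [:- z, 1:]" by (simp only: pderiv_mult)
  then have "poly (pderiv fC) z = poly (Q z) z" by (simp add: pderiv_pCons)
  then show ?thesis unfolding pderiv_fC ev_def by simp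
qed

lemma f'_nz: "z \<in> Z \<Longrightarrow> ev (pderiv f) z \<noteq> 0"
  using sep unfolding Z_def by blast

definition lagrange :: "(complex \<Rightarrow> complex) \<Rightarrow> complex poly" where
  "lagrange h = (\<Sum>z\<in>Z. psmult (h z / ev (pderiv f) z) (Q z))"

lemma poly_lagrange: "z \<in> Z \<Longrightarrow> poly (lagrange h) z = h z"
proof -
  assume z: "z \<in> Z"
  have "poly (lagrange h) z = (\<Sum>w\<in>Z. h w / ev (pderiv f) w * poly (Q w) z)"
    unfolding lagrange_def by (simp add: poly_sum)
  also have "\<dots> = (\<Sum>w\<in>{z}. h w / ev (pderiv f) w * poly (Q w) z)"
    by (rule sum.mono_neutral_right) (use z finite_Z poly_Q in auto)
  finally show ?thesis using poly_Q_self[OF z] f'_nz[OF z] by simp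
qed

lemma degree_lagrange: "degree (lagrange h) < degree f"
proof -
  have "degree (lagrange h) \<le> degree f - 1"
    unfolding lagrange_def using degree_Q by (intro degree_sum_le finite_Z) (auto intro: order_trans[OF degree_smult_le])
  then show ?thesis using deg by linarith
qed

lemma vanish_on_Z:
  assumes "degree p < degree f" "\<And>z. z \<in> Z \<Longrightarrow> poly p z = 0" shows "p = 0"
proof (rule ccontr)
  assume "p \<noteq> 0"
  then have "card {z. poly p z = 0} \<le> degree p" by (rule card_poly_roots_bound)
  moreover have "card Z \<le> card {z. poly p z = 0}"
    by (rule card_mono[OF poly_roots_finite[OF \<open>p \<noteq> 0\<close>]]) (use assms(2) in blast)
  ultimately show False using card_Z assms(1) by linarith
qed

lemma f_dvd_iff: "f dvd p \<longleftrightarrow> (\<forall>z\<in>Z. ev p z = 0)"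
proof
  assume "f dvd p"
  then show "\<forall>z\<in>Z. ev p z = 0" unfolding Z_def by (auto elim!: dvdE)
next
  assume v: "\<forall>z\<in>Z. ev p z = 0"
  have p: "p = f * (p div f) + p mod f" by simp
  have "map_poly of_real (p mod f) = (0 :: complex poly)"
  proof (rule vanish_on_Z)
    have "f \<noteq> 0" using monic by auto
    then show "degree (map_poly of_real (p mod f) :: complex poly) < degree f"
      using degree_mod_less[of f p] deg by (auto simp: degree_map_poly)
    fix z assume z: "z \<in> Z"
    have "ev p z = ev f z * ev (p div f) z + ev (p mod f) z" by (subst p) (simp only: ev_simps)
    then show "poly (map_poly of_real (p mod f)) z = 0" using v z unfolding Z_def ev_def[symmetric] by simp
  qed
  then have "p mod f = 0" by (simp add: poly_eq_iff coeff_map_poly)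
  then show "f dvd p" by (simp add: dvd_eq_mod_eq_0)
qed

text \<open>Averaging the complex interpolant with its conjugate makes the coefficients real and, by
  the symmetry of \<open>h\<close>, keeps the values.\<close>

lemma interpolate_ex:
  assumes "\<And>z. z \<in> Z \<Longrightarrow> h (cnj z) = cnj (h z)"
  shows "\<exists>p. \<forall>z\<in>Z. ev p z = h z"
proof -
  let ?L = "lagrange h"
  have L: "map_poly of_real (map_poly Re q) = psmult (1 / 2) (q + map_poly cnj q)" for q
    by (rule poly_eqI) (simp add: coeff_map_poly complex_eq_iff)
  have c: "poly (map_poly cnj q) z = cnj (poly q (cnj z))" for q z
    by (induction q) (simp_all add: map_poly_pCons)
  have "ev (map_poly Re ?L) z = h z" if "z \<in> Z" for z
    unfolding ev_def L using that assms[OF that] by (simp add: c poly_lagrange cnj_Z)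
  then show ?thesis by blast
qed

lemma interpolate:
  assumes "\<And>z. z \<in> Z \<Longrightarrow> h (cnj z) = cnj (h z)"
  obtains p where "\<And>z. z \<in> Z \<Longrightarrow> ev p z = h z"
  using interpolate_ex[of h] assms by blast

text \<open>Euler's formula. In Lagrange interpolation each summand is a multiple of a monic
  polynomial of degree \<open>degree f - 1\<close>, so the coefficient that \<open>tau\<close> reads
  is the sum of the multipliers.\<close>

lemma tau_eq_sum: "of_real (tau f p) = (\<Sum>z\<in>Z. ev p z / ev (pderiv f) z)"
proof -
  define q where "q = p mod f"
  have "f \<noteq> 0" using monic by auto
  have "f dvd p - q" unfolding q_def by simp
  then have pq: "ev p z = ev q z" if "z \<in> Z" for z using that unfolding f_dvd_iff by simp
  have dq: "degree q < degree f" unfolding q_def using degree_mod_less[OF \<open>f \<noteq> 0\<close>, of p] deg by auto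
  have "map_poly of_real q - lagrange (ev q) = 0"
  proof (rule vanish_on_Z)
    show "degree (map_poly of_real q - lagrange (ev q)) < degree f"
      using dq degree_lagrange by (intro degree_diff_less) (auto simp: degree_map_poly)
  qed (simp add: poly_lagrange ev_def[symmetric])
  then have "map_poly of_real q = lagrange (ev q)" by simp
  then have "of_real (coeff q (degree f - 1)) = coeff (lagrange (ev q)) (degree f - 1)"
    by (metis coeff_map_poly of_real_0)
  also have "\<dots> = (\<Sum>z\<in>Z. ev q z / ev (pderiv f) z * coeff (Q z) (degree f - 1))"
    unfolding lagrange_def by (simp add: coeff_sum)
  also have "\<dots> = (\<Sum>z\<in>Z. ev p z / ev (pderiv f) z)"
  proof (rule sum.cong[OF refl])
    fix z assume z: "z \<in> Z"
    have "coeff (Q z) (degree f - 1) = 1" using lead_Q[of z] unfolding degree_Q[OF z] .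
    then show "ev q z / ev (pderiv f) z * coeff (Q z) (degree f - 1) = ev p z / ev (pderiv f) z" using pq[OF z] by simp
  qed
  finally show ?thesis unfolding tau_def q_def .
qed

section \<open>\<open>W\<^sub>D\<close> as the space of functions on the roots\<close>

lemma bezout_U: obtains s t where "s * U + t * f = 1"
  using that[of "fst (bezout_coefficients U f)" "snd (bezout_coefficients U f)"]
    bezout_coefficients_fst_snd[of U f] coprime_imp_gcd_eq_1[OF coprime_U] by simp

definition Ui :: "real poly" where "Ui = (SOME s. \<exists>t. s * U + t * f = 1)"
definition Ri :: "real poly" where "Ri = (SOME s. U dvd 1 - s * R)"

lemma Ui: "f dvd 1 - Ui * U"
proof -
  have "\<exists>t. Ui * U + t * f = 1" unfolding Ui_def by (rule someI_ex) (use bezout_U in blast)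
  then obtain t where "Ui * U + t * f = 1" by blast
  then have "1 - Ui * U = f * t" by (simp add: algebra_simps)
  then show ?thesis by simp
qed

text \<open>Modulo \<open>U\<close> the polynomial \<open>f\<close> is the square of
  \<open>R\<close>, so the Bezout coefficient \<open>t\<close> of \<open>f\<close> gives the inverse
  \<open>t * R\<close> of \<open>R\<close>.\<close>

lemma Ri: "U dvd 1 - Ri * R"
proof -
  obtain s t where st: "s * U + t * f = 1" by (rule bezout_U)
  have "(t * R) * R = t * (f - U * V)" unfolding UV by (simp add: power2_eq_square)
  then have "1 - (t * R) * R = s * U + t * f - t * (f - U * V)" unfolding st by simp
  also have "\<dots> = U * (s + t * V)" by (simp add: algebra_simps)
  finally have "U dvd 1 - (t * R) * R" by simp
  then show ?thesis unfolding Ri_def by (rule someI)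
qed

lemma ev_Ui: "z \<in> Z \<Longrightarrow> ev Ui z * ev U z = 1"
  using Ui unfolding f_dvd_iff by auto

lemma ev_U_nz: "z \<in> Z \<Longrightarrow> ev U z \<noteq> 0"
  using ev_Ui by fastforce

abbreviation "W \<equiv> W_space f U R"

text \<open>Setting \<open>y = 0\<close> identifies \<open>W\<^sub>D\<close> with \<open>A\<^sub>f\<close>, because \<open>U\<close> is coprime to \<open>f\<close>; \<open>cl\<close> is the inverse.\<close>

definition cl :: "real poly \<Rightarrow> (real poly \<times> real poly) set" where
  "cl c = W_class f U R (c, - c * Ri)"

lemma cl_coords: obtains a where "c = a * U - (- c * Ri) * R"
proof -
  obtain k where "1 - Ri * R = U * k" using Ri by blast
  then have "c * (1 - Ri * R) = c * (U * k)" by simp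
  then have "c = (c * k) * U - (- c * Ri) * R" by (simp add: algebra_simps)
  then show thesis using that by blast
qed

lemma cl_closed: "cl c \<in> carrier W"
proof -
  obtain a where "c = a * U - (- c * Ri) * R" by (rule cl_coords)
  then have "(c, - c * Ri) \<in> ideal_D U R" unfolding ideal_D_def by blast
  then show ?thesis unfolding cl_def W_space_def by simp
qed

text \<open>The first component \<open>c\<close> determines the second modulo \<open>U\<close>, as
  \<open>c = - b R\<close> there; and a multiple \<open>k U\<close> in the second place is
  \<open>y (k U)\<close>, hence zero in \<open>W\<^sub>D\<close>.\<close>

lemma W_class_cl: "W_class f U R (a * U - b * R, b) = cl (a * U - b * R)"
proof -
  obtain k where "1 - Ri * R = U * k" using Ri by blast
  then have "b * (1 - Ri * R) = b * (U * k)" by simp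
  then have "b = - (a * U - b * R) * Ri + ((b * k + a * Ri) * U - 0 * R)" by (simp add: algebra_simps)
  then show ?thesis unfolding cl_def W_class_eq_iff fst_conv snd_conv
    by (intro exI[of _ "b * k + a * Ri"] exI[of _ 0]) simp
qed

lemma carrier_W: "carrier W = range cl"
proof -
  have "carrier W \<subseteq> range cl" unfolding W_space_def ideal_D_def using W_class_cl by auto
  then show ?thesis using cl_closed by blast
qed

lemma cl_eq_iff: "cl c = cl d \<longleftrightarrow> f dvd c - d"
proof
  assume "cl c = cl d"
  then obtain b where "c = d + b * f" unfolding cl_def W_class_eq_iff by auto
  then show "f dvd c - d" by simp
next
  assume "f dvd c - d"
  then obtain b where b: "c = d + b * f" by (metis dvdE diff_add_cancel add.commute mult.commute)
  obtain k where k: "1 - Ri * R = U * k" using Ri by blast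
  have f: "f = U * V + R ^ 2" using UV by simp
  \<comment> \<open>The second components must match as well, which rests on
    \<open>R = f * Ri\<close> modulo \<open>U\<close>.\<close>
  have "R * (1 - Ri * R) = R * (U * k)" using k by simp
  then have "R - f * Ri = U * (R * k - V * Ri)" unfolding f by (simp add: algebra_simps power2_eq_square)
  then have "b * (R - f * Ri) = b * (U * (R * k - V * Ri))" by simp
  then have "- c * Ri = - d * Ri + ((b * (R * k - V * Ri)) * U - b * R)" unfolding b by (simp add: algebra_simps)
  then show "cl c = cl d" unfolding cl_def W_class_eq_iff fst_conv snd_conv using b by blast
qed

lemma cl_eq_iff_ev: "cl c = cl d \<longleftrightarrow> (\<forall>z\<in>Z. ev c z = ev d z)"
  unfolding cl_eq_iff f_dvd_iff by simp

lemma cl_add: "cl c \<oplus>\<^bsub>W\<^esub> cl d = cl (c + d)"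
  unfolding cl_def W_add by (simp add: algebra_simps)

lemma cl_smult: "k \<odot>\<^bsub>W\<^esub> cl c = cl (psmult k c)"
  unfolding cl_def W_smult by simp

lemma cl_zero: "\<zero>\<^bsub>W\<^esub> = cl 0"
  unfolding cl_def W_zero by simp

lemma W_op_cl: "W_op f U R (cl c) = cl ([:0, 1:] * c)"
  unfolding cl_def W_op_class by (simp add: algebra_simps)

section \<open>The form and weighted inner products in terms of values at the roots\<close>

definition \<epsilon> :: real where "\<epsilon> = (- 1) ^ degree U"

lemma \<epsilon>_sq: "\<epsilon> * \<epsilon> = 1"
  unfolding \<epsilon>_def by (simp flip: power_mult_distrib)

definition wt :: "complex \<Rightarrow> complex" where "wt z = ev U z * ev (pderiv f) z"

lemma wt_nz: "z \<in> Z \<Longrightarrow> wt z \<noteq> 0"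
  unfolding wt_def using ev_U_nz f'_nz by simp

lemma wt_cnj: "wt (cnj z) = cnj (wt z)"
  unfolding wt_def by (simp add: ev_cnj)

text \<open>At a root of \<open>f\<close> the term with \<open>b * b'\<close> drops out, so the
  product divided by \<open>U\<close> takes the value \<open>c d / U\<close>; then Euler's formula
  applies.\<close>

lemma W_form_cl: "of_real (W_form f U (cl c) (cl d)) = (\<Sum>z\<in>Z. of_real \<epsilon> * ev c z * ev d z / wt z)"
proof -
  define b b' where "b = - c * Ri" and "b' = - d * Ri"
  obtain a where a: "c = a * U - b * R" unfolding b_def by (rule cl_coords)
  obtain a' where a': "d = a' * U - b' * R" unfolding b'_def by (rule cl_coords)
  define q where "q = a * a' * U - (a * b' + b * a') * R - b * b' * V"
  have f: "f = U * V + R ^ 2" using UV by simp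
  have Uq: "U * q = c * d - b * b' * f"
    unfolding q_def a a' f by (simp add: algebra_simps power2_eq_square)
  have "ev U z * ev q z = ev c z * ev d z" if "z \<in> Z" for z
  proof -
    have "ev (U * q) z = ev (c * d - b * b' * f) z" unfolding Uq ..
    then show ?thesis using that unfolding Z_def by simp
  qed
  then have q: "ev q z = ev c z * ev d z / ev U z" if "z \<in> Z" for z
    using ev_U_nz[OF that] that by (simp add: field_simps)
  have "W_form f U (cl c) (cl d) = \<epsilon> * tau f q"
    unfolding cl_def b_def[symmetric] b'_def[symmetric] q_def \<epsilon>_def by (subst a, subst a') (rule W_form_class[OF UV U_nz])
  then have "of_real (W_form f U (cl c) (cl d)) = of_real \<epsilon> * (\<Sum>z\<in>Z. ev q z / ev (pderiv f) z)"
    by (simp add: tau_eq_sum)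
  also have "\<dots> = (\<Sum>z\<in>Z. of_real \<epsilon> * ev c z * ev d z / wt z)"
    unfolding sum_distrib_left wt_def by (rule sum.cong) (simp_all add: q)
  finally show ?thesis .
qed

text \<open>The inner products whose Hermitian extension is diagonal on the eigenvectors of
  \<open>x\<close>. Symmetry of the weights under conjugation makes the sums real.\<close>

definition weighted :: "(complex \<Rightarrow> real) \<Rightarrow> ((real poly \<times> real poly) set \<Rightarrow> (real poly \<times> real poly) set \<Rightarrow> real) \<Rightarrow> bool" where
  "weighted l H \<longleftrightarrow> (\<forall>z\<in>Z. l z > 0 \<and> l (cnj z) = l z) \<and>
    (\<forall>c d. complex_of_real (H (cl c) (cl d)) = (\<Sum>z\<in>Z. cnj (ev c z) * ev d z * of_real (l z)))"

lemma weighted_norm: "weighted l H \<Longrightarrow> H (cl c) (cl c) = (\<Sum>z\<in>Z. (cmod (ev c z))\<^sup>2 * l z)"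
proof -
  assume "weighted l H"
  then have "complex_of_real (H (cl c) (cl c)) = (\<Sum>z\<in>Z. cnj (ev c z) * ev c z * of_real (l z))"
    unfolding weighted_def by blast
  also have "\<dots> = of_real (\<Sum>z\<in>Z. (cmod (ev c z))\<^sup>2 * l z)"
    unfolding of_real_sum by (rule sum.cong) (simp_all add: complex_norm_square mult.commute del: of_real_power)
  finally show ?thesis unfolding of_real_eq_iff .
qed

lemma weighted_pos:
  assumes "weighted l H" "\<not> f dvd c" shows "H (cl c) (cl c) > 0"
proof -
  obtain z where z: "z \<in> Z" "ev c z \<noteq> 0" using assms(2) unfolding f_dvd_iff by blast
  have "0 < (cmod (ev c z))\<^sup>2 * l z" using z assms(1) unfolding weighted_def by simp
  also have "\<dots> \<le> (\<Sum>z\<in>Z. (cmod (ev c z))\<^sup>2 * l z)"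
    using assms(1) by (intro member_le_sum z(1) finite_Z) (auto simp: weighted_def intro: less_imp_le)
  finally show ?thesis unfolding weighted_norm[OF assms(1)] .
qed

lemma weighted_inner_product:
  assumes w: "weighted l H" shows "inner_product W H"
proof -
  have H: "complex_of_real (H (cl c) (cl d)) = (\<Sum>z\<in>Z. cnj (ev c z) * ev d z * of_real (l z))" for c d
    using w unfolding weighted_def by blast
  have add: "H (cl c \<oplus>\<^bsub>W\<^esub> cl c') (cl d) = H (cl c) (cl d) + H (cl c') (cl d)" for c c' d
  proof -
    have "complex_of_real (H (cl c \<oplus>\<^bsub>W\<^esub> cl c') (cl d)) = of_real (H (cl c) (cl d) + H (cl c') (cl d))"
      unfolding cl_add of_real_add H by (simp add: sum.distrib algebra_simps)
    then show ?thesis unfolding of_real_eq_iff .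
  qed
  have smult: "H (k \<odot>\<^bsub>W\<^esub> cl c) (cl d) = k * H (cl c) (cl d)" for k c d
  proof -
    have "complex_of_real (H (k \<odot>\<^bsub>W\<^esub> cl c) (cl d)) = of_real (k * H (cl c) (cl d))"
      unfolding cl_smult of_real_mult H by (simp add: sum_distrib_left algebra_simps)
    then show ?thesis unfolding of_real_eq_iff .
  qed
  have sym: "H (cl c) (cl d) = H (cl d) (cl c)" for c d
  proof -
    have "complex_of_real (H (cl c) (cl d)) = cnj (of_real (H (cl c) (cl d)))" by simp
    also have "\<dots> = of_real (H (cl d) (cl c))" unfolding H by (simp add: mult.commute)
    finally show ?thesis unfolding of_real_eq_iff .
  qed
  have pos: "0 < H (cl c) (cl c)" if "cl c \<noteq> \<zero>\<^bsub>W\<^esub>" for c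
    using that weighted_pos[OF w] unfolding cl_zero cl_eq_iff by simp
  show ?thesis unfolding inner_product_def carrier_W using add smult sym pos by auto
qed

lemma to_dual_inj:
  assumes H: "inner_product W H" shows "inj_on (to_dual W H) (carrier W)"
proof (rule inj_onI)
  fix v w assume vw: "v \<in> carrier W" "w \<in> carrier W" "to_dual W H v = to_dual W H w"
  obtain c d where cd: "v = cl c" "w = cl d" using vw(1,2) unfolding carrier_W by blast
  have add: "H (u \<oplus>\<^bsub>W\<^esub> x) y = H u y + H x y" if "u \<in> carrier W" "x \<in> carrier W" "y \<in> carrier W" for u x y
    using conjunct1[OF H[unfolded inner_product_def]] that by simp
  have "H (cl d \<oplus>\<^bsub>W\<^esub> cl (c - d)) (cl (c - d)) = H (cl d) (cl (c - d)) + H (cl (c - d)) (cl (c - d))"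
    by (rule add) (rule cl_closed)+
  moreover have "H v (cl (c - d)) = H w (cl (c - d))"
    using fun_cong[OF vw(3), of "cl (c - d)"] cl_closed unfolding to_dual_def by simp
  ultimately have "H (cl (c - d)) (cl (c - d)) = 0" unfolding cd cl_add by simp
  moreover have "\<forall>v\<in>carrier W. v \<noteq> \<zero>\<^bsub>W\<^esub> \<longrightarrow> 0 < H v v" using H unfolding inner_product_def by simp
  ultimately have "cl (c - d) = \<zero>\<^bsub>W\<^esub>" using cl_closed[of "c - d"] by force
  then show "v = w" unfolding cd cl_zero cl_eq_iff by simp
qed

abbreviation "phi H \<equiv> \<lambda>v. inv_into (carrier W) (to_dual W H) (to_dual W (W_form f U) v)"

text \<open>Solving \<open>cnj d * l = \<epsilon> * c / wt\<close> at each root. On values the map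
  is conjugation followed by a factor, so it is only real linear.\<close>

lemma phi_cl:
  assumes w: "weighted l H" and d: "\<And>z. z \<in> Z \<Longrightarrow> ev d z = of_real \<epsilon> * cnj (ev c z) / (cnj (wt z) * of_real (l z))"
  shows "phi H (cl c) = cl d"
proof (rule inv_into_f_eq[OF to_dual_inj[OF weighted_inner_product[OF w]] cl_closed])
  have "H (cl d) (cl e) = W_form f U (cl c) (cl e)" for e
  proof -
    have "complex_of_real (H (cl d) (cl e)) = (\<Sum>z\<in>Z. cnj (ev d z) * ev e z * of_real (l z))"
      using w unfolding weighted_def by blast
    also have "\<dots> = (\<Sum>z\<in>Z. of_real \<epsilon> * ev c z * ev e z / wt z)"
    proof (rule sum.cong[OF refl])
      fix z assume z: "z \<in> Z"
      have "l z \<noteq> 0" using w z unfolding weighted_def by fastforce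
      then show "cnj (ev d z) * ev e z * of_real (l z) = of_real \<epsilon> * ev c z * ev e z / wt z"
        using wt_nz[OF z] unfolding d[OF z] by (simp add: field_simps)
    qed
    also have "\<dots> = of_real (W_form f U (cl c) (cl e))" unfolding W_form_cl ..
    finally show ?thesis unfolding of_real_eq_iff .
  qed
  then show "to_dual W H (cl d) = to_dual W (W_form f U) (cl c)"
    unfolding to_dual_def carrier_W by (auto simp: restrict_def fun_eq_iff)
qed

lemma phi_exists:
  assumes w: "weighted l H"
  obtains d where "\<And>z. z \<in> Z \<Longrightarrow> ev d z = of_real \<epsilon> * cnj (ev c z) / (cnj (wt z) * of_real (l z))" "phi H (cl c) = cl d"
proof -
  obtain d where "\<And>z. z \<in> Z \<Longrightarrow> ev d z = of_real \<epsilon> * cnj (ev c z) / (cnj (wt z) * of_real (l z))"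
    by (rule interpolate[of "\<lambda>z. of_real \<epsilon> * cnj (ev c z) / (cnj (wt z) * of_real (l z))"])
      (use w in \<open>auto simp: weighted_def ev_cnj wt_cnj\<close>)
  then show thesis using that phi_cl[OF w] by blast
qed

text \<open>The weight for which the factor in \<open>phi_cl\<close> has modulus 1, as compatibility
  requires.\<close>

definition \<kappa> :: "complex \<Rightarrow> real" where "\<kappa> z = 1 / cmod (wt z)"

lemma \<kappa>_pos: "z \<in> Z \<Longrightarrow> \<kappa> z > 0" unfolding \<kappa>_def using wt_nz by simp
lemma \<kappa>_cnj: "\<kappa> (cnj z) = \<kappa> z" unfolding \<kappa>_def wt_cnj by simp

text \<open>The chosen representatives do not matter, as only their values at the roots enter. The
  value 0 outside the carrier matches \<open>H_inner\<close>.\<close>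

definition H0 :: "(real poly \<times> real poly) set \<Rightarrow> (real poly \<times> real poly) set \<Rightarrow> real" where
  "H0 v w = (if v \<in> carrier W \<and> w \<in> carrier W
     then Re (\<Sum>z\<in>Z. cnj (ev (SOME c. v = cl c) z) * ev (SOME c. w = cl c) z * of_real (\<kappa> z)) else 0)"

lemma weighted_H0: "weighted \<kappa> H0"
proof -
  have some: "ev (SOME c'. cl c = cl c') z = ev c z" if "z \<in> Z" for c z
  proof -
    have "cl c = cl (SOME c'. cl c = cl c')" by (rule someI[of _ c]) simp
    then show ?thesis using that unfolding cl_eq_iff_ev by simp
  qed
  have "complex_of_real (H0 (cl c) (cl d)) = (\<Sum>z\<in>Z. cnj (ev c z) * ev d z * of_real (\<kappa> z))" for c d
  proof -
    let ?s = "\<Sum>z\<in>Z. cnj (ev c z) * ev d z * of_real (\<kappa> z)"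
    have "cnj ?s = (\<Sum>z\<in>Z. cnj (ev c (cnj z)) * ev d (cnj z) * of_real (\<kappa> (cnj z)))"
      by (simp add: ev_cnj \<kappa>_cnj)
    also have "\<dots> = ?s" by (rule sum_cnj)
    finally have "cnj ?s = ?s" .
    then have "?s \<in> \<real>" unfolding Reals_cnj_iff .
    then have "of_real (Re ?s) = ?s" by (rule of_real_Re)
    moreover have "H0 (cl c) (cl d) = Re ?s"
      unfolding H0_def using cl_closed some by (simp cong: sum.cong)
    ultimately show ?thesis by simp
  qed
  then show ?thesis unfolding weighted_def using \<kappa>_pos \<kappa>_cnj by blast
qed

lemma module_homI:
  assumes "\<And>c. S (cl c) \<in> carrier W" "\<And>c d. S (cl (c + d)) = S (cl c) \<oplus>\<^bsub>W\<^esub> S (cl d)"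
    "\<And>k c. S (cl (psmult k c)) = k \<odot>\<^bsub>W\<^esub> S (cl c)"
  shows "S \<in> module_hom class_ring W W"
  unfolding module_hom_def using assms by (auto simp: carrier_W cl_add cl_smult)

lemma compatible_H0: "compatible W (W_form f U) H0"
  unfolding compatible_def isometry_def
proof (intro conjI ballI)
  note w = weighted_H0
  have phi: "\<exists>d. phi H0 (cl c) = cl d \<and> (\<forall>z\<in>Z. ev d z = of_real \<epsilon> * cnj (ev c z) / (cnj (wt z) * of_real (\<kappa> z)))" for c
    using phi_exists[OF w, of c] by metis
  then obtain D where D: "\<And>c. phi H0 (cl c) = cl (D c)"
    "\<And>c z. z \<in> Z \<Longrightarrow> ev (D c) z = of_real \<epsilon> * cnj (ev c z) / (cnj (wt z) * of_real (\<kappa> z))" by metis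
  have unit: "cnj (of_real \<epsilon> / (cnj (wt z) * of_real (\<kappa> z))) * (of_real \<epsilon> / (cnj (wt z) * of_real (\<kappa> z))) = 1" if "z \<in> Z" for z
  proof -
    have "wt z * cnj (wt z) * (of_real (\<kappa> z) * of_real (\<kappa> z)) = 1"
      using wt_nz[OF that] unfolding \<kappa>_def by (simp add: complex_norm_square[symmetric] power2_eq_square)
    moreover have "complex_of_real \<epsilon> * of_real \<epsilon> = 1" using \<epsilon>_sq by (metis of_real_1 of_real_mult)
    ultimately show ?thesis by (simp add: mult.assoc mult.left_commute)
  qed
  show "phi H0 \<in> module_hom class_ring W W"
    by (rule module_homI; unfold D(1) cl_add cl_smult cl_eq_iff_ev)
      (auto simp: D(2) cl_closed add_divide_distrib algebra_simps)
  have iso: "H0 (phi H0 (cl c)) (phi H0 (cl d)) = H0 (cl c) (cl d)" for c d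
  proof -
    have H: "complex_of_real (H0 (cl c) (cl d)) = (\<Sum>z\<in>Z. cnj (ev c z) * ev d z * of_real (\<kappa> z))" for c d
      using w unfolding weighted_def by blast
    \<comment> \<open>The factor has modulus 1 and drops out, while the conjugation of values
      conjugates the whole sum, which is real.\<close>
    have "complex_of_real (H0 (cl (D c)) (cl (D d))) = (\<Sum>z\<in>Z. ev c z * cnj (ev d z) * of_real (\<kappa> z))"
      unfolding H
    proof (rule sum.cong[OF refl])
      fix z assume z: "z \<in> Z"
      define u where "u = of_real \<epsilon> / (cnj (wt z) * of_real (\<kappa> z))"
      have "ev (D e) z = u * cnj (ev e z)" for e unfolding D(2)[OF z] u_def by simp
      then have "cnj (ev (D c) z) * ev (D d) z = (cnj u * u) * (ev c z * cnj (ev d z))" by (simp add: ac_simps)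
      then show "cnj (ev (D c) z) * ev (D d) z * of_real (\<kappa> z) = ev c z * cnj (ev d z) * of_real (\<kappa> z)"
        using unit[OF z] unfolding u_def by simp
    qed
    also have "\<dots> = cnj (of_real (H0 (cl c) (cl d)))" unfolding H by simp
    also have "\<dots> = of_real (H0 (cl c) (cl d))" by simp
    finally show ?thesis unfolding D(1) of_real_eq_iff .
  qed
  then show "H0 (phi H0 v) (phi H0 x) = H0 v x" if "v \<in> carrier W" "x \<in> carrier W" for v x
    using that unfolding carrier_W by auto
  show "bij_betw (phi H0) (carrier W) (carrier W)"
    unfolding bij_betw_def
  proof
    show "inj_on (phi H0) (carrier W)"
    proof (rule inj_onI)
      fix v x assume vx: "v \<in> carrier W" "x \<in> carrier W" "phi H0 v = phi H0 x"
      obtain c d where cd: "v = cl c" "x = cl d" using vx(1,2) unfolding carrier_W by blast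
      have "ev c z = ev d z" if z: "z \<in> Z" for z
      proof -
        have "ev (D c) z = ev (D d) z" using vx(3) z unfolding cd D(1) cl_eq_iff_ev by blast
        moreover have "\<epsilon> \<noteq> 0" using \<epsilon>_sq by auto
        ultimately show ?thesis using wt_nz[OF z] \<kappa>_pos[OF z] unfolding D(2)[OF z] by simp
      qed
      then show "v = x" unfolding cd cl_eq_iff_ev by blast
    qed
    show "phi H0 ` carrier W = carrier W"
    proof
      show "phi H0 ` carrier W \<subseteq> carrier W"
      proof (rule image_subsetI)
        fix v assume "v \<in> carrier W"
        then obtain c where v: "v = cl c" unfolding carrier_W by blast
        show "phi H0 v \<in> carrier W" unfolding v D(1) by (rule cl_closed)
      qed
      show "carrier W \<subseteq> phi H0 ` carrier W"
      proof
        fix v assume "v \<in> carrier W"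
        then obtain d where d: "v = cl d" unfolding carrier_W by blast
        \<comment> \<open>The equation of \<open>phi_cl\<close> solved for \<open>c\<close>.\<close>
        obtain c where c: "\<And>z. z \<in> Z \<Longrightarrow> ev c z = of_real \<epsilon> * cnj (ev d z) * (wt z * of_real (\<kappa> z))"
          by (rule interpolate[of "\<lambda>z. of_real \<epsilon> * cnj (ev d z) * (wt z * of_real (\<kappa> z))"])
            (auto simp: ev_cnj wt_cnj \<kappa>_cnj)
        have "ev (D c) z = ev d z" if z: "z \<in> Z" for z
        proof -
          have "complex_of_real \<epsilon> * of_real \<epsilon> = 1" using \<epsilon>_sq by (metis of_real_1 of_real_mult)
          then show ?thesis using wt_nz[OF z] \<kappa>_pos[OF z] unfolding D(2)[OF z] c[OF z]
            by (simp flip: mult.assoc)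
        qed
        then have "v = phi H0 (cl c)" unfolding d D(1) cl_eq_iff_ev by simp
        then show "v \<in> phi H0 ` carrier W" using cl_closed by blast
      qed
    qed
  qed
qed

text \<open>The adjoint is multiplication by a real polynomial \<open>s\<close> that takes the value
  \<open>cnj z\<close> at each root \<open>z\<close>.\<close>

lemma commutes_H0: "commutes_with_adjoint W H0 (W_op f U R)"
proof -
  obtain s where s: "\<And>z. z \<in> Z \<Longrightarrow> ev s z = cnj z" by (rule interpolate[of cnj]) auto
  define S where "S v = cl (s * (SOME c. v = cl c))" for v
  have S: "S (cl c) = cl (s * c)" for c
  proof -
    have "cl c = cl (SOME c'. cl c = cl c')" by (rule someI[of _ c]) simp
    then show ?thesis unfolding S_def cl_eq_iff_ev by simp
  qed
  have hom: "S \<in> module_hom class_ring W W"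
    by (rule module_homI) (simp_all add: S cl_closed cl_add cl_smult algebra_simps)
  have H: "complex_of_real (H0 (cl c) (cl d)) = (\<Sum>z\<in>Z. cnj (ev c z) * ev d z * of_real (\<kappa> z))" for c d
    using weighted_H0 unfolding weighted_def by blast
  have adj: "H0 (W_op f U R (cl c)) (cl d) = H0 (cl c) (S (cl d))" for c d
  proof -
    have "complex_of_real (H0 (W_op f U R (cl c)) (cl d)) = of_real (H0 (cl c) (S (cl d)))"
      unfolding W_op_cl S H by (rule sum.cong) (simp_all add: s)
    then show ?thesis unfolding of_real_eq_iff .
  qed
  have "W_op f U R (S (cl c)) = S (W_op f U R (cl c))" for c
    unfolding W_op_cl S by (simp only: ac_simps)
  with adj show ?thesis unfolding commutes_with_adjoint_def carrier_W
    by (intro bexI[OF _ hom]) blast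
qed

text \<open>
  For uniqueness: the adjoint of multiplication by \<open>x\<close> commutes with it, hence is multiplication by some
  \<open>s\<close>, so \<open>H(c, d) = \<lambda>(c(s) d)\<close> for a linear form \<open>\<lambda>\<close>, and \<open>\<lambda>\<close> is a combination of evaluations at the
  roots. Positivity on the real and imaginary parts \<open>A\<close>, \<open>B\<close> of the characteristic function of
  a root forces \<open>s(\<omega>)\<close> to be the complex conjugate of \<open>\<omega>\<close> and the weights to be positive.
\<close>

lemma normal_imp_weighted:
  assumes H: "inner_product W H" and T: "commutes_with_adjoint W H (W_op f U R)"
  shows "\<exists>l. weighted l H"
proof -
  define h where "h c d = H (cl c) (cl d)" for c d
  note Hd = H[unfolded inner_product_def]
  have h_add: "h (c + c') d = h c d + h c' d" for c c' d
    using conjunct1[OF Hd] cl_closed by (simp add: h_def flip: cl_add)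
  have h_smult: "h (psmult k c) d = k * h c d" for k c d
    using conjunct1[OF conjunct2[OF Hd]] cl_closed by (simp add: h_def flip: cl_smult)
  have h_sym: "h c d = h d c" for c d
    using conjunct1[OF conjunct2[OF conjunct2[OF Hd]]] cl_closed by (simp add: h_def)
  have h_pos: "0 < h c c" if "\<not> f dvd c" for c
  proof -
    have "cl c \<noteq> \<zero>\<^bsub>W\<^esub>" using that unfolding cl_zero cl_eq_iff by simp
    then show ?thesis using conjunct2[OF conjunct2[OF conjunct2[OF Hd]]] cl_closed by (simp add: h_def)
  qed
  have h_cong: "h c d = h c' d'" if "\<And>z. z \<in> Z \<Longrightarrow> ev c z = ev c' z" "\<And>z. z \<in> Z \<Longrightarrow> ev d z = ev d' z" for c d c' d'
  proof -
    have "cl c = cl c'" "cl d = cl d'" unfolding cl_eq_iff_ev using that by blast+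
    then show ?thesis unfolding h_def by simp
  qed
  have h_add_right: "h c (d + d') = h c d + h c d'" for c d d' using h_add h_sym by metis
  have h_smult_right: "h c (psmult k d) = k * h c d" for k c d using h_smult h_sym by metis
  have h_0: "h 0 d = 0" for d using h_smult[of 0 0 d] by simp
  obtain S where S: "S \<in> module_hom class_ring W W"
    "\<And>v w. v \<in> carrier W \<Longrightarrow> w \<in> carrier W \<Longrightarrow> H (W_op f U R v) w = H v (S w)"
    "\<And>v. v \<in> carrier W \<Longrightarrow> W_op f U R (S v) = S (W_op f U R v)"
    using T unfolding commutes_with_adjoint_def by blast
  have S_car: "S (cl c) \<in> carrier W" for c using S(1) cl_closed unfolding module_hom_def by blast
  have S_add: "S (cl (c + d)) = S (cl c) \<oplus>\<^bsub>W\<^esub> S (cl d)" for c d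
    unfolding cl_add[symmetric] by (rule module_hom_add[OF S(1) cl_closed cl_closed])
  have S_smult: "S (cl (psmult k c)) = k \<odot>\<^bsub>W\<^esub> S (cl c)" for k c
    unfolding cl_smult[symmetric] by (rule module_hom_smult[OF S(1) _ cl_closed]) (simp add: class_ring_simps)
  obtain s where s: "S (cl 1) = cl s" using S_car[of 1] unfolding carrier_W by blast
  have S_cl: "S (cl c) = cl (c * s)" for c
  proof (induction c)
    case 0
    obtain e where "S (cl 0) = cl e" using S_car[of 0] unfolding carrier_W by blast
    then show ?case using S_smult[of 0 0] by (simp add: cl_smult)
  next
    case (pCons a c)
    have p: "pCons a c = psmult a 1 + [:0, 1:] * c" by simp
    have "S (cl ([:0, 1:] * c)) = cl ([:0, 1:] * (c * s))"
      using S(3)[OF cl_closed, of c] unfolding pCons.IH W_op_cl ..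
    then have "S (cl (pCons a c)) = cl (psmult a s + [:0, 1:] * (c * s))"
      unfolding p S_add S_smult s cl_smult by (simp only: cl_add)
    then show ?case by simp
  qed
  have h_x: "h ([:0, 1:] * c) d = h c (d * s)" for c d
    using S(2)[OF cl_closed cl_closed] unfolding h_def W_op_cl S_cl .
  \<comment> \<open>Moving a polynomial in \<open>x\<close> to the other argument replaces
    \<open>x\<close> by its adjoint \<open>s\<close>.\<close>
  have h_p: "h (p * c) d = h c (pcompose p s * d)" for p c d
  proof (induction p arbitrary: d)
    case 0
    then show ?case using h_0 h_sym[of c 0] by simp
  next
    case (pCons a p)
    have "h (pCons a p * c) d = h (psmult a c + [:0, 1:] * (p * c)) d" by simp
    also have "\<dots> = a * h c d + h c (pcompose p s * (d * s))"
      unfolding h_add h_smult h_x pCons.IH ..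
    also have "\<dots> = h c (pcompose (pCons a p) s * d)"
      unfolding h_smult_right[symmetric] h_add_right[symmetric] by (simp add: pcompose_pCons algebra_simps)
    finally show ?case .
  qed
  define \<delta> where "\<delta> w z = (if z = w then 1 else 0 :: complex)" for w z :: complex
  have \<delta>_cnj: "\<delta> w (cnj z) = \<delta> (cnj w) z" "cnj (\<delta> w z) = \<delta> w z" for w z
    unfolding \<delta>_def by (metis complex_cnj_cnj, simp)
  have "\<exists>A. \<forall>z\<in>Z. ev A z = (\<delta> w z + \<delta> (cnj w) z) / 2" for w
    by (rule interpolate_ex) (simp add: \<delta>_cnj add.commute)
  then obtain A where A: "\<And>w z. z \<in> Z \<Longrightarrow> ev (A w) z = (\<delta> w z + \<delta> (cnj w) z) / 2" by metis
  have "\<exists>B. \<forall>z\<in>Z. ev B z = - (\<i> / 2) * (\<delta> w z - \<delta> (cnj w) z)" for w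
    by (rule interpolate_ex) (simp add: \<delta>_cnj algebra_simps)
  then obtain B where B: "\<And>w z. z \<in> Z \<Longrightarrow> ev (B w) z = - (\<i> / 2) * (\<delta> w z - \<delta> (cnj w) z)" by metis
  have AB: "ev (A w) z + \<i> * ev (B w) z = \<delta> w z" "ev (A w) z - \<i> * ev (B w) z = \<delta> (cnj w) z" if "z \<in> Z" for w z
    unfolding A[OF that] B[OF that] by (simp_all add: field_simps)
  have sum_\<delta>: "(\<Sum>w\<in>Z. k w * \<delta> w z) = k z" "(\<Sum>w\<in>Z. k w * \<delta> (cnj w) z) = k (cnj z)"
    "(\<Sum>w\<in>Z. k w * \<delta> z w) = k z" if "z \<in> Z" for k :: "complex \<Rightarrow> complex" and z
  proof -
    have "(\<Sum>w\<in>Z. k w * \<delta> w z) = (\<Sum>w\<in>Z. if w = z then k w else 0)" by (rule sum.cong) (auto simp: \<delta>_def)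
    then show "(\<Sum>w\<in>Z. k w * \<delta> w z) = k z" using that finite_Z by simp
    have "(\<Sum>w\<in>Z. k w * \<delta> (cnj w) z) = (\<Sum>w\<in>Z. if w = cnj z then k w else 0)" by (rule sum.cong) (auto simp: \<delta>_def)
    then show "(\<Sum>w\<in>Z. k w * \<delta> (cnj w) z) = k (cnj z)" using that finite_Z cnj_Z by simp
    have "(\<Sum>w\<in>Z. k w * \<delta> z w) = (\<Sum>w\<in>Z. if w = z then k w else 0)" by (rule sum.cong) (auto simp: \<delta>_def)
    then show "(\<Sum>w\<in>Z. k w * \<delta> z w) = k z" using that finite_Z by simp
  qed
  \<comment> \<open>The complex linear extension of \<open>h 1\<close>, evaluated at the
    characteristic function of \<open>w\<close>.\<close>
  define m where "m w = complex_of_real (h 1 (A w)) + \<i> * complex_of_real (h 1 (B w))" for w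
  have m_cnj: "m (cnj w) = cnj (m w)" for w
  proof -
    have "h 1 (A (cnj w)) = h 1 (A w)" by (rule h_cong) (simp_all add: A add.commute)
    moreover have "h 1 (B (cnj w)) = h 1 (psmult (- 1) (B w))"
      by (rule h_cong) (simp_all add: B algebra_simps)
    ultimately show ?thesis unfolding m_def h_smult_right by simp
  qed
  have lin: "complex_of_real (h 1 q) = (\<Sum>z\<in>Z. ev q z * m z)" for q
  proof -
    have h_sum: "h 1 (\<Sum>w\<in>X. p w) = (\<Sum>w\<in>X. h 1 (p w))" for p and X :: "complex set"
      by (induction X rule: infinite_finite_induct) (simp_all add: h_add_right h_sym[of 1 0] h_0)
    \<comment> \<open>The real part of the expansion of \<open>q\<close> into characteristic
      functions; it is all of \<open>q\<close> because the values of \<open>q\<close> are symmetric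
      under conjugation.\<close>
    define q' where "q' = (\<Sum>w\<in>Z. psmult (Re (ev q w)) (A w) + psmult (- Im (ev q w)) (B w))"
    have "ev q z = ev q' z" if z: "z \<in> Z" for z
    proof -
      have "ev q' z = (\<Sum>w\<in>Z. ev q w / 2 * \<delta> w z + cnj (ev q w) / 2 * \<delta> (cnj w) z)"
        unfolding q'_def ev_sum
      proof (rule sum.cong[OF refl])
        fix w
        have c: "ev q w = of_real (Re (ev q w)) + \<i> * of_real (Im (ev q w))" by (rule complex_eq)
        have d: "cnj (ev q w) = of_real (Re (ev q w)) - \<i> * of_real (Im (ev q w))" by (simp add: complex_eq_iff)
        show "ev (psmult (Re (ev q w)) (A w) + psmult (- Im (ev q w)) (B w)) z =
          ev q w / 2 * \<delta> w z + cnj (ev q w) / 2 * \<delta> (cnj w) z"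
          unfolding d ev_simps A[OF z] B[OF z] by (subst (3) c) (simp add: diff_divide_distrib add_divide_distrib algebra_simps)
      qed
      also have "\<dots> = ev q z / 2 + cnj (ev q (cnj z)) / 2" unfolding sum.distrib sum_\<delta>[OF z] ..
      finally show ?thesis by (simp add: ev_cnj)
    qed
    then have "h 1 q = h 1 q'" by (intro h_cong) simp_all
    also have "\<dots> = Re (\<Sum>w\<in>Z. ev q w * m w)"
      unfolding q'_def h_sum h_add_right h_smult_right m_def by (simp add: Re_sum)
    finally have 1: "h 1 q = Re (\<Sum>w\<in>Z. ev q w * m w)" .
    have "cnj (\<Sum>w\<in>Z. ev q w * m w) = (\<Sum>w\<in>Z. ev q (cnj w) * m (cnj w))" by (simp add: ev_cnj m_cnj)
    also have "\<dots> = (\<Sum>w\<in>Z. ev q w * m w)" by (rule sum_cnj)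
    finally have "(\<Sum>w\<in>Z. ev q w * m w) \<in> \<real>" unfolding Reals_cnj_iff .
    then show ?thesis unfolding 1 by (rule of_real_Re)
  qed
  have h_eq: "complex_of_real (h c d) = (\<Sum>z\<in>Z. ev c (ev s z) * ev d z * m z)" for c d
    using lin[of "pcompose c s * d"] h_p[of c 1 d] by (simp add: ev_pcompose)
  \<comment> \<open>Multiplication by \<open>f\<close> is zero, so its adjoint, multiplication by
    \<open>pcompose f s\<close>, is zero too; hence \<open>s\<close> maps roots to roots.\<close>
  have sZ: "ev s z \<in> Z" if z: "z \<in> Z" for z
  proof -
    have "h c (pcompose f s) = 0" for c
    proof -
      have "h (f * c) 1 = h 0 1" by (rule h_cong) (simp_all add: Z_def)
      then show ?thesis using h_p[of f c 1] h_0 by simp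
    qed
    then have "f dvd pcompose f s" using h_pos[of "pcompose f s"] by (metis less_irrefl)
    then show ?thesis using z unfolding f_dvd_iff ev_pcompose Z_def by blast
  qed
  have key: "ev s (cnj w) = w \<and> (\<exists>k>0. m (cnj w) = complex_of_real k)" if w: "w \<in> Z" for w
  proof -
    have cw: "cnj w \<in> Z" using w cnj_Z by blast
    have "ev (A w) w \<noteq> 0" unfolding A[OF w] \<delta>_def by simp
    then have "\<not> f dvd A w" unfolding f_dvd_iff using w by blast
    then have "h (A w) (A w) > 0" by (rule h_pos)
    moreover have "h (B w) (B w) \<ge> 0"
    proof (cases "f dvd B w")
      case True
      then have "h (B w) (B w) = h 0 (B w)" unfolding f_dvd_iff by (intro h_cong) simp_all
      then show ?thesis using h_0 by simp
    qed (use h_pos in force)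
    ultimately have pos: "h (A w) (A w) + h (B w) (B w) > 0" by simp
    \<comment> \<open>The added imaginary part is 0 by symmetry. It completes the sum to the
      Hermitian norm of the characteristic function of \<open>w\<close>, in which only
      \<open>z = cnj w\<close> survives.\<close>
    have "complex_of_real (h (A w) (A w) + h (B w) (B w)) =
      of_real (h (A w) (A w)) + of_real (h (B w) (B w)) + \<i> * (of_real (h (B w) (A w)) - of_real (h (A w) (B w)))"
      using h_sym[of "A w" "B w"] by simp
    also have "\<dots> = (\<Sum>z\<in>Z. (ev (A w) (ev s z) + \<i> * ev (B w) (ev s z)) * (ev (A w) z - \<i> * ev (B w) z) * m z)"
      unfolding h_eq sum_distrib_left sum_subtractf[symmetric] sum.distrib[symmetric]
      by (rule sum.cong) (simp_all add: algebra_simps)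
    also have "\<dots> = (\<Sum>z\<in>Z. (\<delta> w (ev s z) * m z) * \<delta> (cnj w) z)"
      by (rule sum.cong) (simp_all add: AB sZ)
    also have "\<dots> = \<delta> w (ev s (cnj w)) * m (cnj w)" by (rule sum_\<delta>(3)[OF cw])
    finally have eq: "complex_of_real (h (A w) (A w) + h (B w) (B w)) = \<delta> w (ev s (cnj w)) * m (cnj w)" .
    have "ev s (cnj w) = w"
    proof (rule ccontr)
      assume "ev s (cnj w) \<noteq> w"
      then have "complex_of_real (h (A w) (A w) + h (B w) (B w)) = 0" unfolding eq \<delta>_def by simp
      then show False using pos unfolding of_real_eq_0_iff by simp
    qed
    moreover from this have "m (cnj w) = complex_of_real (h (A w) (A w) + h (B w) (B w))" unfolding eq \<delta>_def by simp
    ultimately show ?thesis using pos by blast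
  qed
  have s_eq: "ev s z = cnj z" and m_eq: "Re (m z) > 0 \<and> m z = of_real (Re (m z))" if "z \<in> Z" for z
    using key[of "cnj z"] that cnj_Z by auto
  have "weighted (\<lambda>z. Re (m z)) H" unfolding weighted_def
  proof (intro conjI ballI allI)
    fix z assume "z \<in> Z"
    then show "Re (m z) > 0" using m_eq by blast
    show "Re (m (cnj z)) = Re (m z)" unfolding m_cnj by simp
  next
    fix c d
    show "complex_of_real (H (cl c) (cl d)) = (\<Sum>z\<in>Z. cnj (ev c z) * ev d z * of_real (Re (m z)))"
      unfolding h_def[symmetric] h_eq by (rule sum.cong) (use m_eq s_eq in \<open>simp_all add: ev_cnj\<close>)
  qed
  then show ?thesis by blast
qed

text \<open>The isometry condition is tested on the characteristic function of
  \<open>{z0, cnj z0}\<close>, the smallest support around \<open>z0\<close> open to a real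
  polynomial. Both points contribute equally, which leaves one equation for
  \<open>l z0\<close>.\<close>

lemma compatible_weight:
  assumes w: "weighted l H" and c: "compatible W (W_form f U) H" and z0: "z0 \<in> Z"
  shows "l z0 = \<kappa> z0"
proof -
  have l: "l z > 0" "l (cnj z) = l z" if "z \<in> Z" for z using w that unfolding weighted_def by blast+
  have cnj_eq: "cnj z = z0 \<longleftrightarrow> z = cnj z0" for z by (metis complex_cnj_cnj)
  have "\<exists>c. \<forall>z\<in>Z. ev c z = (if z = z0 \<or> z = cnj z0 then 1 else 0)"
    by (rule interpolate_ex) (auto simp: cnj_eq)
  then obtain c where c1: "\<And>z. z \<in> Z \<Longrightarrow> ev c z = (if z = z0 \<or> z = cnj z0 then 1 else 0)" by blast
  obtain d where d: "\<And>z. z \<in> Z \<Longrightarrow> ev d z = of_real \<epsilon> * cnj (ev c z) / (cnj (wt z) * of_real (l z))" "phi H (cl c) = cl d"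
    using phi_exists[OF w, of c] by metis
  have "\<bar>\<epsilon>\<bar> = 1" unfolding \<epsilon>_def by simp
  then have d_norm: "(cmod (ev d z))\<^sup>2 * l z = (cmod (ev c z))\<^sup>2 * ((\<kappa> z)\<^sup>2 / l z)" if "z \<in> Z" for z
    unfolding d(1)[OF that] \<kappa>_def using l(1)[OF that]
    by (simp add: norm_mult norm_divide power_mult_distrib power_divide power2_eq_square)
  have "H (cl d) (cl d) = H (cl c) (cl c)"
    using assms(2) cl_closed unfolding compatible_def isometry_def d(2)[symmetric] by blast
  then have "(\<Sum>z\<in>Z. (cmod (ev c z))\<^sup>2 * ((\<kappa> z)\<^sup>2 / l z)) = (\<Sum>z\<in>Z. (cmod (ev c z))\<^sup>2 * l z)"
    unfolding weighted_norm[OF w] using d_norm by simp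
  then have "(\<Sum>z\<in>Z. (cmod (ev c z))\<^sup>2 * ((\<kappa> z)\<^sup>2 / l z - l z)) = 0"
    by (simp add: right_diff_distrib sum_subtractf)
  moreover have "(\<Sum>z\<in>Z. (cmod (ev c z))\<^sup>2 * ((\<kappa> z)\<^sup>2 / l z - l z)) = (\<Sum>z\<in>{z0, cnj z0}. (\<kappa> z)\<^sup>2 / l z - l z)"
    by (rule sum.mono_neutral_cong_right[OF finite_Z]) (use z0 cnj_Z c1 in auto)
  moreover have "(\<kappa> (cnj z0))\<^sup>2 / l (cnj z0) - l (cnj z0) = (\<kappa> z0)\<^sup>2 / l z0 - l z0"
    unfolding \<kappa>_cnj l(2)[OF z0] ..
  ultimately have "(\<kappa> z0)\<^sup>2 / l z0 - l z0 = 0" by (cases "z0 = cnj z0") auto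
  then have "(\<kappa> z0)\<^sup>2 = (l z0)\<^sup>2" using l(1)[OF z0] by (simp add: field_simps power2_eq_square)
  then show ?thesis using l(1)[OF z0] \<kappa>_pos[OF z0] by (simp add: power2_eq_iff_nonneg)
qed

lemma H_inner_eq_H0: "H_inner W (W_form f U) (W_op f U R) = H0"
  unfolding H_inner_def
proof (rule the_equality)
  show "inner_product W H0 \<and> compatible W (W_form f U) H0 \<and> commutes_with_adjoint W H0 (W_op f U R) \<and>
    (\<forall>v w. v \<notin> carrier W \<or> w \<notin> carrier W \<longrightarrow> H0 v w = 0)"
    using weighted_inner_product[OF weighted_H0] compatible_H0 commutes_H0 unfolding H0_def[of v w for v w] by auto
next
  fix H
  assume H: "inner_product W H \<and> compatible W (W_form f U) H \<and> commutes_with_adjoint W H (W_op f U R) \<and>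
    (\<forall>v w. v \<notin> carrier W \<or> w \<notin> carrier W \<longrightarrow> H v w = 0)"
  obtain l where l: "weighted l H" using normal_imp_weighted H by blast
  have "H (cl c) (cl d) = H0 (cl c) (cl d)" for c d
  proof -
    have "complex_of_real (H (cl c) (cl d)) = (\<Sum>z\<in>Z. cnj (ev c z) * ev d z * of_real (l z))"
      using l unfolding weighted_def by blast
    also have "\<dots> = (\<Sum>z\<in>Z. cnj (ev c z) * ev d z * of_real (\<kappa> z))"
      by (rule sum.cong) (use compatible_weight[OF l] H in auto)
    also have "\<dots> = of_real (H0 (cl c) (cl d))" using weighted_H0 unfolding weighted_def by simp
    finally show ?thesis unfolding of_real_eq_iff .
  qed
  then have "H v w = H0 v w" if "v \<in> carrier W" "w \<in> carrier W" for v w using that unfolding carrier_W by blast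
  moreover have "H v w = H0 v w" if "v \<notin> carrier W \<or> w \<notin> carrier W" for v w
    using that H unfolding H0_def by auto
  ultimately show "H = H0" by blast
qed

text \<open>The weight \<open>1 / |U f'|\<close> cancels one of the two factors \<open>|U|\<close>
  in the squared value.\<close>

lemma H_inner_multiple_U:
  "H_inner W (W_form f U) (W_op f U R) (W_class f U R (psmult a U, 0)) (W_class f U R (psmult a U, 0)) =
    a\<^sup>2 * (\<Sum>z\<in>Z. cmod (ev U z) / cmod (ev (pderiv f) z))"
proof -
  have "W_class f U R (psmult a U, 0) = cl (psmult a U)"
    using W_class_cl[of "[:a:]" 0] by simp
  then have "H_inner W (W_form f U) (W_op f U R) (W_class f U R (psmult a U, 0)) (W_class f U R (psmult a U, 0)) =
    (\<Sum>z\<in>Z. (cmod (ev (psmult a U) z))\<^sup>2 * \<kappa> z)"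
    unfolding H_inner_eq_H0 using weighted_norm[OF weighted_H0] by simp
  also have "\<dots> = (\<Sum>z\<in>Z. a\<^sup>2 * (cmod (ev U z) / cmod (ev (pderiv f) z)))"
    by (rule sum.cong) (auto simp: \<kappa>_def wt_def norm_mult power_mult_distrib power2_eq_square dest: ev_U_nz)
  finally show ?thesis unfolding sum_distrib_left .
qed

end

section \<open>Change of coefficient field and the theorem\<close>

lemma of_real_of_rat: "complex_of_real (of_rat x) = of_rat x"
  by (cases x) (simp add: of_rat_rat)

lemma real_poly_smult: "real_poly (psmult c p) = psmult (of_rat c) (real_poly p)"
  by (rule poly_eqI) (simp add: coeff_map_poly of_rat_mult)

lemma ev_real_poly: "ev (real_poly p) z = poly (map_poly of_rat p) z"
proof -
  have "map_poly complex_of_real (real_poly p) = map_poly of_rat p"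
    by (rule poly_eqI) (simp add: coeff_map_poly of_real_of_rat)
  then show ?thesis unfolding ev_def by simp
qed

lemma ev_int_poly: "ev (real_poly (rat_poly f)) z = poly (map_poly of_int f) z"
proof -
  have "map_poly of_rat (rat_poly f) = (map_poly of_int f :: complex poly)"
    by (rule poly_eqI) (simp add: coeff_map_poly)
  then show ?thesis unfolding ev_real_poly by simp
qed

lemma pderiv_real_poly: "pderiv (real_poly (rat_poly f)) = real_poly (rat_poly (pderiv f))"
  by (rule poly_eqI) (simp add: coeff_pderiv coeff_map_poly of_rat_mult del: of_nat_Suc)

lemma bezout_poly:
  fixes p q :: "rat poly"
  assumes "coprime p q" obtains s t where "s * p + t * q = 1"
  using that[of "fst (bezout_coefficients p q)" "snd (bezout_coefficients p q)"]
    bezout_coefficients_fst_snd[of p q] coprime_imp_gcd_eq_1[OF assms] by simp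

lemma coprime_real_poly:
  assumes "coprime p q" shows "coprime (real_poly p) (real_poly q)"
proof -
  obtain s t where "s * p + t * q = 1" using assms by (rule bezout_poly)
  then have "real_poly (s * p + t * q) = real_poly 1" by simp
  then have st: "real_poly s * real_poly p + real_poly t * real_poly q = 1"
    unfolding real_poly_arith by simp
  show ?thesis
  proof (rule coprimeI)
    fix d assume "d dvd real_poly p" "d dvd real_poly q"
    then show "is_unit d" unfolding st[symmetric] by (intro dvd_add dvd_mult)
  qed
qed

text \<open>The resultant commutes with passing to complex coefficients, where a common root of
  \<open>f\<close> and its derivative would make it vanish.\<close>

lemma poly_disc_separable:
  fixes f :: "int poly"
  assumes "lead_coeff f = 1" "poly_disc f \<noteq> 0" "poly (map_poly of_int f) (z::complex) = 0"
  shows "poly (map_poly of_int (pderiv f)) z \<noteq> 0"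
proof
  assume z: "poly (map_poly of_int (pderiv f)) z = 0"
  let ?f = "map_poly of_int f :: complex poly" and ?g = "map_poly of_int (pderiv f) :: complex poly"
  have "resultant f (pderiv f) \<noteq> 0" using assms(1,2) unfolding poly_disc_def by auto
  then have "resultant ?f ?g \<noteq> 0" unfolding of_int_hom.resultant_hom by simp
  then have "degree (gcd ?f ?g) = 0" using resultant_0_gcd by blast
  moreover have dvd: "[:- z, 1:] dvd gcd ?f ?g" using z assms(3) by (simp add: poly_eq_0_iff_dvd)
  moreover have "?f \<noteq> 0" using assms(1) by auto
  then have "gcd ?f ?g \<noteq> 0" by simp
  ultimately show False using dvd_imp_degree_le[OF dvd] by simp
qed

theorem theorem4p10:
  fixes g :: nat and f :: "int poly" and U V R :: "rat poly" and M :: nat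
  assumes "g \<ge> 1"
    and "degree f = 2 * g + 1" and "lead_coeff f = 1" and "coeff f (2 * g) = 0"
    and "poly_disc f \<noteq> 0"
    and "mumford_triple g (map_poly of_int f) U V R"
    and "M = (LEAST n :: nat. 0 < n \<and> (\<exists>P :: int poly. Polynomial.smult (of_nat n) U = map_poly of_int P))"
  shows "(\<exists>N :: nat. M = N ^ 2) \<and>
    (coprime U (map_poly of_int f) \<longrightarrow>
      (let fQ = map_poly of_int f;
           W = W_space fQ U R;
           T = W_op fQ U R
       in \<exists>M_D. Z_lattice W (W_form fQ U) M_D \<and> T ` M_D \<subseteq> M_D \<and>
            (\<exists>v. primitive_vector W M_D v \<and>
               1 / 2 * ln (H_TD fQ U R (W_base_change fQ U R v) (W_base_change fQ U R v)) =
               1 / 2 * ln (real M) +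
               1 / 2 * ln (\<Sum>\<omega>\<in>#proots (map_poly of_int f :: complex poly).
                 cmod (poly (map_poly of_rat U) \<omega>) /
                 cmod (poly (pderiv (map_poly of_int f)) \<omega>)))))"
proof -
  define I where "I n \<longleftrightarrow> 0 < n \<and> (\<exists>P. psmult (of_nat n) U = rat_poly P)" for n
  have M_def: "M = (LEAST n. I n)" using assms(7) unfolding I_def .
  obtain d q where d: "d > 0" "psmult (of_int d) U = rat_poly q" by (rule clear_denominators)
  then have "I (nat d)" unfolding I_def by (auto intro!: exI[of _ q])
  then have "I M" unfolding M_def by (rule LeastI)
  have M_min: "M \<le> n" if "I n" for n unfolding M_def using that by (rule Least_le)
  obtain P where P: "M > 0" "psmult (of_nat M) U = rat_poly P" using \<open>I M\<close> unfolding I_def by blast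
  have U: "lead_coeff U = 1" "degree U \<le> g" "U * V = rat_poly f - R ^ 2" "R = 0 \<or> degree R < degree U"
    using assms(6) unfolding mumford_triple_def by auto
  \<comment> \<open>The minimality of \<open>M\<close> is used here: a prime \<open>p\<close>
    dividing \<open>P\<close> divides its leading coefficient \<open>M\<close>, and
    \<open>M / p\<close> would already clear the denominators of \<open>U\<close>.\<close>
  have prim: "\<not> [:p:] dvd P" if p: "prime p" for p :: int
  proof
    assume "[:p:] dvd P"
    then obtain P' where P': "P = psmult p P'" unfolding const_dvd_iff_smult by blast
    have "p > 1" using p by (simp add: prime_gt_1_int)
    have "of_nat M * lead_coeff U = coeff (rat_poly P) (degree U)" unfolding P(2)[symmetric] by simp
    then have "(of_int (int M) :: rat) = of_int (p * coeff P' (degree U))" using U(1) by (simp add: P' coeff_map_poly)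
    then have Mp: "int M = p * coeff P' (degree U)" unfolding of_int_eq_iff .
    define n where "n = nat (coeff P' (degree U))"
    have "0 < p * coeff P' (degree U)" unfolding Mp[symmetric] using P(1) by simp
    then have pos: "coeff P' (degree U) > 0" using \<open>p > 1\<close> by (simp add: zero_less_mult_iff)
    then have n: "int M = p * int n" "n > 0" unfolding n_def using Mp by simp_all
    have "psmult (of_int p) (psmult (of_nat n) U) = psmult (of_int p) (rat_poly P')"
    proof -
      have "(of_nat M :: rat) = of_int p * of_nat n" using arg_cong[OF n(1), of "of_int :: int \<Rightarrow> rat"] by simp
      then show ?thesis using P(2) unfolding P' rat_poly_smult by simp
    qed
    then have "psmult (of_int p) (psmult (of_nat n) U - rat_poly P') = 0" by (simp only: smult_diff_right)
    then have "psmult (of_nat n) U = rat_poly P'" using \<open>p > 1\<close> by (simp only: smult_eq_0_iff) auto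
    then have "I n" unfolding I_def using n(2) by blast
    then have "M \<le> n" by (rule M_min)
    moreover have "int n < int M" using n \<open>p > 1\<close> by simp
    ultimately show False by simp
  qed
  interpret mumford_int g f U V R P M
    by unfold_locales (use assms(2,3) U P prim in auto)
  obtain N where N: "M = N ^ 2" using M_square by blast
  have "N > 0" using N M_pos by (cases N) auto
  have main: "\<exists>M_D. Z_lattice W (W_form fQ U) M_D \<and> W_op fQ U R ` M_D \<subseteq> M_D \<and>
    (\<exists>v. primitive_vector W M_D v \<and>
       1 / 2 * ln (H_TD fQ U R (W_base_change fQ U R v) (W_base_change fQ U R v)) =
       1 / 2 * ln (real M) +
       1 / 2 * ln (\<Sum>\<omega>\<in>#proots (map_poly of_int f :: complex poly).
         cmod (poly (map_poly of_rat U) \<omega>) / cmod (poly (pderiv (map_poly of_int f)) \<omega>)))"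
    if cop: "coprime U fQ"
  proof -
    define r :: rat where "r = 1 / of_nat N"
    have r: "r\<^sup>2 = 1 / of_nat M" "r \<noteq> 0" "r * of_nat M = of_nat N"
      using \<open>N > 0\<close> unfolding r_def N by (simp_all add: power2_eq_square)
    define v where "v = cls (psmult (r * of_nat M) U) 0"
    interpret C: real_curve "real_poly fQ" "real_poly U" "real_poly V" "real_poly R"
    proof
      show "lead_coeff (real_poly fQ) = 1" using monic_f by (simp add: degree_map_poly coeff_map_poly)
      show "degree (real_poly fQ) > 0" using f_pos by (simp add: degree_map_poly)
      show "real_poly U \<noteq> 0" using U_nz by (simp add: poly_eq_iff coeff_map_poly)
      show "real_poly U * real_poly V = real_poly fQ - real_poly R ^ 2"
        using arg_cong[OF UV, of real_poly] by (simp add: real_poly_arith power2_eq_square)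
      show "coprime (real_poly U) (real_poly fQ)" by (rule coprime_real_poly[OF cop])
      show "ev (pderiv (real_poly fQ)) z \<noteq> 0" if "ev (real_poly fQ) z = 0" for z
        using poly_disc_separable[OF assms(3,5), of z] that unfolding pderiv_real_poly ev_int_poly by blast
    qed
    let ?fC = "map_poly of_int f :: complex poly"
    have fC: "C.fC = ?fC"
      unfolding C.fC_def by (rule poly_eqI) (simp add: coeff_map_poly)
    have Z: "C.Z = {z. poly ?fC z = 0}" unfolding C.Z_eq fC ..
    \<comment> \<open>The roots are simple, so the sum over the multiset of roots is the sum over
      the set.\<close>
    have "proots ?fC = mset_set C.Z"
    proof (rule multiset_eqI)
      fix z
      have "rsquarefree ?fC" using C.rsquarefree_fC unfolding fC .
      then have "order z ?fC = 0 \<or> order z ?fC = 1" unfolding rsquarefree_def by blast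
      moreover have "?fC \<noteq> 0" using C.fC_nz unfolding fC .
      ultimately show "count (proots ?fC) z = count (mset_set C.Z) z"
        using C.finite_Z unfolding Z by (auto simp: order_root count_mset_set')
    qed
    moreover have "pderiv ?fC = map_poly of_int (pderiv f)"
      by (rule poly_eqI) (simp add: coeff_pderiv coeff_map_poly)
    ultimately have S: "(\<Sum>\<omega>\<in>#proots ?fC. cmod (poly (map_poly of_rat U) \<omega>) / cmod (poly (pderiv ?fC) \<omega>)) =
      (\<Sum>z\<in>C.Z. cmod (ev (real_poly U) z) / cmod (ev (pderiv (real_poly fQ)) z))"
      unfolding pderiv_real_poly ev_int_poly ev_real_poly[of U] by (simp add: sum_unfold_sum_mset)
    have "C.Z \<noteq> {}" using C.card_Z C.deg by auto
    then have S_pos: "(\<Sum>z\<in>C.Z. cmod (ev (real_poly U) z) / cmod (ev (pderiv (real_poly fQ)) z)) > 0"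
      using C.finite_Z C.ev_U_nz C.f'_nz by (intro sum_pos) auto
    have "W_base_change fQ U R v = W_class (real_poly fQ) (real_poly U) (real_poly R) (psmult (real N) (real_poly U), 0)"
      unfolding v_def W_base_change_class r(3) by (simp add: real_poly_smult)
    then have "H_TD fQ U R (W_base_change fQ U R v) (W_base_change fQ U R v) =
      (real N)\<^sup>2 * (\<Sum>z\<in>C.Z. cmod (ev (real_poly U) z) / cmod (ev (pderiv (real_poly fQ)) z))"
      unfolding H_TD_def using C.H_inner_multiple_U by simp
    then have "ln (H_TD fQ U R (W_base_change fQ U R v) (W_base_change fQ U R v)) =
      ln (real M) + ln (\<Sum>\<omega>\<in>#proots ?fC. cmod (poly (map_poly of_rat U) \<omega>) / cmod (poly (pderiv ?fC) \<omega>))"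
      unfolding S using S_pos \<open>N > 0\<close> by (simp add: N ln_mult_pos)
    then have height: "1 / 2 * ln (H_TD fQ U R (W_base_change fQ U R v) (W_base_change fQ U R v)) =
       1 / 2 * ln (real M) +
       1 / 2 * ln (\<Sum>\<omega>\<in>#proots ?fC. cmod (poly (map_poly of_rat U) \<omega>) / cmod (poly (pderiv ?fC) \<omega>))"
      by (simp only: distrib_left)
    have "primitive_vector W (lat r) v" unfolding v_def by (rule primitive_vector_U[OF r(2)])
    with height show ?thesis
      using Z_lattice_lat[OF r(1)] W_op_lattice by (intro exI[of _ "lat r"] conjI exI[of _ v])
  qed
  show ?thesis unfolding Let_def
  proof (intro conjI impI)
    show "\<exists>N. M = N ^ 2" using N by blast
  qed (rule main)
qed

end
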